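(* Let $K \ge 2$. The information metric of the family of Concrete distributions $C(\boldsymbol\beta,\tau)$, expressed in the $K+1$ (redundant) parameters $(\theta_1,\ldots,\theta_K,\theta_{K+1}) = (\beta_1,\ldots,\beta_K,\tau)$, is $$ ds^2 = \frac{(K-1)(K\pi^2/6+1) + \frac12\sum_{i=1}^K\sum_{j=1}^K(\log\beta_i-\log\beta_j)^2}{(K+1)\tau^2}\, d\tau^2 + 2\sum_{i=1}^K \frac{\sum_{j=1}^K\log\beta_j - K\log\beta_i}{(K+1)\tau\beta_i}\, d\beta_i\, d\tau + \sum_{i=1}^K\sum_{j=1}^K \frac{K\delta_{ij}-1}{(K+1)\beta_i\beta_j}\, d\beta_i\, d\beta_j . $$
   Context: The simplex is $S_K = \{(x_1,\ldots,x_K)\in\mathbb{R}^K : \sum_{i=1}^K x_i = 1,\ x_i\ge 0\}$; integrals and densities on $S_K$ are with respect to Lebesgue measure $dx_1\cdots dx_{K-1}$ in the first $K-1$ coordinates, with $x_K = 1-\sum_{i=1}^{K-1}x_i$. For $\boldsymbol\beta=(\beta_1,\ldots,\beta_K)$ with all $\beta_i>0$ and $\tau>0$, the Concrete distribution $C(\boldsymbol\beta,\tau)$ is the probability distribution on $S_K$ with density $$f(\mathbf x) = \frac{(K-1)!\,\tau^{K-1}}{(\sum_{j=1}^K\beta_j/x_j^\tau)^K}\prod_{i=1}^K\frac{\beta_i}{x_i^{\tau+1}} .$$ It is invariant under $\boldsymbol\beta\to\lambda\boldsymbol\beta$, $\lambda>0$; no normalization constraint on $\boldsymbol\beta$ is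 imposed here. The information metric is the symmetric 2-tensor $ds^2=\sum_{A=1}^{K+1}\sum_{B=1}^{K+1} I_{AB}\,d\theta_A\,d\theta_B$ where, treating $\theta_1,\ldots,\theta_{K+1}$ as unconstrained positive variables, $$I_{AB} = \mathbb{E}\Big(\frac{\partial\log f}{\partial\theta_A}\frac{\partial\log f}{\partial\theta_B}\Big) = -\mathbb{E}\Big(\frac{\partial^2\log f}{\partial\theta_A\,\partial\theta_B}\Big),$$ the expectation being over $\mathbf X\sim C(\boldsymbol\beta,\tau)$. (The matrix $(I_{AB})$ is degenerate because one parameter is redundant.) $\delta_{ij}$ is the Kronecker delta. *)

theory Defs
  imports "HOL-Probability.Probability"
begin

text \<open>Points of the simplex are functions on the index set \<open>{1..K}\<close> (extensional, i.e.
  \<open>undefined\<close> elsewhere), as in the library's product measures \<open>\<Pi>\<^sub>M i\<in>{1..K}. _\<close>.\<close>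

definition prob_simplex :: "nat \<Rightarrow> (nat \<Rightarrow> real) set" where
  "prob_simplex K = {x \<in> extensional {1..K}. (\<Sum>i=1..K. x i) = 1 \<and> (\<forall>i\<in>{1..K}. 0 \<le> x i)}"

definition complete_last :: "nat \<Rightarrow> (nat \<Rightarrow> real) \<Rightarrow> (nat \<Rightarrow> real)" where
  "complete_last K y = y(K := 1 - (\<Sum>i=1..K-1. y i))"

text \<open>Lebesgue measure \<open>dx\<^sub>1 \<dots> dx\<^bsub>K-1\<^esub>\<close> in the first \<open>K - 1\<close> coordinates, carried to the
  simplex by \<open>x\<^sub>K = 1 - x\<^sub>1 - \<dots> - x\<^bsub>K-1\<^esub>\<close>.\<close>

definition simplex_lebesgue :: "nat \<Rightarrow> (nat \<Rightarrow> real) measure" where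
  "simplex_lebesgue K =
     distr (restrict_space (\<Pi>\<^sub>M i\<in>{1..K-1}. lborel) {y. complete_last K y \<in> prob_simplex K})
           (restrict_space (\<Pi>\<^sub>M i\<in>{1..K}. borel) (prob_simplex K))
           (complete_last K)"

text \<open>On the faces \<open>x\<^sub>i = 0\<close>, a null set, the formula takes a junk value
  (\<open>0 powr a = 0\<close> and division by zero is zero).\<close>

definition concrete_density :: "nat \<Rightarrow> (nat \<Rightarrow> real) \<Rightarrow> real \<Rightarrow> (nat \<Rightarrow> real) \<Rightarrow> real" where
  "concrete_density K \<beta> \<tau> x =
     fact (K-1) * \<tau>^(K-1) / (\<Sum>j=1..K. \<beta> j / x j powr \<tau>)^K
       * (\<Prod>i=1..K. \<beta> i / x i powr (\<tau> + 1))"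

definition concrete :: "nat \<Rightarrow> (nat \<Rightarrow> real) \<Rightarrow> real \<Rightarrow> (nat \<Rightarrow> real) measure" where
  "concrete K \<beta> \<tau> = density (simplex_lebesgue K) (\<lambda>x. ennreal (concrete_density K \<beta> \<tau> x))"

text \<open>The coordinate tuple \<open>(\<beta>\<^sub>1, \<dots>, \<beta>\<^sub>K, \<tau>)\<close>, used both for parameters and for their
  differentials.\<close>

definition coords :: "nat \<Rightarrow> (nat \<Rightarrow> real) \<Rightarrow> real \<Rightarrow> (nat \<Rightarrow> real)" where
  "coords K \<beta> \<tau> = \<beta>(K + 1 := \<tau>)"

definition pderiv_at :: "nat \<Rightarrow> ((nat \<Rightarrow> real) \<Rightarrow> real) \<Rightarrow> (nat \<Rightarrow> real) \<Rightarrow> real" where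
  "pderiv_at A g \<theta> = deriv (\<lambda>t. g (\<theta>(A := t))) (\<theta> A)"

text \<open>\<open>concrete_density\<close> and \<open>concrete\<close> evaluate their \<open>\<beta>\<close> only on \<open>{1..K}\<close>, so the whole
  tuple \<open>\<theta>\<close> can be passed for it.\<close>

definition log_lik :: "nat \<Rightarrow> (nat \<Rightarrow> real) \<Rightarrow> (nat \<Rightarrow> real) \<Rightarrow> real" where
  "log_lik K x \<theta> = ln (concrete_density K \<theta> (\<theta> (K + 1)) x)"

definition score_prod :: "nat \<Rightarrow> (nat \<Rightarrow> real) \<Rightarrow> nat \<Rightarrow> nat \<Rightarrow> (nat \<Rightarrow> real) \<Rightarrow> real" where
  "score_prod K \<theta> A B x = pderiv_at A (log_lik K x) \<theta> * pderiv_at B (log_lik K x) \<theta>"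

definition log_lik_hess :: "nat \<Rightarrow> (nat \<Rightarrow> real) \<Rightarrow> nat \<Rightarrow> nat \<Rightarrow> (nat \<Rightarrow> real) \<Rightarrow> real" where
  "log_lik_hess K \<theta> A B x = pderiv_at A (pderiv_at B (log_lik K x)) \<theta>"

definition fisher_info :: "nat \<Rightarrow> (nat \<Rightarrow> real) \<Rightarrow> nat \<Rightarrow> nat \<Rightarrow> real" where
  "fisher_info K \<theta> A B = (\<integral>x. score_prod K \<theta> A B x \<partial>concrete K \<theta> (\<theta> (K + 1)))"

text \<open>The symmetric 2-tensor \<open>ds\<^sup>2\<close> at \<open>\<theta>\<close>, as a quadratic form in the differentials
  \<open>d\<theta>\<close>.\<close>

definition info_metric :: "nat \<Rightarrow> (nat \<Rightarrow> real) \<Rightarrow> (nat \<Rightarrow> real) \<Rightarrow> real" where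
  "info_metric K \<theta> d\<theta> = (\<Sum>A=1..K+1. \<Sum>B=1..K+1. fisher_info K \<theta> A B * d\<theta> A * d\<theta> B)"

end

theory Submission
  imports Defs
begin

text \<open>If \<open>E\<^sub>1, \<dots>, E\<^sub>K\<close> are independent standard exponential variables, then the normalization of
  \<open>y\<^sub>i = (\<beta>\<^sub>i / E\<^sub>i) powr (1 / \<tau>)\<close>, a vector of independent Frechet variables, is Concrete, and at this
  point the weights \<open>w\<^sub>i = \<beta>\<^sub>i x\<^sub>i\<^sup>-\<^sup>\<tau> / \<Sum>\<^sub>j \<beta>\<^sub>j x\<^sub>j\<^sup>-\<^sup>\<tau>\<close> that govern score and Hessian are \<open>E\<^sub>i / S\<close> with
  \<open>S = \<Sum>\<^sub>j E\<^sub>j\<close>. Since \<open>S\<close> is independent of the direction, the expectation of a function of \<open>x\<close> is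
  unchanged under the weight \<open>S\<^sup>2 / (K (K + 1))\<close>. With this weight the products of scores and the Hessian
  become polynomials in the \<open>E\<^sub>i\<close> and their logarithms, whose expectations reduce to
  \<open>\<Gamma>, \<Gamma>', \<Gamma>''\<close> at \<open>1, 2, 3\<close>.\<close>

section \<open>Logarithmic moments of the exponential distribution\<close>

text \<open>The weight has to be quadratic because a score is linear in the ratios
  \<open>E\<^sub>i / S\<close>, so that products of two scores and Hessian entries have denominator
  \<open>S\<^sup>2\<close> and nothing worse. Multiplying by \<open>S\<^sup>2\<close> clears it
  exactly, and the troublesome expectations of ratios become expectations of sums of products of
  functions of single coordinates. The constant K (K + 1) is the second moment of S, a Gamma
  variable of shape K; the K + 1 in the denominators of the metric originates here. Independence of
  S and the direction is never stated by itself: it is contained in the radial integral, where the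
  weight merely raises an exponent from K - 1 to K + 1 and hence turns (K - 1)! into (K + 1)!. The
  radius is taken to be the sum of the coordinates, which fits the simplex and reduces the change of
  variables to a translation and a scaling.\<close>

abbreviation exp1 :: "real measure" where
  "exp1 \<equiv> density lborel (exponential_density 1)"

lemma prob_space_exp1: "prob_space exp1"
  by (rule prob_space_exponential_density) simp

lemma AE_exp1_pos: "AE t in exp1. t > 0"
proof -
  have "AE t in lborel. t \<noteq> (0::real)" by (rule AE_lborel_singleton)
  then show ?thesis
    by (subst AE_density) (auto simp: exponential_density_def)
qed

lemma has_bochner_integral_exp1_powr:
  assumes "s > 0"
  shows "has_bochner_integral exp1 (\<lambda>t. t powr (s - 1)) (Gamma s)"
proof (rule has_bochner_integral_nn_integral)
  have "(\<integral>\<^sup>+t. ennreal (t powr (s - 1)) \<partial>exp1) =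
      (\<integral>\<^sup>+t. ennreal (exponential_density 1 t) * ennreal (t powr (s - 1)) \<partial>lborel)"
    by (subst nn_integral_density) auto
  also have "\<dots> = (\<integral>\<^sup>+t. ennreal (indicator {0..} t * t powr (s - 1) / exp t) \<partial>lborel)"
    by (intro nn_integral_cong)
       (auto simp: exponential_density_def exp_minus field_simps simp flip: ennreal_mult' split: split_indicator)
  finally show "(\<integral>\<^sup>+t. ennreal (t powr (s - 1)) \<partial>exp1) = ennreal (Gamma s)"
    by (simp add: Gamma_conv_nn_integral_real[OF assms])
qed (use assms in \<open>auto intro!: Gamma_real_pos less_imp_le\<close>)

text \<open>A single term of the exponential series is at most the whole sum. Taken at u = ln t,
  this trades any power of |ln t| for t^\<epsilon> + t^-\<epsilon> at the cost of a
  constant.\<close>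

lemma abs_power_le_exp:
  fixes u \<epsilon> :: real
  assumes "\<epsilon> > 0"
  shows "\<bar>u\<bar> ^ n \<le> fact n / \<epsilon> ^ n * exp (\<epsilon> * \<bar>u\<bar>)"
proof -
  have "(\<epsilon> * \<bar>u\<bar>) ^ n / fact n \<le> exp (\<epsilon> * \<bar>u\<bar>)"
  proof -
    have "(\<lambda>k. (\<epsilon> * \<bar>u\<bar>) ^ k /\<^sub>R fact k) sums exp (\<epsilon> * \<bar>u\<bar>)"
      by (rule exp_converges)
    then have "(\<Sum>k\<in>{n}. (\<epsilon> * \<bar>u\<bar>) ^ k /\<^sub>R fact k) \<le> exp (\<epsilon> * \<bar>u\<bar>)"
      using assms sum_le_suminf[of "\<lambda>k. (\<epsilon> * \<bar>u\<bar>) ^ k /\<^sub>R fact k" "{n}"]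
      by (auto simp: sums_iff)
    then show ?thesis by (simp add: field_simps)
  qed
  then show ?thesis using assms by (simp add: field_simps power_mult_distrib)
qed

lemma exp_mult_abs_ln_le:
  fixes t \<epsilon> :: real
  assumes "t > 0"
  shows "exp (\<epsilon> * \<bar>ln t\<bar>) \<le> t powr \<epsilon> + t powr (- \<epsilon>)"
  using assms by (cases "ln t \<ge> 0") (auto simp: powr_def)

text \<open>Taken at u = h ln t, this bounds the difference quotient (t^h - 1) / h by |ln t| e^|h ln
  t|.\<close>

lemma abs_exp_minus_one_le: "\<bar>exp u - 1\<bar> \<le> \<bar>u\<bar> * exp \<bar>u\<bar>" for u :: real
proof (cases "u \<ge> 0")
  case True
  have "1 - u \<le> exp (- u)" using exp_ge_add_one_self[of "- u"] by simp
  then have "(1 - u) * exp u \<le> exp (- u) * exp u" by (intro mult_right_mono) auto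
  then have "exp u - 1 \<le> u * exp u" by (simp add: algebra_simps flip: exp_add)
  then show ?thesis using True by auto
next
  case False
  have "1 + u \<le> exp u" by (rule exp_ge_add_one_self)
  moreover have "\<bar>u\<bar> * 1 \<le> \<bar>u\<bar> * exp \<bar>u\<bar>" by (intro mult_left_mono) auto
  moreover have "exp u \<le> 1" using False by simp
  ultimately show ?thesis using False by linarith
qed

text \<open>The exponents s + s/2 and s - s/2 are both positive, so the two terms integrate to Gamma
  values. The margin s/2 is what later estimates may spend on logarithms and on a shift of the
  exponent.\<close>

lemma integrable_exp1_dominating:
  assumes "s > 0"
  shows "integrable exp1 (\<lambda>t. t powr (s - 1) * (t powr (s/2) + t powr (- (s/2))))"
proof -
  have "integrable exp1 (\<lambda>t. t powr ((s + s/2) - 1) + t powr ((s - s/2) - 1))"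
    using assms has_bochner_integral_exp1_powr[of "s + s/2"] has_bochner_integral_exp1_powr[of "s - s/2"]
    by (intro Bochner_Integration.integrable_add) (auto simp: has_bochner_integral_iff)
  then show ?thesis
    by (rule integrable_cong_AE_imp)
       (auto intro!: AE_mp[OF AE_exp1_pos] AE_I2 simp: powr_add[symmetric] algebra_simps)
qed

text \<open>This is the n-th derivative of Gamma at s > 0, in the form obtained by differentiating
  under Euler's integral.\<close>

definition log_moment :: "nat \<Rightarrow> real \<Rightarrow> real" where
  "log_moment n s = (\<integral>t. t powr (s - 1) * ln t ^ n \<partial>exp1)"

lemma integrable_log_moment:
  assumes "s > 0"
  shows "integrable exp1 (\<lambda>t. t powr (s - 1) * ln t ^ n)"
proof (rule Bochner_Integration.integrable_bound)
  let ?C = "fact n / (s/2) ^ n"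
  show "integrable exp1 (\<lambda>t. ?C * (t powr (s - 1) * (t powr (s/2) + t powr (- (s/2)))))"
    by (intro integrable_mult_right integrable_exp1_dominating assms)
  show "AE t in exp1. norm (t powr (s - 1) * ln t ^ n) \<le> norm (?C * (t powr (s - 1) * (t powr (s/2) + t powr (- (s/2)))))"
    using AE_exp1_pos
  proof eventually_elim
    fix t :: real assume t: "t > 0"
    have "\<bar>ln t\<bar> ^ n \<le> ?C * exp (s/2 * \<bar>ln t\<bar>)" using assms by (intro abs_power_le_exp) auto
    also have "\<dots> \<le> ?C * (t powr (s/2) + t powr (- (s/2)))"
      using assms t by (intro mult_left_mono exp_mult_abs_ln_le) auto
    finally have "t powr (s - 1) * \<bar>ln t\<bar> ^ n \<le> t powr (s - 1) * (?C * (t powr (s/2) + t powr (- (s/2))))"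
      by (intro mult_left_mono) auto
    then show "norm (t powr (s - 1) * ln t ^ n) \<le> norm (?C * (t powr (s - 1) * (t powr (s/2) + t powr (- (s/2)))))"
      using assms by (simp add: abs_mult power_abs mult_ac)
  qed
qed auto

text \<open>Differentiation under the integral, with dominated convergence applied along an
  arbitrary sequence of increments tending to 0.\<close>

lemma DERIV_log_moment:
  assumes s: "s > 0"
  shows "(log_moment n has_real_derivative log_moment (Suc n) s) (at s)"
proof -
  define D where "D = (\<lambda>h t. t powr (s - 1) * ln t ^ n * ((t powr h - 1) / h))"
  \<comment> \<open>The exponent s/4 is spent twice: once to absorb |ln t|^(n+1), once on the growth
    of t^h with |h| \<le> s/4. Together they exhaust the s/2 of the dominating function.\<close>
  define C :: real where "C = fact (Suc n) / (s/4) ^ Suc n"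
  have lim: "(\<lambda>h. (log_moment n (s + h) - log_moment n s) / h) \<midarrow>0\<rightarrow> log_moment (Suc n) s"
    unfolding tendsto_at_iff_sequentially
  proof (intro allI impI, unfold comp_def)
    fix X :: "nat \<Rightarrow> real" assume X0: "\<forall>i. X i \<in> UNIV - {0}" and X: "X \<longlonglongrightarrow> 0"
    have "\<forall>\<^sub>F i in sequentially. \<bar>X i\<bar> < s / 4"
      using tendstoD[OF X, of "s/4"] s by (auto simp: dist_real_def)
    \<comment> \<open>Dominated convergence asks for the bound at every index, so the sequence is
      shifted past the increments that are too large; \<open>LIMSEQ_offset\<close> undoes the
      shift.\<close>
    then obtain M where M: "\<And>i. i \<ge> M \<Longrightarrow> \<bar>X i\<bar> < s / 4"
      by (auto simp: eventually_sequentially)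
    have "(\<lambda>i. \<integral>t. D (X (i + M)) t \<partial>exp1) \<longlonglongrightarrow> (\<integral>t. t powr (s - 1) * ln t ^ Suc n \<partial>exp1)"
    proof (rule integral_dominated_convergence)
      show "integrable exp1 (\<lambda>t. C * (t powr (s - 1) * (t powr (s/2) + t powr (- (s/2)))))"
        by (intro integrable_mult_right integrable_exp1_dominating s)
      show "AE t in exp1. (\<lambda>i. D (X (i + M)) t) \<longlonglongrightarrow> t powr (s - 1) * ln t ^ Suc n"
        using AE_exp1_pos
      proof eventually_elim
        fix t :: real assume t: "t > 0"
        have "((\<lambda>h. t powr h) has_real_derivative ln t) (at 0)"
          using t by (auto intro!: derivative_eq_intros)
        then have "(\<lambda>h. (t powr h - 1) / h) \<midarrow>0\<rightarrow> ln t"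
          using t by (simp add: DERIV_def)
        moreover have "(\<lambda>i. X (i + M)) \<longlonglongrightarrow> 0" using X by (rule LIMSEQ_ignore_initial_segment)
        ultimately have "(\<lambda>i. (t powr (X (i + M)) - 1) / X (i + M)) \<longlonglongrightarrow> ln t"
          using X0 unfolding tendsto_at_iff_sequentially comp_def by auto
        from tendsto_mult[OF tendsto_const[of "t powr (s - 1) * ln t ^ n"] this]
        show "(\<lambda>i. D (X (i + M)) t) \<longlonglongrightarrow> t powr (s - 1) * ln t ^ Suc n"
          by (simp add: D_def mult_ac)
      qed
      show "AE t in exp1. norm (D (X (i + M)) t) \<le> C * (t powr (s - 1) * (t powr (s/2) + t powr (- (s/2))))" for i
        using AE_exp1_pos
      proof eventually_elim
        fix t :: real assume t: "t > 0"
        let ?h = "X (i + M)"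
        have h: "\<bar>?h\<bar> \<le> s/4" "?h \<noteq> 0" using M[of "i + M"] X0 by auto
        have "\<bar>t powr ?h - 1\<bar> \<le> \<bar>?h * ln t\<bar> * exp \<bar>?h * ln t\<bar>"
          using abs_exp_minus_one_le[of "?h * ln t"] t by (simp add: powr_def)
        also have "\<dots> \<le> \<bar>?h * ln t\<bar> * exp (s/4 * \<bar>ln t\<bar>)"
          using mult_right_mono[OF h(1), of "\<bar>ln t\<bar>"] by (intro mult_left_mono) (auto simp: abs_mult)
        finally have "\<bar>(t powr ?h - 1) / ?h\<bar> \<le> \<bar>ln t\<bar> * exp (s/4 * \<bar>ln t\<bar>)"
          using h by (simp add: abs_mult field_simps)
        then have "\<bar>ln t\<bar> ^ n * \<bar>(t powr ?h - 1) / ?h\<bar> \<le> \<bar>ln t\<bar> ^ n * (\<bar>ln t\<bar> * exp (s/4 * \<bar>ln t\<bar>))"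
          by (intro mult_left_mono) auto
        also have "\<dots> = \<bar>ln t\<bar> ^ Suc n * exp (s/4 * \<bar>ln t\<bar>)" by simp
        also have "\<dots> \<le> (C * exp (s/4 * \<bar>ln t\<bar>)) * exp (s/4 * \<bar>ln t\<bar>)"
          unfolding C_def using s by (intro mult_right_mono abs_power_le_exp) auto
        also have "\<dots> = C * exp (s/2 * \<bar>ln t\<bar>)" by (simp flip: exp_add)
        also have "\<dots> \<le> C * (t powr (s/2) + t powr (- (s/2)))"
          using s t by (intro mult_left_mono exp_mult_abs_ln_le) (auto simp: C_def)
        finally have "t powr (s - 1) * (\<bar>ln t\<bar> ^ n * \<bar>(t powr ?h - 1) / ?h\<bar>)
            \<le> t powr (s - 1) * (C * (t powr (s/2) + t powr (- (s/2))))"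
          by (intro mult_left_mono) auto
        then show "norm (D ?h t) \<le> C * (t powr (s - 1) * (t powr (s/2) + t powr (- (s/2))))"
          by (simp add: D_def abs_mult power_abs mult_ac)
      qed
    qed (auto simp: D_def)
    moreover have "(\<integral>t. D (X (i + M)) t \<partial>exp1) =
        (log_moment n (s + X (i + M)) - log_moment n s) / X (i + M)" for i
    proof -
      let ?h = "X (i + M)"
      have h: "\<bar>?h\<bar> < s/4" "?h \<noteq> 0" using M[of "i + M"] X0 by auto
      have "(\<integral>t. D ?h t \<partial>exp1) = (\<integral>t. (t powr (s + ?h - 1) * ln t ^ n - t powr (s - 1) * ln t ^ n) / ?h \<partial>exp1)"
      proof (intro Bochner_Integration.integral_cong)
        fix t :: real
        have "t powr (s + ?h - 1) = t powr (s - 1) * t powr ?h"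
          by (simp add: algebra_simps flip: powr_add)
        then show "D ?h t = (t powr (s + ?h - 1) * ln t ^ n - t powr (s - 1) * ln t ^ n) / ?h"
          unfolding D_def by (simp add: algebra_simps diff_divide_distrib)
      qed simp
      also have "\<dots> = (log_moment n (s + ?h) - log_moment n s) / ?h"
        using s h unfolding log_moment_def
        by (subst Bochner_Integration.integral_divide_zero, subst Bochner_Integration.integral_diff)
           (auto intro!: integrable_log_moment)
      finally show ?thesis .
    qed
    ultimately have "(\<lambda>i. (log_moment n (s + X (i + M)) - log_moment n s) / X (i + M)) \<longlonglongrightarrow> log_moment (Suc n) s"
      by (simp add: log_moment_def)
    then show "(\<lambda>i. (log_moment n (s + X i) - log_moment n s) / X i) \<longlonglongrightarrow> log_moment (Suc n) s"
      by (rule LIMSEQ_offset)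
  qed
  then show "DERIV (log_moment n) s :> log_moment (Suc n) s" by (simp add: DERIV_def)
qed

lemma log_moment_0: "s > 0 \<Longrightarrow> log_moment 0 s = Gamma s"
  using has_bochner_integral_exp1_powr[of s] by (simp add: log_moment_def has_bochner_integral_iff)

text \<open>Uniqueness of derivatives: \<open>log_moment 0\<close> coincides with Gamma on the open
  half-line, and its derivative is known in two ways. The next lemma repeats this one order
  higher.\<close>

lemma log_moment_1:
  assumes "s > 0" shows "log_moment 1 s = Gamma s * Digamma s"
proof -
  have "(log_moment 0 has_real_derivative Gamma s * Digamma s) (at s)"
    by (rule has_field_derivative_transform_within_open[where S = "{0<..}" and f = Gamma])
       (use assms in \<open>auto intro!: derivative_eq_intros simp: log_moment_0 elim!: nonpos_Ints_cases\<close>)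
  with DERIV_log_moment[OF assms, of 0] show ?thesis by (auto dest: DERIV_unique)
qed

lemma log_moment_2:
  assumes "s > 0" shows "log_moment 2 s = Gamma s * ((Digamma s)\<^sup>2 + Polygamma 1 s)"
proof -
  have "(log_moment 1 has_real_derivative Gamma s * ((Digamma s)\<^sup>2 + Polygamma 1 s)) (at s)"
    by (rule has_field_derivative_transform_within_open[where S = "{0<..}" and f = "\<lambda>s. Gamma s * Digamma s"])
       (use assms in \<open>auto intro!: derivative_eq_intros simp: log_moment_1[unfolded One_nat_def] power2_eq_square algebra_simps elim!: nonpos_Ints_cases\<close>)
  with DERIV_log_moment[OF assms, of 1] show ?thesis by (auto dest: DERIV_unique simp: numeral_2_eq_2)
qed

text \<open>The series of \<open>Polygamma 1\<close> at 1 is the Basel sum. All occurrences of pi in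
  the metric come from here.\<close>

lemma Polygamma_1_1: "Polygamma 1 (1::real) = pi\<^sup>2 / 6"
proof -
  have "(\<lambda>n. 1 / (real n + 1)\<^sup>2) sums (pi\<^sup>2 / 6)" using inverse_squares_sums by (simp add: add_ac)
  then show ?thesis
    by (simp add: Polygamma_def sums_iff inverse_eq_divide numeral_2_eq_2 add_ac)
qed

text \<open>\<open>l\<close> is ln t minus its mean, which is
  \<open>Digamma 1 = - euler_mascheroni\<close>. The recurrences of Digamma and Polygamma carry the
  values from 1 to 2 and 3, and Euler's constant cancels from every moment.\<close>

lemma exp1_moments:
  defines "l \<equiv> \<lambda>t. ln t + (euler_mascheroni :: real)"
  shows "has_bochner_integral exp1 (\<lambda>t. t) 1"
    "has_bochner_integral exp1 (\<lambda>t. t\<^sup>2) 2"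
    "has_bochner_integral exp1 (\<lambda>t. l t) 0"
    "has_bochner_integral exp1 (\<lambda>t. t * l t) 1"
    "has_bochner_integral exp1 (\<lambda>t. t\<^sup>2 * l t) 3"
    "has_bochner_integral exp1 (\<lambda>t. (l t)\<^sup>2) (pi\<^sup>2 / 6)"
    "has_bochner_integral exp1 (\<lambda>t. t * (l t)\<^sup>2) (pi\<^sup>2 / 6)"
    "has_bochner_integral exp1 (\<lambda>t. t\<^sup>2 * (l t)\<^sup>2) (pi\<^sup>2 / 3 + 2)"
proof -
  let ?g = "euler_mascheroni :: real"
  have pow: "t powr (real (Suc a) - 1) = t ^ a" if "t > 0" for t a
    using that by (simp add: powr_realpow)
  have m: "has_bochner_integral exp1 (\<lambda>t. t ^ a * ln t ^ n) (log_moment n (real (Suc a)))" for a n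
  proof -
    have "has_bochner_integral exp1 (\<lambda>t. t powr (real (Suc a) - 1) * ln t ^ n) (log_moment n (real (Suc a)))"
      using integrable_log_moment[of "real (Suc a)" n] by (simp add: has_bochner_integral_iff log_moment_def)
    moreover have "AE t in exp1. t powr (real (Suc a) - 1) * ln t ^ n = t ^ a * ln t ^ n"
      using AE_exp1_pos by eventually_elim (simp only: pow)
    ultimately show ?thesis
      by (subst (asm) has_bochner_integral_cong_AE) auto
  qed
  have d: "Digamma (1::real) = - ?g" "Digamma (2::real) = 1 - ?g" "Digamma (3::real) = 3/2 - ?g"
    using Digamma_plus1[of "1::real"] Digamma_plus1[of "2::real"] by auto
  have p: "Polygamma 1 (2::real) = pi\<^sup>2/6 - 1" "Polygamma 1 (3::real) = pi\<^sup>2/6 - 5/4"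
    using Polygamma_plus1[of "1::real" 1] Polygamma_plus1[of "2::real" 1] Polygamma_1_1
    by (auto simp: power2_eq_square)
  have G: "Gamma (2::real) = 1" "Gamma (3::real) = 2"
    using Gamma_fact[of 1, where 'a=real] Gamma_fact[of 2, where 'a=real] by auto
  note v = m[of 0 0] m[of 1 0] m[of 2 0] m[of 0 1] m[of 1 1] m[of 2 1] m[of 0 2] m[of 1 2] m[of 2 2]
  note w = v[simplified log_moment_0 log_moment_1 log_moment_2]
  have e: "l t * x = x * ln t + ?g * x" "(l t)\<^sup>2 * x = x * (ln t)\<^sup>2 + 2 * ?g * (x * ln t) + ?g\<^sup>2 * x" for t x
    by (simp_all add: l_def power2_eq_square algebra_simps)
  have m1: "has_bochner_integral exp1 (\<lambda>t. l t * t ^ a) (log_moment 1 (real (Suc a)) + ?g * log_moment 0 (real (Suc a)))" for a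
    unfolding e using m[of a 1] m[of a 0]
    by (intro has_bochner_integral_add has_bochner_integral_mult_right) auto
  have m2: "has_bochner_integral exp1 (\<lambda>t. (l t)\<^sup>2 * t ^ a) (log_moment 2 (real (Suc a)) + 2 * ?g * log_moment 1 (real (Suc a)) + ?g\<^sup>2 * log_moment 0 (real (Suc a)))" for a
    unfolding e using m[of a 2] m[of a 1] m[of a 0]
    by (intro has_bochner_integral_add has_bochner_integral_mult_right) auto
  note s = log_moment_0 log_moment_1[unfolded One_nat_def] log_moment_2 d p[unfolded One_nat_def] G
    Polygamma_1_1[unfolded One_nat_def]
  note s' = power2_eq_square algebra_simps
  show "has_bochner_integral exp1 (\<lambda>t. t) 1" using m[of 1 0] by (simp add: s)
  show "has_bochner_integral exp1 (\<lambda>t. t\<^sup>2) 2" using m[of 2 0] by (simp add: s)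
  show "has_bochner_integral exp1 (\<lambda>t. l t) 0" using m1[of 0] by (simp add: s)
  show "has_bochner_integral exp1 (\<lambda>t. t * l t) 1"
    using m1[of 1] by (subst mult.commute) (simp add: s)
  show "has_bochner_integral exp1 (\<lambda>t. t\<^sup>2 * l t) 3"
    using m1[of 2] by (subst mult.commute) (simp add: s s')
  show "has_bochner_integral exp1 (\<lambda>t. (l t)\<^sup>2) (pi\<^sup>2 / 6)"
    using m2[of 0] by (simp add: s power2_eq_square)
  show "has_bochner_integral exp1 (\<lambda>t. t * (l t)\<^sup>2) (pi\<^sup>2 / 6)"
    using m2[of 1] by (subst mult.commute) (simp add: s s')
  show "has_bochner_integral exp1 (\<lambda>t. t\<^sup>2 * (l t)\<^sup>2) (pi\<^sup>2 / 3 + 2)"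
    using m2[of 2] by (subst mult.commute) (simp add: s s')
qed

section \<open>Frechet distributions and polar coordinates on the positive orthant\<close>

text \<open>The scale enters through its \<tau>-th power b, so that the distribution function is exp
  (- b / y^\<tau>) on y > 0.\<close>

definition frechet_density :: "real \<Rightarrow> real \<Rightarrow> real \<Rightarrow> real" where
  "frechet_density b \<tau> y = (if y > 0 then b * \<tau> / y powr (\<tau> + 1) * exp (- (b / y powr \<tau>)) else 0)"

definition frechet :: "real \<Rightarrow> real \<Rightarrow> real measure" where
  "frechet b \<tau> = density lborel (\<lambda>y. ennreal (frechet_density b \<tau> y))"

lemma borel_measurable_frechet_density [measurable]: "frechet_density b \<tau> \<in> borel_measurable borel"
  unfolding frechet_density_def by measurable

lemma sets_frechet [measurable_cong, simp]: "sets (frechet b \<tau>) = sets borel"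
  and space_frechet [simp]: "space (frechet b \<tau>) = UNIV"
  by (simp_all add: frechet_def)

lemma frechet_density_nonneg: "b > 0 \<Longrightarrow> \<tau> > 0 \<Longrightarrow> frechet_density b \<tau> y \<ge> 0"
  by (simp add: frechet_density_def)

lemma DERIV_frechet_cdf:
  assumes "y > 0"
  shows "((\<lambda>y. exp (- (b / y powr \<tau>))) has_real_derivative b * \<tau> / y powr (\<tau> + 1) * exp (- (b / y powr \<tau>))) (at y)"
proof -
  have "((\<lambda>y. exp (- (b * y powr (- \<tau>)))) has_real_derivative b * \<tau> * y powr (- \<tau> - 1) * exp (- (b * y powr (- \<tau>)))) (at y)"
    using assms by (auto intro!: derivative_eq_intros)
  moreover have "- \<tau> - 1 = - (\<tau> + 1)" by simp
  ultimately show ?thesis by (simp only: powr_minus_divide mult_1_right times_divide_eq_right)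
qed

lemma tendsto_frechet_cdf:
  fixes b \<tau> :: real
  assumes "\<tau> > 0"
  shows "((\<lambda>y. exp (- (b / y powr \<tau>))) \<longlongrightarrow> 1) at_top"
proof -
  have "((\<lambda>y::real. y powr (- \<tau>)) \<longlongrightarrow> 0) at_top"
    using assms by (intro tendsto_neg_powr filterlim_ident) auto
  from tendsto_mult[OF tendsto_const[of b] this]
  have "((\<lambda>y. exp (- (b * y powr (- \<tau>)))) \<longlongrightarrow> exp (- (b * 0))) at_top"
    by (intro tendsto_exp tendsto_minus)
  then show ?thesis unfolding powr_minus_divide by simp
qed

lemma emeasure_frechet_atLeast:
  assumes "b > 0" "\<tau> > 0" "c > 0"
  shows "emeasure (frechet b \<tau>) {c..} = ennreal (1 - exp (- (b / c powr \<tau>)))"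
proof -
  have "emeasure (frechet b \<tau>) {c..} = (\<integral>\<^sup>+y. ennreal (frechet_density b \<tau> y) * indicator {c..} y \<partial>lborel)"
    unfolding frechet_def by (subst emeasure_density) auto
  also have "\<dots> = ennreal (1 - exp (- (b / c powr \<tau>)))"
  proof (rule nn_integral_FTC_atLeast)
    show "((\<lambda>y. exp (- (b / y powr \<tau>))) has_real_derivative frechet_density b \<tau> y) (at y)" if "c \<le> y" for y
      using DERIV_frechet_cdf[of y b \<tau>] that assms by (simp add: frechet_density_def)
  qed (use assms in \<open>auto intro!: frechet_density_nonneg tendsto_frechet_cdf\<close>)
  finally show ?thesis .
qed

text \<open>The two measures are compared on half-lines \<open>{..a}\<close>, so that no total mass has to be known.\<close>

lemma distr_frechet_exp1:
  assumes b: "b > 0" and \<tau>: "\<tau> > 0"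
  shows "distr (frechet b \<tau>) borel (\<lambda>y. b / y powr \<tau>) = exp1"
proof (rule measure_eqI_generator_eq)
  let ?E = "range (atMost :: real \<Rightarrow> real set)"
  show "Int_stable ?E"
    by (auto simp: Int_stable_def intro!: image_eqI)
  have eq: "emeasure (distr (frechet b \<tau>) borel (\<lambda>y. b / y powr \<tau>)) {..a} = emeasure exp1 {..a}" for a
  proof -
    \<comment> \<open>The density vanishes for y \<le> 0, so the values of \<open>powr\<close> there
      do not matter.\<close>
    have pos: "AE y in frechet b \<tau>. y > 0"
      unfolding frechet_def by (subst AE_density) (auto simp: frechet_density_def)
    have "emeasure (distr (frechet b \<tau>) borel (\<lambda>y. b / y powr \<tau>)) {..a} =
        emeasure (frechet b \<tau>) ((\<lambda>y. b / y powr \<tau>) -` {..a})"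
      by (subst emeasure_distr) auto
    also have "\<dots> = ennreal (if a < 0 then 0 else 1 - exp (- a))"
    proof (cases "a > 0")
      case True
      \<comment> \<open>The map is decreasing on y > 0, so the preimage of {..a} is a half-line
        {c..} up to a null set; c solves b / c^\<tau> = a.\<close>
      define c where "c = (b / a) powr (1 / \<tau>)"
      have c: "c > 0" "c powr \<tau> = b / a" using b \<tau> True by (auto simp: c_def powr_powr)
      have "emeasure (frechet b \<tau>) ((\<lambda>y. b / y powr \<tau>) -` {..a}) = emeasure (frechet b \<tau>) {c..}"
      proof (rule emeasure_eq_AE)
        show "AE y in frechet b \<tau>. (y \<in> (\<lambda>y. b / y powr \<tau>) -` {..a}) = (y \<in> {c..})"
          using pos
        proof eventually_elim
          fix y :: real assume y: "y > 0"
          have "b / y powr \<tau> \<le> a \<longleftrightarrow> c powr \<tau> \<le> y powr \<tau>"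
            using y True b by (simp add: c field_simps)
          also have "\<dots> \<longleftrightarrow> c \<le> y"
            using y c \<tau> by (metis less_eq_real_def not_le powr_less_mono2 powr_mono2)
          finally show "(y \<in> (\<lambda>y. b / y powr \<tau>) -` {..a}) = (y \<in> {c..})" by simp
        qed
        have "(\<lambda>y. b / y powr \<tau>) -` {..a} \<inter> space borel \<in> sets borel" by measurable
        then show "(\<lambda>y. b / y powr \<tau>) -` {..a} \<in> sets (frechet b \<tau>)" by simp
      qed auto
      then show ?thesis using emeasure_frechet_atLeast[OF b \<tau> c(1)] True b by (simp add: c)
    next
      case False
      have "AE y in frechet b \<tau>. y \<notin> (\<lambda>y. b / y powr \<tau>) -` {..a}"
        using pos
      proof eventually_elim
        fix y :: real assume "y > 0"
        then have "b / y powr \<tau> > 0" using b by simp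
        then show "y \<notin> (\<lambda>y. b / y powr \<tau>) -` {..a}" using False by auto
      qed
      moreover have "(\<lambda>y. b / y powr \<tau>) -` {..a} \<inter> space borel \<in> sets borel" by measurable
      ultimately show ?thesis using False by (simp add: AE_iff_measurable[OF _ refl] not_less vimage_def)
    qed
    also have "\<dots> = emeasure exp1 {..a}"
      by (subst emeasure_erlang_density) (auto simp: erlang_CDF_def)
    finally show ?thesis .
  qed
  show "emeasure (distr (frechet b \<tau>) borel (\<lambda>y. b / y powr \<tau>)) X = emeasure exp1 X" if "X \<in> ?E" for X
    using that eq by auto
  show "sets (distr (frechet b \<tau>) borel (\<lambda>y. b / y powr \<tau>)) = sigma_sets UNIV ?E"
    unfolding sets_distr borel_eq_atMost by simp
  then show "sets exp1 = sigma_sets UNIV ?E" by simp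
  show "range (\<lambda>n. {..real n}) \<subseteq> ?E" by auto
  show "(\<Union>n. {..real n}) = UNIV" using real_arch_simple by auto
  show "emeasure (distr (frechet b \<tau>) borel (\<lambda>y. b / y powr \<tau>)) {..real n} \<noteq> \<infinity>" for n
    unfolding eq by (subst emeasure_erlang_density) auto
qed auto

text \<open>Push-forward preserves total mass, so it can be read off the exponential law.\<close>

lemma prob_space_frechet: "b > 0 \<Longrightarrow> \<tau> > 0 \<Longrightarrow> prob_space (frechet b \<tau>)"
  using distr_frechet_exp1[of b \<tau>] prob_space_exp1
  by (intro prob_space_distrD[of "\<lambda>y. b / y powr \<tau>" "frechet b \<tau>" borel]) auto

section \<open>Densities, scaling and radial integration on finite products\<close>

lemma PiM_density:
  fixes f :: "'i \<Rightarrow> 'a \<Rightarrow> ennreal"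
  assumes I: "finite I"
    and M: "\<And>i. i \<in> I \<Longrightarrow> sigma_finite_measure (M i)"
    and D: "\<And>i. i \<in> I \<Longrightarrow> sigma_finite_measure (density (M i) (f i))"
    and f: "\<And>i. i \<in> I \<Longrightarrow> f i \<in> borel_measurable (M i)"
  shows "(\<Pi>\<^sub>M i\<in>I. density (M i) (f i)) = density (\<Pi>\<^sub>M i\<in>I. M i) (\<lambda>x. \<Prod>i\<in>I. f i (x i))"
proof -
  \<comment> \<open>\<open>product_sigma_finite\<close> demands sigma-finiteness at every index,
    while the hypotheses give it on I. Elsewhere an empty space is put in, which the product over I
    does not see.\<close>
  define M' where "M' = (\<lambda>i. if i \<in> I then M i else count_space {})"
  define D' where "D' = (\<lambda>i. if i \<in> I then density (M i) (f i) else count_space {})"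
  have c: "sigma_finite_measure (count_space {} :: 'a measure)"
    by (rule sigma_finite_measure_count_space_finite) simp
  interpret M: product_sigma_finite M'
    using M c by (simp add: product_sigma_finite_def M'_def)
  interpret D: product_sigma_finite D'
    using D c by (simp add: product_sigma_finite_def D'_def)
  have PM: "PiM I M' = PiM I M" "PiM I D' = (\<Pi>\<^sub>M i\<in>I. density (M i) (f i))"
    by (intro PiM_cong; simp add: M'_def D'_def)+
  have fm [measurable]: "f i \<in> borel_measurable (M' i)" if "i \<in> I" for i
    using f that by (simp add: M'_def)
  have "density (PiM I M') (\<lambda>x. \<Prod>i\<in>I. f i (x i)) = PiM I D'"
  proof (rule D.PiM_eqI[OF I])
    show "sets (density (PiM I M') (\<lambda>x. \<Prod>i\<in>I. f i (x i))) = sets (PiM I D')"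
      by (simp, intro sets_PiM_cong) (auto simp: M'_def D'_def)
    fix A assume A: "\<And>i. i \<in> I \<Longrightarrow> A i \<in> sets (D' i)"
    have A' [measurable]: "A i \<in> sets (M' i)" if "i \<in> I" for i
      using A[OF that] that by (simp add: M'_def D'_def)
    have "emeasure (density (PiM I M') (\<lambda>x. \<Prod>i\<in>I. f i (x i))) (Pi\<^sub>E I A) =
        (\<integral>\<^sup>+x. (\<Prod>i\<in>I. f i (x i)) * indicator (Pi\<^sub>E I A) x \<partial>PiM I M')"
      using I A' by (intro emeasure_density) (auto intro!: sets_PiM_I_finite)
    also have "\<dots> = (\<integral>\<^sup>+x. (\<Prod>i\<in>I. f i (x i) * indicator (A i) (x i)) \<partial>PiM I M')"
    proof (rule nn_integral_cong)
      fix x assume "x \<in> space (PiM I M')"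
      then have "x \<in> extensional I" by (simp add: space_PiM PiE_def)
      then have "indicator (Pi\<^sub>E I A) x = (\<Prod>i\<in>I. indicator (A i) (x i) :: ennreal)"
        using I by (auto simp: PiE_def Pi_def indicator_def prod_zero_iff split: if_splits intro!: prod.neutral[symmetric])
      then show "(\<Prod>i\<in>I. f i (x i)) * indicator (Pi\<^sub>E I A) x = (\<Prod>i\<in>I. f i (x i) * indicator (A i) (x i))"
        by (simp add: prod.distrib)
    qed
    also have "\<dots> = (\<Prod>i\<in>I. \<integral>\<^sup>+y. f i y * indicator (A i) y \<partial>M' i)"
      using I by (intro M.product_nn_integral_prod) auto
    also have "\<dots> = (\<Prod>i\<in>I. emeasure (D' i) (A i))"
    proof (rule prod.cong)
      fix i assume i: "i \<in> I"
      have "emeasure (density (M' i) (f i)) (A i) = (\<integral>\<^sup>+y. f i y * indicator (A i) y \<partial>M' i)"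
        using i by (intro emeasure_density) auto
      then show "(\<integral>\<^sup>+y. f i y * indicator (A i) y \<partial>M' i) = emeasure (D' i) (A i)"
        using i by (simp add: M'_def D'_def)
    qed simp
    finally show "emeasure (density (PiM I M') (\<lambda>x. \<Prod>i\<in>I. f i (x i))) (Pi\<^sub>E I A) = (\<Prod>i\<in>I. emeasure (D' i) (A i))" .
  qed
  then show ?thesis by (simp add: PM)
qed

text \<open>Induction over the coordinates: each contributes a factor c by the one-dimensional
  substitution, so no determinant occurs.\<close>

lemma nn_integral_PiM_scale:
  fixes c :: real
  assumes "finite I" "c > 0" "f \<in> borel_measurable (\<Pi>\<^sub>M i\<in>I. lborel)"
  shows "(\<integral>\<^sup>+x. f x \<partial>(\<Pi>\<^sub>M i\<in>I. lborel)) = ennreal (c ^ card I) * (\<integral>\<^sup>+x. f (\<lambda>i\<in>I. c * x i) \<partial>(\<Pi>\<^sub>M i\<in>I. lborel))"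
  using assms(1,3)
proof (induction I arbitrary: f)
  case empty
  interpret product_sigma_finite "\<lambda>_. lborel" by standard
  show ?case by (subst (1 2) nn_integral_empty) (auto simp: restrict_def)
next
  case (insert i I)
  interpret product_sigma_finite "\<lambda>_. lborel" by standard
  note [measurable] = insert.prems
  have "(\<integral>\<^sup>+x. f x \<partial>(\<Pi>\<^sub>M i\<in>insert i I. lborel)) = (\<integral>\<^sup>+x. \<integral>\<^sup>+y. f (x(i := y)) \<partial>lborel \<partial>(\<Pi>\<^sub>M i\<in>I. lborel))"
    by (intro product_nn_integral_insert insert)
  also have "\<dots> = ennreal (c ^ card I) * (\<integral>\<^sup>+x. \<integral>\<^sup>+y. f ((\<lambda>i\<in>I. c * x i)(i := y)) \<partial>lborel \<partial>(\<Pi>\<^sub>M i\<in>I. lborel))"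
    using insert(1,2) by (intro insert.IH) measurable
  also have "(\<integral>\<^sup>+x. \<integral>\<^sup>+y. f ((\<lambda>i\<in>I. c * x i)(i := y)) \<partial>lborel \<partial>(\<Pi>\<^sub>M i\<in>I. lborel)) =
      (\<integral>\<^sup>+x. ennreal c * (\<integral>\<^sup>+y. f (\<lambda>j\<in>insert i I. c * (x(i := y)) j) \<partial>lborel) \<partial>(\<Pi>\<^sub>M i\<in>I. lborel))"
  proof (rule nn_integral_cong)
    fix x :: "'a \<Rightarrow> real"
    have [measurable]: "(\<lambda>y. f ((\<lambda>i\<in>I. c * x i)(i := y))) \<in> borel_measurable borel"
      using insert(1,2) by (intro measurable_compose[OF _ insert.prems] measurable_fun_upd[where J = I]) (auto simp: space_PiM)
    have "(\<integral>\<^sup>+y. f ((\<lambda>i\<in>I. c * x i)(i := y)) \<partial>lborel) = ennreal c * (\<integral>\<^sup>+y. f ((\<lambda>i\<in>I. c * x i)(i := 0 + c * y)) \<partial>lborel)"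
      using assms(2) by (subst nn_integral_real_affine[where c = c and t = 0]) auto
    also have "(\<lambda>y. (\<lambda>i\<in>I. c * x i)(i := 0 + c * y)) = (\<lambda>y. \<lambda>j\<in>insert i I. c * (x(i := y)) j)"
      using insert(2) by (auto simp: fun_eq_iff restrict_def)
    then have "(\<lambda>y. f ((\<lambda>i\<in>I. c * x i)(i := 0 + c * y))) = (\<lambda>y. f (\<lambda>j\<in>insert i I. c * (x(i := y)) j))"
      by (metis)
    finally show "(\<integral>\<^sup>+y. f ((\<lambda>i\<in>I. c * x i)(i := y)) \<partial>lborel) = ennreal c * (\<integral>\<^sup>+y. f (\<lambda>j\<in>insert i I. c * (x(i := y)) j) \<partial>lborel)" .
  qed
  also have "\<dots> = ennreal c * (\<integral>\<^sup>+x. (\<integral>\<^sup>+y. f (\<lambda>j\<in>insert i I. c * (x(i := y)) j) \<partial>lborel) \<partial>(\<Pi>\<^sub>M i\<in>I. lborel))"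
    using insert(1) by (intro nn_integral_cmult) measurable
  also have "(\<integral>\<^sup>+x. (\<integral>\<^sup>+y. f (\<lambda>j\<in>insert i I. c * (x(i := y)) j) \<partial>lborel) \<partial>(\<Pi>\<^sub>M i\<in>I. lborel)) =
      (\<integral>\<^sup>+x. f (\<lambda>i\<in>insert i I. c * x i) \<partial>(\<Pi>\<^sub>M i\<in>insert i I. lborel))"
    using insert(1,2) by (intro product_nn_integral_insert[symmetric]) measurable
  finally have "(\<integral>\<^sup>+x. f x \<partial>(\<Pi>\<^sub>M i\<in>insert i I. lborel)) = ennreal (c ^ card I) *
      (ennreal c * (\<integral>\<^sup>+x. f (\<lambda>i\<in>insert i I. c * x i) \<partial>(\<Pi>\<^sub>M i\<in>insert i I. lborel)))" .
  moreover have "ennreal (c ^ card (insert i I)) = ennreal (c ^ card I) * ennreal c"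
    using insert(1,2) assms(2) by (simp add: ennreal_mult mult_ac)
  ultimately show ?case by (simp only: mult.assoc)
qed

text \<open>Replacing the last coordinate by the sum r of all coordinates is a translation, and
  dividing the remaining ones by r is a scaling with Jacobian r^(K-1). The directions are then
  exactly the points that \<open>complete_last\<close> produces.\<close>

lemma nn_integral_PiM_polar:
  assumes K: "K \<ge> (1::nat)" and H [measurable]: "H \<in> borel_measurable (\<Pi>\<^sub>M i\<in>{1..K}. lborel)"
    and pos: "\<And>y. H y \<noteq> 0 \<Longrightarrow> \<forall>i\<in>{1..K}. y i > 0"
  shows "(\<integral>\<^sup>+y. H y \<partial>(\<Pi>\<^sub>M i\<in>{1..K}. lborel)) =
    (\<integral>\<^sup>+x. \<integral>\<^sup>+r. indicator {0<..} r * ennreal (r ^ (K - 1)) * H (\<lambda>i\<in>{1..K}. r * complete_last K x i) \<partial>lborel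
       \<partial>(\<Pi>\<^sub>M i\<in>{1..K-1}. lborel))"
proof -
  interpret product_sigma_finite "\<lambda>_. lborel" by standard
  define J where "J = {1..K-1}"
  have J: "finite J" "K \<notin> J" "card J = K - 1" and KJ: "{1..K} = insert K J"
    using K by (auto simp: J_def)
  define P where "P = (\<Pi>\<^sub>M i\<in>J. lborel :: real measure)"
  interpret P: sigma_finite_measure P unfolding P_def by (rule sigma_finite[OF J(1)])
  interpret pair_sigma_finite P lborel ..
  have HJ [measurable]: "H \<in> borel_measurable (\<Pi>\<^sub>M i\<in>insert K J. lborel)" using H unfolding KJ .
  have PJ [measurable_cong]: "sets P = sets (\<Pi>\<^sub>M i\<in>J. lborel)" by (simp add: P_def)
  have [measurable]: "(\<lambda>x. sum x J) \<in> borel_measurable P"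
    unfolding P_def using J(1) by measurable
  have upd: "(\<lambda>z. (fst z)(K := snd z - sum (fst z) J)) \<in> P \<Otimes>\<^sub>M lborel \<rightarrow>\<^sub>M (\<Pi>\<^sub>M i\<in>insert K J. lborel)"
    using J(2) by (intro measurable_fun_upd[where J = J]) (auto simp: PJ[symmetric] P_def[symmetric])
  have upd1: "(\<lambda>x. x(K := r - sum x J)) \<in> P \<rightarrow>\<^sub>M (\<Pi>\<^sub>M i\<in>insert K J. lborel)" for r
    using J(2) by (intro measurable_fun_upd[where J = J]) (auto simp: PJ[symmetric] P_def[symmetric])
  have cl: "(\<lambda>z. \<lambda>i\<in>insert K J. snd z * complete_last K (fst z) i) \<in> P \<Otimes>\<^sub>M lborel \<rightarrow>\<^sub>M (\<Pi>\<^sub>M i\<in>insert K J. lborel)"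
  proof (rule measurable_restrict)
    fix i assume "i \<in> insert K J"
    then consider "i \<in> J" "i \<noteq> K" | "i = K" using J(2) by auto
    then show "(\<lambda>z. snd z * complete_last K (fst z) i) \<in> P \<Otimes>\<^sub>M lborel \<rightarrow>\<^sub>M lborel"
    proof cases
      case 1
      then have [measurable]: "(\<lambda>x. x i) \<in> borel_measurable P"
        unfolding P_def by measurable
      from 1 show ?thesis by (simp add: complete_last_def)
    next
      case 2
      then show ?thesis unfolding complete_last_def J_def[symmetric] by simp
    qed
  qed
  have "(\<integral>\<^sup>+y. H y \<partial>(\<Pi>\<^sub>M i\<in>{1..K}. lborel)) = (\<integral>\<^sup>+x. \<integral>\<^sup>+y. H (x(K := y)) \<partial>lborel \<partial>P)"
    unfolding KJ P_def by (intro product_nn_integral_insert J HJ)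
  also have "\<dots> = (\<integral>\<^sup>+x. \<integral>\<^sup>+r. H (x(K := r - sum x J)) \<partial>lborel \<partial>P)"
  proof (rule nn_integral_cong)
    fix x assume "x \<in> space P"
    then have "(\<lambda>y. H (x(K := y))) \<in> borel_measurable borel"
      using J(2) by (intro measurable_compose[OF _ HJ] measurable_fun_upd[where J = J]) (auto simp: P_def)
    from nn_integral_real_affine[OF this, of 1 "- sum x J"]
    show "(\<integral>\<^sup>+y. H (x(K := y)) \<partial>lborel) = (\<integral>\<^sup>+r. H (x(K := r - sum x J)) \<partial>lborel)" by simp
  qed
  \<comment> \<open>The order of integration is exchanged so that r is fixed while the other
    coordinates are scaled by it.\<close>
  also have "\<dots> = (\<integral>\<^sup>+r. \<integral>\<^sup>+x. H (x(K := r - sum x J)) \<partial>P \<partial>lborel)"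
    using measurable_compose[OF upd HJ] by (intro Fubini'[symmetric]) (simp add: case_prod_beta')
  also have "\<dots> = (\<integral>\<^sup>+r. \<integral>\<^sup>+x. indicator {0<..} r * ennreal (r ^ (K - 1)) * H (\<lambda>i\<in>{1..K}. r * complete_last K x i) \<partial>P \<partial>lborel)"
  proof (rule nn_integral_cong)
    fix r :: real
    show "(\<integral>\<^sup>+x. H (x(K := r - sum x J)) \<partial>P) = (\<integral>\<^sup>+x. indicator {0<..} r * ennreal (r ^ (K - 1)) * H (\<lambda>i\<in>{1..K}. r * complete_last K x i) \<partial>P)"
    proof (cases "r > 0")
      case True
      have "(\<integral>\<^sup>+x. H (x(K := r - sum x J)) \<partial>P) =
          ennreal (r ^ (K - 1)) * (\<integral>\<^sup>+x. H ((\<lambda>i\<in>J. r * x i)(K := r - sum (\<lambda>i\<in>J. r * x i) J)) \<partial>P)"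
        unfolding P_def J(3)[symmetric]
        using measurable_compose[OF upd1 HJ] by (intro nn_integral_PiM_scale J True) (simp add: P_def)
      also have "(\<lambda>x. (\<lambda>i\<in>J. r * x i)(K := r - sum (\<lambda>i\<in>J. r * x i) J)) = (\<lambda>x. \<lambda>i\<in>{1..K}. r * complete_last K x i)"
        unfolding KJ complete_last_def J_def[symmetric] using J(2)
        by (auto simp: fun_eq_iff restrict_def right_diff_distrib sum_distrib_left)
      then have "(\<lambda>x. H ((\<lambda>i\<in>J. r * x i)(K := r - sum (\<lambda>i\<in>J. r * x i) J))) = (\<lambda>x. H (\<lambda>i\<in>{1..K}. r * complete_last K x i))"
        by metis
      also have "ennreal (r ^ (K - 1)) * (\<integral>\<^sup>+x. H (\<lambda>i\<in>{1..K}. r * complete_last K x i) \<partial>P) =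
          (\<integral>\<^sup>+x. ennreal (r ^ (K - 1)) * H (\<lambda>i\<in>{1..K}. r * complete_last K x i) \<partial>P)"
        using measurable_compose[where f = "\<lambda>x. (x, r)" and M = P, OF _ measurable_compose[OF cl HJ]]
        unfolding KJ by (intro nn_integral_cmult[symmetric]) simp
      finally have "(\<integral>\<^sup>+x. H (x(K := r - sum x J)) \<partial>P) =
          (\<integral>\<^sup>+x. ennreal (r ^ (K - 1)) * H (\<lambda>i\<in>{1..K}. r * complete_last K x i) \<partial>P)" .
      then show ?thesis using True by simp
    next
      case False
      \<comment> \<open>If H were nonzero, all coordinates would be positive, and so would be their
        sum r.\<close>
      have "H (x(K := r - sum x J)) = 0" for x
      proof (rule ccontr)
        assume "H (x(K := r - sum x J)) \<noteq> 0"
        from pos[OF this] have *: "r - sum x J > 0" "\<And>i. i \<in> J \<Longrightarrow> x i > 0"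
          using J(2) unfolding KJ by (auto simp: fun_upd_def split: if_splits)
        have "sum x J \<ge> 0" using *(2) by (intro sum_nonneg) (auto intro: less_imp_le)
        with *(1) False show False by simp
      qed
      with False show ?thesis by simp
    qed
  qed
  also have "\<dots> = (\<integral>\<^sup>+x. \<integral>\<^sup>+r. indicator {0<..} r * ennreal (r ^ (K - 1)) * H (\<lambda>i\<in>{1..K}. r * complete_last K x i) \<partial>lborel \<partial>P)"
  proof (rule Fubini')
    note measurable_compose[OF cl HJ, measurable]
    show "(\<lambda>(x, r). indicator {0<..} r * ennreal (r ^ (K - 1)) * H (\<lambda>i\<in>{1..K}. r * complete_last K x i)) \<in> borel_measurable (P \<Otimes>\<^sub>M lborel)"
      unfolding KJ case_prod_beta' by measurable
  qed
  finally show ?thesis by (simp add: P_def J_def)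
qed

section \<open>Polynomial moments of independent pairs\<close>

lemma has_bochner_integral_cong_value:
  assumes "has_bochner_integral M f a" "\<And>x. x \<in> space M \<Longrightarrow> f x = g x" "a = b"
  shows "has_bochner_integral M g b"
  using assms by (simp cong: has_bochner_integral_cong)

text \<open>Independence of coordinate k from those in I, in the form of Fubini's theorem. A point
  of the larger product still carries coordinate k, so it is restricted before F is applied.\<close>

lemma has_bochner_integral_PiM_insert:
  fixes F :: "('i \<Rightarrow> 'a) \<Rightarrow> real" and g :: "'a \<Rightarrow> real"
  assumes M: "\<And>i. i \<in> insert k I \<Longrightarrow> prob_space (M i)" and k: "k \<notin> I"
    and F: "has_bochner_integral (PiM I M) F a" and g: "has_bochner_integral (M k) g c"
  shows "has_bochner_integral (PiM (insert k I) M) (\<lambda>x. F (restrict x I) * g (x k)) (a * c)"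
proof -
  interpret k: prob_space "M k" using M by auto
  interpret I: prob_space "PiM I M" using M by (intro prob_space_PiM) auto
  interpret pair_sigma_finite "M k" "PiM I M" ..
  have [measurable]: "F \<in> borel_measurable (PiM I M)" "g \<in> borel_measurable (M k)"
    using F g by (auto simp: has_bochner_integral_iff)
  have int: "integrable (M k \<Otimes>\<^sub>M PiM I M) (\<lambda>(t, X). F X * g t)"
  proof (rule Fubini_integrable)
    show "integrable (M k) (\<lambda>t. \<integral>X. norm (case (t, X) of (t, X) \<Rightarrow> F X * g t) \<partial>PiM I M)"
      using F g by (auto simp: abs_mult has_bochner_integral_iff)
    show "AE t in M k. integrable (PiM I M) (\<lambda>X. case (t, X) of (t, X) \<Rightarrow> F X * g t)"
      using F by (auto simp: has_bochner_integral_iff)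
  qed measurable
  have "(\<integral>z. (case z of (t, X) \<Rightarrow> F X * g t) \<partial>(M k \<Otimes>\<^sub>M PiM I M)) = (\<integral>t. \<integral>X. F X * g t \<partial>PiM I M \<partial>M k)"
    using integral_fst'[OF int] by simp
  also have "\<dots> = a * c" using F g by (simp add: has_bochner_integral_iff)
  finally have "has_bochner_integral (M k \<Otimes>\<^sub>M PiM I M) (\<lambda>(t, X). F X * g t) (a * c)"
    using int by (simp add: has_bochner_integral_iff)
  then have "has_bochner_integral (M k \<Otimes>\<^sub>M PiM I M)
      (\<lambda>z. F (restrict ((\<lambda>(t, X). X(k := t)) z) I) * g ((\<lambda>(t, X). X(k := t)) z k)) (a * c)"
  proof (rule has_bochner_integral_cong_value)
    fix z assume "z \<in> space (M k \<Otimes>\<^sub>M PiM I M)"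
    then obtain t X where z: "z = (t, X)" "X \<in> extensional I"
      by (auto simp: space_pair_measure space_PiM PiE_def)
    have "restrict (X(k := t)) I = X"
      using z(2) k by (auto simp: fun_eq_iff restrict_def extensional_def)
    then show "(case z of (t, X) \<Rightarrow> F X * g t) =
        F (restrict ((\<lambda>(t, X). X(k := t)) z) I) * g ((\<lambda>(t, X). X(k := t)) z k)"
      using z by simp
  qed simp
  moreover have "(\<lambda>x. F (restrict x I) * g (x k)) \<in> borel_measurable (PiM (insert k I) M)"
    by (intro borel_measurable_times measurable_compose[OF measurable_restrict_subset[of I]]
        measurable_compose[OF measurable_component_singleton]) auto
  moreover have "(\<lambda>(t, X). X(k := t)) \<in> M k \<Otimes>\<^sub>M PiM I M \<rightarrow>\<^sub>M PiM (insert k I) M"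
    by measurable
  ultimately have "has_bochner_integral (distr (M k \<Otimes>\<^sub>M PiM I M) (PiM (insert k I) M) (\<lambda>(t, X). X(k := t)))
      (\<lambda>x. F (restrict x I) * g (x k)) (a * c)"
    by (intro has_bochner_integral_distr)
  then show ?thesis using distr_pair_PiM_eq_PiM[of I M k] M by simp
qed

section \<open>Recursion for joint moments of sums over independent sites\<close>

lemma mult_four_sums:
  fixes f g h l :: "nat \<Rightarrow> real"
  shows "sum f A * sum g B * sum h C * sum l D = (\<Sum>i\<in>A. \<Sum>j\<in>B. \<Sum>k\<in>C. \<Sum>m\<in>D. f i * g j * h k * l m)"
  by (simp only: sum_distrib_left[symmetric] sum_distrib_right[symmetric])

text \<open>One pair (e, v) of statistics per site. Integrability of all mixed powers lets a single
  induction over the index set settle integrability of every monomial in the sums over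
  sites.\<close>

locale independent_pairs =
  fixes U :: "'i set" and M :: "'i \<Rightarrow> 'a measure" and e v :: "'i \<Rightarrow> 'a \<Rightarrow> real"
  assumes prob: "\<And>i. i \<in> U \<Longrightarrow> prob_space (M i)"
    and integrable_site: "\<And>i p q. i \<in> U \<Longrightarrow> integrable (M i) (\<lambda>t. e i t ^ p * v i t ^ q)"
begin

definition site :: "nat \<Rightarrow> nat \<Rightarrow> 'i \<Rightarrow> 'a \<Rightarrow> real" where
  "site p q i t = e i t ^ p * v i t ^ q"

definition site_moment :: "nat \<Rightarrow> nat \<Rightarrow> 'i \<Rightarrow> real" where
  "site_moment p q i = (\<integral>t. site p q i t \<partial>M i)"

definition SE :: "'i set \<Rightarrow> ('i \<Rightarrow> 'a) \<Rightarrow> real" where "SE I x = (\<Sum>i\<in>I. e i (x i))"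
definition SEV :: "'i set \<Rightarrow> ('i \<Rightarrow> 'a) \<Rightarrow> real" where "SEV I x = (\<Sum>i\<in>I. e i (x i) * v i (x i))"
definition SV :: "'i set \<Rightarrow> ('i \<Rightarrow> 'a) \<Rightarrow> real" where "SV I x = (\<Sum>i\<in>I. v i (x i))"
definition SEV2 :: "'i set \<Rightarrow> ('i \<Rightarrow> 'a) \<Rightarrow> real" where "SEV2 I x = (\<Sum>i\<in>I. e i (x i) * v i (x i) ^ 2)"

text \<open>After clearing denominators, score products and Hessian entries consist of these four
  sums and of factors from at most two single sites.\<close>

definition mon :: "nat \<Rightarrow> nat \<Rightarrow> nat \<Rightarrow> nat \<Rightarrow> 'i set \<Rightarrow> ('i \<Rightarrow> 'a) \<Rightarrow> real" where
  "mon a b c d I x = SE I x ^ a * SEV I x ^ b * SV I x ^ c * SEV2 I x ^ d"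

definition moment :: "nat \<Rightarrow> nat \<Rightarrow> nat \<Rightarrow> nat \<Rightarrow> 'i set \<Rightarrow> real" where
  "moment a b c d I = (\<integral>x. mon a b c d I x \<partial>PiM I M)"

lemma has_bochner_integral_site:
  "i \<in> U \<Longrightarrow> has_bochner_integral (M i) (site p q i) (site_moment p q i)"
  using integrable_site[of i p q] by (simp add: has_bochner_integral_iff site_moment_def site_def[abs_def])

lemma mon_restrict: "mon a b c d I (restrict x I) = mon a b c d I x"
  by (simp add: mon_def SE_def SEV_def SV_def SEV2_def)

text \<open>Each of the four sums gains one summand, and the four powers are expanded by the
  binomial theorem. Every factor e, e v, v or e v^2 taken from the new site raises its exponents by
  (1,0), (1,1), (0,1) or (1,2). The additional factor \<open>site p q\<close> serves for integrands
  that single out one site.\<close>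

lemma mon_insert:
  assumes "finite I" "k \<notin> I"
  shows "mon a b c d (insert k I) x * site p q k (x k) =
    (\<Sum>i\<le>a. \<Sum>j\<le>b. \<Sum>l\<le>c. \<Sum>m\<le>d. real ((a choose i) * (b choose j) * (c choose l) * (d choose m)) *
      (mon i j l m I x * site (p + (a - i) + (b - j) + (d - m)) (q + (b - j) + (c - l) + 2 * (d - m)) k (x k)))"
proof -
  let ?e = "e k (x k)" and ?v = "v k (x k)"
  have "mon a b c d (insert k I) x * site p q k (x k) =
      (SE I x + ?e) ^ a * (SEV I x + ?e * ?v) ^ b * (SV I x + ?v) ^ c * (SEV2 I x + ?e * ?v ^ 2) ^ d * site p q k (x k)"
    using assms by (simp add: mon_def SE_def SEV_def SV_def SEV2_def add.commute)
  also have "\<dots> = (\<Sum>i\<le>a. \<Sum>j\<le>b. \<Sum>l\<le>c. \<Sum>m\<le>d.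
      (of_nat (a choose i) * SE I x ^ i * ?e ^ (a - i)) * (of_nat (b choose j) * SEV I x ^ j * (?e * ?v) ^ (b - j)) *
      (of_nat (c choose l) * SV I x ^ l * ?v ^ (c - l)) * (of_nat (d choose m) * SEV2 I x ^ m * (?e * ?v ^ 2) ^ (d - m)) * site p q k (x k))"
    unfolding binomial_ring unfolding mult_four_sums unfolding sum_distrib_right ..
  also have "\<dots> = (\<Sum>i\<le>a. \<Sum>j\<le>b. \<Sum>l\<le>c. \<Sum>m\<le>d. real ((a choose i) * (b choose j) * (c choose l) * (d choose m)) *
      (mon i j l m I x * site (p + (a - i) + (b - j) + (d - m)) (q + (b - j) + (c - l) + 2 * (d - m)) k (x k)))"
    by (intro sum.cong refl)
       (simp only: mon_def site_def power_add mult_2 mult_2_right power2_eq_square power_mult_distrib of_nat_mult mult_ac)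
  finally show ?thesis .
qed

text \<open>Every term of the expansion splits into a function of the old sites and one of the new
  site, which are independent. Integrability over I is a premise because this lemma is itself the
  induction step that proves it.\<close>

lemma has_bochner_integral_mon_insert:
  assumes I: "finite I" "k \<notin> I" "insert k I \<subseteq> U"
    and mon: "\<And>a b c d. integrable (PiM I M) (mon a b c d I)"
  shows "has_bochner_integral (PiM (insert k I) M) (\<lambda>x. mon a b c d (insert k I) x * site p q k (x k))
    (\<Sum>i\<le>a. \<Sum>j\<le>b. \<Sum>l\<le>c. \<Sum>m\<le>d. real ((a choose i) * (b choose j) * (c choose l) * (d choose m)) *
      (moment i j l m I * site_moment (p + (a - i) + (b - j) + (d - m)) (q + (b - j) + (c - l) + 2 * (d - m)) k))"
  unfolding mon_insert[OF I(1,2)]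
proof (intro has_bochner_integral_sum has_bochner_integral_mult_right)
  fix i j l m p q
  have "has_bochner_integral (PiM (insert k I) M) (\<lambda>x. mon i j l m I (restrict x I) * site p q k (x k))
      (moment i j l m I * site_moment p q k)"
    using I mon prob
    by (intro has_bochner_integral_PiM_insert has_bochner_integral_site) (auto simp: has_bochner_integral_iff moment_def)
  then show "has_bochner_integral (PiM (insert k I) M) (\<lambda>x. mon i j l m I x * site p q k (x k))
      (moment i j l m I * site_moment p q k)"
    by (simp only: mon_restrict)
qed

lemma integrable_mon:
  assumes "finite I" "I \<subseteq> U"
  shows "integrable (PiM I M) (mon a b c d I)"
  using assms
proof (induction I arbitrary: a b c d rule: finite_induct)
  case empty
  interpret prob_space "PiM {} M" by (rule prob_space_PiM) simp
  show ?case by (simp add: mon_def[abs_def] SE_def SEV_def SV_def SEV2_def)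
next
  case (insert k I)
  then show ?case
    using has_bochner_integral_mon_insert[of I k a b c d 0 0] by (simp add: has_bochner_integral_iff site_def)
qed

lemma has_bochner_integral_mon:
  "finite I \<Longrightarrow> I \<subseteq> U \<Longrightarrow> has_bochner_integral (PiM I M) (mon a b c d I) (moment a b c d I)"
  using integrable_mon by (simp add: has_bochner_integral_iff moment_def)

lemma moment_empty: "moment a b c d {} = (if a = 0 \<and> b = 0 \<and> c = 0 \<and> d = 0 then 1 else 0)"
proof -
  interpret prob_space "PiM {} M" by (rule prob_space_PiM) simp
  show ?thesis
    by (simp add: moment_def mon_def[abs_def] SE_def SEV_def SV_def SEV2_def prob_space power_0_left)
qed

text \<open>The case p = q = 0: a recursion that determines all moments from those of single
  sites.\<close>

lemma moment_insert:
  assumes "finite I" "k \<notin> I" "insert k I \<subseteq> U"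
  shows "moment a b c d (insert k I) =
    (\<Sum>i\<le>a. \<Sum>j\<le>b. \<Sum>l\<le>c. \<Sum>m\<le>d. real ((a choose i) * (b choose j) * (c choose l) * (d choose m)) *
      (moment i j l m I * site_moment ((a - i) + (b - j) + (d - m)) ((b - j) + (c - l) + 2 * (d - m)) k))"
  using has_bochner_integral_mon_insert[OF assms, of a b c d 0 0] integrable_mon[of I] assms
  by (simp add: has_bochner_integral_iff site_def moment_def)

end

text \<open>The model is e = E, a standard exponential variable, and v = b - (ln E +
  euler_mascheroni), with z the variance of ln E. Keeping b and z symbolic turns the inductions
  below into polynomial identities.\<close>

locale exponential_log_pairs = independent_pairs U M e v
  for U :: "'i set" and M :: "'i \<Rightarrow> 'a measure" and e v :: "'i \<Rightarrow> 'a \<Rightarrow> real" +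
  fixes b :: "'i \<Rightarrow> real" and z :: real
  assumes site_moment: "i \<in> U \<Longrightarrow> site_moment 1 0 i = 1" "i \<in> U \<Longrightarrow> site_moment 2 0 i = 2"
    "i \<in> U \<Longrightarrow> site_moment 0 1 i = b i" "i \<in> U \<Longrightarrow> site_moment 1 1 i = b i - 1"
    "i \<in> U \<Longrightarrow> site_moment 2 1 i = 2 * b i - 3" "i \<in> U \<Longrightarrow> site_moment 0 2 i = b i ^ 2 + z"
    "i \<in> U \<Longrightarrow> site_moment 1 2 i = b i ^ 2 - 2 * b i + z"
    "i \<in> U \<Longrightarrow> site_moment 2 2 i = 2 * b i ^ 2 - 6 * b i + 2 * z + 2"
begin

lemma site_moment_0_0: "i \<in> U \<Longrightarrow> site_moment 0 0 i = 1"
  using prob[of i] by (simp add: site_moment_def site_def prob_space.prob_space)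

text \<open>The exponents are put in \<open>Suc\<close> form, in which the sums of the recursion
  unfold.\<close>

lemmas site_moments = site_moment_0_0 site_moment[unfolded numeral_2_eq_2 One_nat_def]

lemma moment_0: "finite I \<Longrightarrow> I \<subseteq> U \<Longrightarrow> moment 0 0 0 0 I = 1"
  by (induction I rule: finite_induct) (simp_all add: moment_empty moment_insert site_moments)

abbreviation "B I \<equiv> sum b I"
abbreviation "C I \<equiv> \<Sum>i\<in>I. b i ^ 2"
abbreviation "n I \<equiv> real (card I)"

section \<open>Closed forms of the joint moments\<close>

lemmas moment_0' [simp] = moment_0

text \<open>The four digits are the exponents of \<open>SE\<close>, \<open>SEV\<close>,
  \<open>SV\<close> and \<open>SEV2\<close>. Each value is verified by induction: besides the moment
  at hand, the recursion calls only moments with smaller exponents, available as primed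
  simplification rules, and a polynomial identity in \<open>n I\<close>, \<open>B I\<close> and
  \<open>C I\<close> remains.\<close>

lemma moment_1000: "finite I \<Longrightarrow> I \<subseteq> U \<Longrightarrow> moment 1 0 0 0 I = n I"
proof (induction I rule: finite_induct)
  case (insert k I)
  then show ?case
    by (simp add: moment_insert site_moments numeral_2_eq_2) (simp add: algebra_simps power2_eq_square power3_eq_cube)?
qed (simp add: moment_empty)

lemmas moment_1000' [simp] = moment_1000[unfolded numeral_2_eq_2 One_nat_def]

lemma moment_2000: "finite I \<Longrightarrow> I \<subseteq> U \<Longrightarrow> moment 2 0 0 0 I = n I + n I ^ 2"
proof (induction I rule: finite_induct)
  case (insert k I)
  then show ?case
    by (simp add: moment_insert site_moments numeral_2_eq_2) (simp add: algebra_simps power2_eq_square power3_eq_cube)?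
qed (simp add: moment_empty)

lemmas moment_2000' [simp] = moment_2000[unfolded numeral_2_eq_2 One_nat_def]

lemma moment_0010: "finite I \<Longrightarrow> I \<subseteq> U \<Longrightarrow> moment 0 0 1 0 I = B I"
proof (induction I rule: finite_induct)
  case (insert k I)
  then show ?case
    by (simp add: moment_insert site_moments numeral_2_eq_2) (simp add: algebra_simps power2_eq_square power3_eq_cube)?
qed (simp add: moment_empty)

lemmas moment_0010' [simp] = moment_0010[unfolded numeral_2_eq_2 One_nat_def]

lemma moment_0020: "finite I \<Longrightarrow> I \<subseteq> U \<Longrightarrow> moment 0 0 2 0 I = B I ^ 2 + n I * z"
proof (induction I rule: finite_induct)
  case (insert k I)
  then show ?case
    by (simp add: moment_insert site_moments numeral_2_eq_2) (simp add: algebra_simps power2_eq_square power3_eq_cube)?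
qed (simp add: moment_empty)

lemmas moment_0020' [simp] = moment_0020[unfolded numeral_2_eq_2 One_nat_def]

lemma moment_1010: "finite I \<Longrightarrow> I \<subseteq> U \<Longrightarrow> moment 1 0 1 0 I = n I * B I - n I"
proof (induction I rule: finite_induct)
  case (insert k I)
  then show ?case
    by (simp add: moment_insert site_moments numeral_2_eq_2) (simp add: algebra_simps power2_eq_square power3_eq_cube)?
qed (simp add: moment_empty)

lemmas moment_1010' [simp] = moment_1010[unfolded numeral_2_eq_2 One_nat_def]

lemma moment_2010: "finite I \<Longrightarrow> I \<subseteq> U \<Longrightarrow> moment 2 0 1 0 I = n I * B I - n I - 2 * n I ^ 2 + n I ^ 2 * B I"
proof (induction I rule: finite_induct)
  case (insert k I)
  then show ?case
    by (simp add: moment_insert site_moments numeral_2_eq_2) (simp add: algebra_simps power2_eq_square power3_eq_cube)?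
qed (simp add: moment_empty)

lemmas moment_2010' [simp] = moment_2010[unfolded numeral_2_eq_2 One_nat_def]

lemma moment_1020: "finite I \<Longrightarrow> I \<subseteq> U \<Longrightarrow> moment 1 0 2 0 I = n I * B I ^ 2 - 2 * n I * B I + n I ^ 2 * z"
proof (induction I rule: finite_induct)
  case (insert k I)
  then show ?case
    by (simp add: moment_insert site_moments numeral_2_eq_2) (simp add: algebra_simps power2_eq_square power3_eq_cube)?
qed (simp add: moment_empty)

lemmas moment_1020' [simp] = moment_1020[unfolded numeral_2_eq_2 One_nat_def]

lemma moment_2020: "finite I \<Longrightarrow> I \<subseteq> U \<Longrightarrow> moment 2 0 2 0 I = n I * B I ^ 2 - 2 * n I * B I + n I ^ 2 * (2 + z - 4 * B I + B I ^ 2) + n I ^ 3 * z"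
proof (induction I rule: finite_induct)
  case (insert k I)
  then show ?case
    by (simp add: moment_insert site_moments numeral_2_eq_2) (simp add: algebra_simps power2_eq_square power3_eq_cube)?
qed (simp add: moment_empty)

lemma moment_0100: "finite I \<Longrightarrow> I \<subseteq> U \<Longrightarrow> moment 0 1 0 0 I = B I - n I"
proof (induction I rule: finite_induct)
  case (insert k I)
  then show ?case
    by (simp add: moment_insert site_moments numeral_2_eq_2) (simp add: algebra_simps power2_eq_square power3_eq_cube)?
qed (simp add: moment_empty)

lemmas moment_0100' [simp] = moment_0100[unfolded numeral_2_eq_2 One_nat_def]

lemma moment_0110: "finite I \<Longrightarrow> I \<subseteq> U \<Longrightarrow> moment 0 1 1 0 I = B I ^ 2 - B I + n I * z - n I * B I"
proof (induction I rule: finite_induct)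
  case (insert k I)
  then show ?case
    by (simp add: moment_insert site_moments numeral_2_eq_2) (simp add: algebra_simps power2_eq_square power3_eq_cube)?
qed (simp add: moment_empty)

lemmas moment_0110' [simp] = moment_0110[unfolded numeral_2_eq_2 One_nat_def]

lemma moment_1100: "finite I \<Longrightarrow> I \<subseteq> U \<Longrightarrow> moment 1 1 0 0 I = B I - 2 * n I + n I * B I - n I ^ 2"
proof (induction I rule: finite_induct)
  case (insert k I)
  then show ?case
    by (simp add: moment_insert site_moments numeral_2_eq_2) (simp add: algebra_simps power2_eq_square power3_eq_cube)?
qed (simp add: moment_empty)

lemmas moment_1100' [simp] = moment_1100[unfolded numeral_2_eq_2 One_nat_def]

lemma moment_1110: "finite I \<Longrightarrow> I \<subseteq> U \<Longrightarrow> moment 1 1 1 0 I = B I ^ 2 - B I + n I * (1 + z - 4 * B I + B I ^ 2) + n I ^ 2 * (1 + z - B I)"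
proof (induction I rule: finite_induct)
  case (insert k I)
  then show ?case
    by (simp add: moment_insert site_moments numeral_2_eq_2) (simp add: algebra_simps power2_eq_square power3_eq_cube)?
qed (simp add: moment_empty)

lemmas moment_1110' [simp] = moment_1110[unfolded numeral_2_eq_2 One_nat_def]

text \<open>The sum of squares \<open>C I\<close> appears because a site paired with itself
  contributes \<open>2 * b i ^ 2\<close> to leading order, whereas two distinct sites contribute
  \<open>(b i - 1) * (b j - 1)\<close>.\<close>

lemma moment_0200: "finite I \<Longrightarrow> I \<subseteq> U \<Longrightarrow> moment 0 2 0 0 I = C I - 4 * B I + B I ^ 2 + n I + 2 * n I * z - 2 * n I * B I + n I ^ 2"
proof (induction I rule: finite_induct)
  case (insert k I)
  then show ?case
    by (simp add: moment_insert site_moments numeral_2_eq_2) (simp add: algebra_simps power2_eq_square power3_eq_cube)?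
qed (simp add: moment_empty)

lemma moment_0001: "finite I \<Longrightarrow> I \<subseteq> U \<Longrightarrow> moment 0 0 0 1 I = C I - 2 * B I + n I * z"
proof (induction I rule: finite_induct)
  case (insert k I)
  then show ?case
    by (simp add: moment_insert site_moments numeral_2_eq_2) (simp add: algebra_simps power2_eq_square power3_eq_cube)?
qed (simp add: moment_empty)

lemmas moment_0001' [simp] = moment_0001[unfolded numeral_2_eq_2 One_nat_def]

lemma moment_1001: "finite I \<Longrightarrow> I \<subseteq> U \<Longrightarrow> moment 1 0 0 1 I = C I - 4 * B I + 2 * n I + n I * z + n I * C I - 2 * n I * B I + n I ^ 2 * z"
proof (induction I rule: finite_induct)
  case (insert k I)
  then show ?case
    by (simp add: moment_insert site_moments numeral_2_eq_2) (simp add: algebra_simps power2_eq_square power3_eq_cube)?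
qed (simp add: moment_empty)

lemmas moment_1001' [simp] = moment_1001[unfolded numeral_2_eq_2 One_nat_def]

text \<open>Site i occurs both inside the sums and as a separate factor. Splitting it off from I
  merges both occurrences into one site statistic, to which the expansion with (p, q) = (1, 0) or
  (1, 1) applies.\<close>

lemma has_bochner_integral_mon_site:
  assumes "finite I" "I \<subseteq> U" "i \<in> I"
  shows "has_bochner_integral (PiM I M) (\<lambda>x. SE I x * site 1 0 i (x i)) (n I + 1)"
    "has_bochner_integral (PiM I M) (\<lambda>x. SEV I x * site 1 0 i (x i)) (B I + b i - n I - 2)"
    "has_bochner_integral (PiM I M) (\<lambda>x. SE I x * SV I x * site 1 0 i (x i)) ((n I + 1) * B I - 2 * n I - 1)"
    "has_bochner_integral (PiM I M) (\<lambda>x. SE I x * site 1 1 i (x i)) ((n I + 1) * b i - n I - 2)"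
proof -
  obtain J where J: "I = insert i J" "i \<notin> J" using assms(3) by (meson Set.set_insert)
  with assms have J': "finite J" "insert i J \<subseteq> U" "J \<subseteq> U" "i \<in> U" by auto
  note h = has_bochner_integral_mon_insert[OF J'(1) J(2) J'(2) integrable_mon[OF J'(1,3)]]
  note eval = mon_def site_moments numeral_2_eq_2 J' J(2)
  show "has_bochner_integral (PiM I M) (\<lambda>x. SE I x * site 1 0 i (x i)) (n I + 1)"
    unfolding J(1) by (rule has_bochner_integral_cong_value[OF h[of 1 0 0 0]]) (auto simp: eval)
  show "has_bochner_integral (PiM I M) (\<lambda>x. SEV I x * site 1 0 i (x i)) (B I + b i - n I - 2)"
    unfolding J(1) by (rule has_bochner_integral_cong_value[OF h[of 0 1 0 0]]) (auto simp: eval)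
  show "has_bochner_integral (PiM I M) (\<lambda>x. SE I x * SV I x * site 1 0 i (x i)) ((n I + 1) * B I - 2 * n I - 1)"
    unfolding J(1) by (rule has_bochner_integral_cong_value[OF h[of 1 0 1 0]]) (auto simp: eval algebra_simps)
  show "has_bochner_integral (PiM I M) (\<lambda>x. SE I x * site 1 1 i (x i)) ((n I + 1) * b i - n I - 2)"
    unfolding J(1) by (rule has_bochner_integral_cong_value[OF h[of 1 0 0 0]]) (auto simp: eval algebra_simps)
qed

lemma has_bochner_integral_site_site:
  assumes "finite I" "I \<subseteq> U" "i \<in> I" "j \<in> I"
  shows "has_bochner_integral (PiM I M) (\<lambda>x. e i (x i) * e j (x j)) (if i = j then 2 else 1)"
proof (cases "i = j")
  case True
  obtain J where J: "I = insert i J" "i \<notin> J" using assms(3) by (meson Set.set_insert)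
  with assms have J': "finite J" "insert i J \<subseteq> U" "J \<subseteq> U" "i \<in> U" by auto
  \<comment> \<open>\<open>mon 0 0 0 0\<close> is the constant 1; it stands for the sites that do
    not occur in the integrand.\<close>
  have "has_bochner_integral (PiM I M) (\<lambda>x. mon 0 0 0 0 J (restrict x J) * site 2 0 i (x i)) (moment 0 0 0 0 J * site_moment 2 0 i)"
    unfolding J(1) using J(2) J' prob
    by (intro has_bochner_integral_PiM_insert has_bochner_integral_mon has_bochner_integral_site) auto
  then show ?thesis
    by (rule has_bochner_integral_cong_value) (use True J' in \<open>auto simp: mon_def site_def site_moment power2_eq_square\<close>)
next
  case False
  obtain J where J: "I = insert i J" "i \<notin> J" using assms(3) by (meson Set.set_insert)
  with assms False obtain L where L: "J = insert j L" "j \<notin> L" by (metis Set.set_insert insertE)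
  have sub: "finite L" "insert j L \<subseteq> U" "L \<subseteq> U" "i \<in> U" "j \<in> U" "insert i (insert j L) \<subseteq> U" using assms J L by auto
  have "has_bochner_integral (PiM J M) (\<lambda>x. mon 0 0 0 0 L (restrict x L) * site 1 0 j (x j)) (moment 0 0 0 0 L * site_moment 1 0 j)"
    unfolding L(1) using L(2) sub prob
    by (intro has_bochner_integral_PiM_insert has_bochner_integral_mon has_bochner_integral_site) auto
  from has_bochner_integral_PiM_insert[OF _ J(2) this has_bochner_integral_site[OF sub(4)]] prob sub L(1)
  have "has_bochner_integral (PiM I M)
      (\<lambda>x. (mon 0 0 0 0 L (restrict (restrict x J) L) * site 1 0 j (restrict x J j)) * site 1 0 i (x i))
      ((moment 0 0 0 0 L * site_moment 1 0 j) * site_moment 1 0 i)"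
    unfolding J(1) by blast
  then show ?thesis
    by (rule has_bochner_integral_cong_value)
       (use False L sub in \<open>auto simp: mon_def site_def site_moment[unfolded One_nat_def]\<close>)
qed

section \<open>Expectations of score products and Hessian entries with denominators cleared\<close>

context
  fixes I :: "'i set"
  assumes I: "finite I" "I \<subseteq> U"
begin

text \<open>The total mass of the weight \<open>S\<^sup>2\<close>, hence its normalizing
  constant.\<close>

lemma second_moment_SE: "has_bochner_integral (PiM I M) (\<lambda>x. SE I x ^ 2) (n I * (n I + 1))"
  by (rule has_bochner_integral_cong_value[OF has_bochner_integral_mon[OF I, of 2 0 0 0]])
     (auto simp: mon_def moment_2000 I power2_eq_square algebra_simps)

text \<open>\<open>SE I x - n I * e i (x i)\<close> is \<open>S \<beta>\<^sub>i\<close> times the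
  score in direction \<open>\<beta>\<^sub>i\<close>. The excess on the diagonal comes from the
  second moment 2 of one exponential variable, against 1 for two distinct ones.\<close>

lemma score_moment_site_site:
  assumes i: "i \<in> I" and j: "j \<in> I"
  shows "has_bochner_integral (PiM I M) (\<lambda>x. (SE I x - n I * e i (x i)) * (SE I x - n I * e j (x j)))
    (n I * (n I * (if i = j then 1 else 0) - 1))"
proof -
  note s = has_bochner_integral_mon_site(1)[OF I]
  have "has_bochner_integral (PiM I M)
      (\<lambda>x. SE I x ^ 2 - n I * (SE I x * site 1 0 i (x i)) - n I * (SE I x * site 1 0 j (x j)) + n I ^ 2 * (e i (x i) * e j (x j)))
      (n I * (n I + 1) - n I * (n I + 1) - n I * (n I + 1) + n I ^ 2 * (if i = j then 2 else 1))"
    by (intro has_bochner_integral_add has_bochner_integral_diff has_bochner_integral_mult_right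
        second_moment_SE s[OF i] s[OF j] has_bochner_integral_site_site I i j)
  then show ?thesis
    by (rule has_bochner_integral_cong_value) (auto simp: site_def power2_eq_square algebra_simps)
qed

text \<open>The second factor is S \<tau> times the score in direction \<tau>.\<close>

lemma score_moment_site_log:
  assumes i: "i \<in> I"
  shows "has_bochner_integral (PiM I M)
    (\<lambda>x. (SE I x - n I * e i (x i)) * ((n I - 1) * SE I x + n I * SEV I x - SE I x * SV I x))
    (n I * (B I - n I * b i))"
proof -
  note m = has_bochner_integral_mon[OF I]
  note s = has_bochner_integral_mon_site[OF I i]
  have "has_bochner_integral (PiM I M)
      (\<lambda>x. (n I - 1) * mon 2 0 0 0 I x + n I * mon 1 1 0 0 I x - mon 2 0 1 0 I x -
        n I * ((n I - 1) * (SE I x * site 1 0 i (x i)) + n I * (SEV I x * site 1 0 i (x i)) - SE I x * SV I x * site 1 0 i (x i)))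
      ((n I - 1) * moment 2 0 0 0 I + n I * moment 1 1 0 0 I - moment 2 0 1 0 I -
        n I * ((n I - 1) * (n I + 1) + n I * (B I + b i - n I - 2) - ((n I + 1) * B I - 2 * n I - 1)))"
    by (intro has_bochner_integral_add has_bochner_integral_diff has_bochner_integral_mult_right m s)
  then show ?thesis
    by (rule has_bochner_integral_cong_value)
       (auto simp: site_def mon_def moment_2000 moment_1100 moment_2010[unfolded One_nat_def] I power2_eq_square algebra_simps)
qed

lemma score_moment_log_log:
  "has_bochner_integral (PiM I M) (\<lambda>x. ((n I - 1) * SE I x + n I * SEV I x - SE I x * SV I x) ^ 2)
    (n I * ((n I - 1) * (n I * z + 1) + n I * C I - B I ^ 2))"
proof -
  note m = has_bochner_integral_mon[OF I]
  have "has_bochner_integral (PiM I M)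
      (\<lambda>x. (n I - 1) ^ 2 * mon 2 0 0 0 I x + n I ^ 2 * mon 0 2 0 0 I x + mon 2 0 2 0 I x
        + 2 * (n I - 1) * n I * mon 1 1 0 0 I x - 2 * (n I - 1) * mon 2 0 1 0 I x - 2 * n I * mon 1 1 1 0 I x)
      ((n I - 1) ^ 2 * moment 2 0 0 0 I + n I ^ 2 * moment 0 2 0 0 I + moment 2 0 2 0 I
        + 2 * (n I - 1) * n I * moment 1 1 0 0 I - 2 * (n I - 1) * moment 2 0 1 0 I - 2 * n I * moment 1 1 1 0 I)"
    by (intro has_bochner_integral_add has_bochner_integral_diff has_bochner_integral_mult_right m)
  then show ?thesis
    by (rule has_bochner_integral_cong_value)
       (auto simp: mon_def moment_2000 moment_1100 moment_2010[unfolded One_nat_def] moment_0200 moment_2020 moment_1110 I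
         power2_eq_square power3_eq_cube algebra_simps)
qed

text \<open>Under the weights \<open>e\<^sub>j / S\<close>, the integrand is
  \<open>- S\<^sup>2\<close> times the covariance of v with the indicator of site i; the mixed
  second derivative is a multiple of it.\<close>

lemma hess_moment_site_log:
  assumes i: "i \<in> I"
  shows "has_bochner_integral (PiM I M) (\<lambda>x. e i (x i) * (SEV I x - SE I x * v i (x i))) (B I - n I * b i)"
proof -
  note s = has_bochner_integral_mon_site[OF I i]
  have "has_bochner_integral (PiM I M) (\<lambda>x. SEV I x * site 1 0 i (x i) - SE I x * site 1 1 i (x i))
      ((B I + b i - n I - 2) - ((n I + 1) * b i - n I - 2))"
    by (intro has_bochner_integral_diff s)
  then show ?thesis
    by (rule has_bochner_integral_cong_value) (auto simp: site_def algebra_simps)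
qed

text \<open>The integrand is \<open>S\<^sup>2\<close> times the variance of v under the weights
  \<open>e\<^sub>j / S\<close>.\<close>

lemma hess_moment_log_log:
  "has_bochner_integral (PiM I M) (\<lambda>x. SE I x * SEV2 I x - SEV I x ^ 2) (n I * C I - B I ^ 2 + n I * (n I - 1) * (z - 1))"
proof -
  note m = has_bochner_integral_mon[OF I]
  have "has_bochner_integral (PiM I M) (\<lambda>x. mon 1 0 0 1 I x - mon 0 2 0 0 I x) (moment 1 0 0 1 I - moment 0 2 0 0 I)"
    by (intro has_bochner_integral_diff m)
  then show ?thesis
    by (rule has_bochner_integral_cong_value)
       (auto simp: mon_def moment_1001 moment_0200 I power2_eq_square algebra_simps)
qed

end

end

section \<open>Derivatives of the log-likelihood\<close>

lemma concrete_density_face: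
  assumes "i \<in> {1..K}" "x i = 0"
  shows "concrete_density K \<beta> \<tau> x = 0"
proof -
  have "(\<Prod>i=1..K. \<beta> i / x i powr (\<tau> + 1)) = 0"
    using assms by (intro prod_zero) (auto intro!: bexI[of _ i])
  then show ?thesis by (simp add: concrete_density_def)
qed

text \<open>Since \<open>ln 0 = 0\<close>, the log-likelihood at such a point is identically 0 in
  the parameters. This settles the boundary of the simplex, where the analytic formulas
  fail.\<close>

lemma pderiv_log_lik_face:
  assumes "i \<in> {1..K}" "x i = 0"
  shows "pderiv_at A (log_lik K x) \<theta> = 0" "pderiv_at A (pderiv_at B (log_lik K x)) \<theta> = 0"
proof -
  have "log_lik K x = (\<lambda>_. 0)"
    using concrete_density_face[of i K x] assms by (simp add: log_lik_def fun_eq_iff)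
  then show "pderiv_at A (log_lik K x) \<theta> = 0" "pderiv_at A (pderiv_at B (log_lik K x)) \<theta> = 0"
    by (simp_all add: pderiv_at_def)
qed

text \<open>With \<open>u\<^sub>j = \<theta>\<^sub>j x\<^sub>j\<^sup>-\<^sup>\<tau>\<close>, the quantity \<open>log_coeff K x A \<theta> j\<close> is the logarithmic derivative of
  \<open>u\<^sub>j\<close> with respect to \<open>\<theta>\<^sub>A\<close>, so that all first and second derivatives of the log-likelihood are
  moments of \<open>log_coeff\<close> under the weights \<open>u\<^sub>j / \<Sum>\<^sub>k u\<^sub>k\<close>.\<close>

definition term_weight :: "nat \<Rightarrow> (nat \<Rightarrow> real) \<Rightarrow> (nat \<Rightarrow> real) \<Rightarrow> nat \<Rightarrow> real" where
  "term_weight K x \<theta> j = (\<theta> j / x j powr \<theta> (K + 1)) / (\<Sum>k=1..K. \<theta> k / x k powr \<theta> (K + 1))"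

definition log_coeff :: "nat \<Rightarrow> (nat \<Rightarrow> real) \<Rightarrow> nat \<Rightarrow> (nat \<Rightarrow> real) \<Rightarrow> nat \<Rightarrow> real" where
  "log_coeff K x A \<theta> j = (if A = K + 1 then - ln (x j) else if j = A then 1 / \<theta> A else 0)"

definition mean_coeff :: "nat \<Rightarrow> (nat \<Rightarrow> real) \<Rightarrow> nat \<Rightarrow> (nat \<Rightarrow> real) \<Rightarrow> real" where
  "mean_coeff K x A \<theta> = (\<Sum>j=1..K. term_weight K x \<theta> j * log_coeff K x A \<theta> j)"

definition score :: "nat \<Rightarrow> (nat \<Rightarrow> real) \<Rightarrow> nat \<Rightarrow> (nat \<Rightarrow> real) \<Rightarrow> real" where
  "score K x A \<theta> = (if A = K + 1 then (real K - 1) / \<theta> A - (\<Sum>j=1..K. ln (x j)) else 1 / \<theta> A) -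
    real K * mean_coeff K x A \<theta>"

text \<open>The large bracket is the derivative of \<open>mean_coeff K x B\<close> in direction A: a
  covariance under the weights, plus a correction because the coefficient
  \<open>1 / \<theta> A\<close> itself depends on \<open>\<theta> A\<close>.\<close>

definition hess :: "nat \<Rightarrow> (nat \<Rightarrow> real) \<Rightarrow> nat \<Rightarrow> nat \<Rightarrow> (nat \<Rightarrow> real) \<Rightarrow> real" where
  "hess K x A B \<theta> = (if A = B then if A = K + 1 then - (real K - 1) / (\<theta> A)\<^sup>2 else - (1 / (\<theta> A)\<^sup>2) else 0) -
    real K * ((\<Sum>j=1..K. term_weight K x \<theta> j * log_coeff K x A \<theta> j * log_coeff K x B \<theta> j)
      - mean_coeff K x A \<theta> * mean_coeff K x B \<theta>
      - (if A = B \<and> A \<noteq> K + 1 then term_weight K x \<theta> A / (\<theta> A)\<^sup>2 else 0))"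

context
  fixes K :: nat and x :: "nat \<Rightarrow> real"
  assumes K: "K \<ge> 1" and x: "\<And>i. i \<in> {1..K} \<Longrightarrow> x i > 0"
begin

lemma DERIV_term:
  assumes A: "A \<in> {1..K+1}" and j: "j \<in> {1..K}" and \<theta>: "\<forall>i\<in>{1..K+1}. \<theta> i > 0"
  shows "((\<lambda>t. (\<theta>(A := t)) j / x j powr ((\<theta>(A := t)) (K + 1))) has_real_derivative
    \<theta> j / x j powr \<theta> (K + 1) * log_coeff K x A \<theta> j) (at (\<theta> A))"
proof -
  have xj: "x j > 0" using x j by auto
  consider "A = K + 1" | "A = j" "A \<noteq> K + 1" | "A \<noteq> j" "A \<noteq> K + 1" by blast
  then show ?thesis
  proof cases
    case 1
    then have "j \<noteq> A" using j by auto
    with 1 xj show ?thesis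
      by (auto intro!: derivative_eq_intros simp: log_coeff_def)
  next
    case 2
    with \<theta> A have "\<theta> j > 0" by auto
    with 2 xj show ?thesis
      by (auto intro!: derivative_eq_intros simp: log_coeff_def)
  next
    case 3
    then show ?thesis by (simp add: log_coeff_def)
  qed
qed

lemma partition_pos:
  assumes "\<forall>i\<in>{1..K+1}. \<theta> i > 0"
  shows "(\<Sum>k=1..K. \<theta> k / x k powr \<theta> (K + 1)) > 0"
proof (rule sum_pos)
  fix i assume "i \<in> {1..K}"
  with assms x[of i] show "\<theta> i / x i powr \<theta> (K + 1) > 0" by auto
qed (use K in auto)

lemma DERIV_partition:
  assumes A: "A \<in> {1..K+1}" and \<theta>: "\<forall>i\<in>{1..K+1}. \<theta> i > 0"
  shows "((\<lambda>t. \<Sum>k=1..K. (\<theta>(A := t)) k / x k powr ((\<theta>(A := t)) (K + 1))) has_real_derivative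
    (\<Sum>k=1..K. \<theta> k / x k powr \<theta> (K + 1)) * mean_coeff K x A \<theta>) (at (\<theta> A))"
proof -
  let ?Q = "\<Sum>k=1..K. \<theta> k / x k powr \<theta> (K + 1)"
  have "?Q * mean_coeff K x A \<theta> = (\<Sum>k=1..K. \<theta> k / x k powr \<theta> (K + 1) * log_coeff K x A \<theta> k)"
    unfolding mean_coeff_def sum_distrib_left term_weight_def
    using partition_pos[OF \<theta>] by (intro sum.cong) (auto simp: less_imp_neq[symmetric])
  then show ?thesis
    using DERIV_term[OF A _ \<theta>] by (simp only:) (intro DERIV_sum)
qed

text \<open>As for any normalized weights u / Q, the logarithmic derivative is that of u minus the
  weighted mean of all of them.\<close>

lemma DERIV_term_weight:
  assumes A: "A \<in> {1..K+1}" and j: "j \<in> {1..K}" and \<theta>: "\<forall>i\<in>{1..K+1}. \<theta> i > 0"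
  shows "((\<lambda>t. term_weight K x (\<theta>(A := t)) j) has_real_derivative
    term_weight K x \<theta> j * (log_coeff K x A \<theta> j - mean_coeff K x A \<theta>)) (at (\<theta> A))"
proof -
  let ?Q = "\<Sum>k=1..K. \<theta> k / x k powr \<theta> (K + 1)" and ?u = "\<theta> j / x j powr \<theta> (K + 1)"
  have Q: "?Q > 0" by (rule partition_pos[OF \<theta>])
  have "((\<lambda>t. term_weight K x (\<theta>(A := t)) j) has_real_derivative
      (?u * log_coeff K x A \<theta> j * ?Q - ?u * (?Q * mean_coeff K x A \<theta>)) / (?Q * ?Q)) (at (\<theta> A))"
    using DERIV_divide[OF DERIV_term[OF A j \<theta>] DERIV_partition[OF A \<theta>]] Q
    unfolding term_weight_def fun_upd_triv by simp
  also have "(?u * log_coeff K x A \<theta> j * ?Q - ?u * (?Q * mean_coeff K x A \<theta>)) / (?Q * ?Q) =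
      ?u / ?Q * (log_coeff K x A \<theta> j - mean_coeff K x A \<theta>)"
  proof -
    have "(u * c * q - u * (q * m)) / (q * q) = u / q * (c - m)" if "q > 0" for u c q m :: real
      using that by (simp add: field_simps)
    then show ?thesis using Q .
  qed
  finally show ?thesis unfolding term_weight_def .
qed

text \<open>All factors are positive here, so the logarithm splits into pieces that are
  differentiated one by one; the logarithm of the partition sum has derivative
  \<open>mean_coeff\<close>.\<close>

lemma log_lik_interior:
  assumes \<theta>: "\<forall>i\<in>{1..K+1}. \<theta> i > 0"
  shows "log_lik K x \<theta> = ln (fact (K - 1)) + (real K - 1) * ln (\<theta> (K + 1))
      - real K * ln (\<Sum>k=1..K. \<theta> k / x k powr \<theta> (K + 1))
      + (\<Sum>i=1..K. ln (\<theta> i) - (\<theta> (K + 1) + 1) * ln (x i))"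
proof -
  let ?Q = "\<Sum>k=1..K. \<theta> k / x k powr \<theta> (K + 1)"
  have Q: "?Q > 0" by (rule partition_pos[OF \<theta>])
  have \<tau>: "\<theta> (K + 1) > 0" using \<theta> by simp
  have p: "\<theta> i / x i powr (\<theta> (K + 1) + 1) > 0" if "i \<in> {1..K}" for i
    using \<theta> x[OF that] that by simp
  then have P: "(\<Prod>i=1..K. \<theta> i / x i powr (\<theta> (K + 1) + 1)) > 0" by (rule prod_pos)
  have "ln (\<Prod>i=1..K. \<theta> i / x i powr (\<theta> (K + 1) + 1)) = (\<Sum>i=1..K. ln (\<theta> i / x i powr (\<theta> (K + 1) + 1)))"
    by (intro ln_prod less_imp_neq[OF p, symmetric] finite_atLeastAtMost)
  also have "\<dots> = (\<Sum>i=1..K. ln (\<theta> i) - (\<theta> (K + 1) + 1) * ln (x i))"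
  proof (rule sum.cong)
    fix i assume i: "i \<in> {1..K}"
    show "ln (\<theta> i / x i powr (\<theta> (K + 1) + 1)) = ln (\<theta> i) - (\<theta> (K + 1) + 1) * ln (x i)"
    proof -
      have "\<theta> i > 0" using \<theta> i by auto
      then show ?thesis using x[OF i] by (simp add: ln_div ln_powr)
    qed
  qed simp
  finally have lnP: "ln (\<Prod>i=1..K. \<theta> i / x i powr (\<theta> (K + 1) + 1)) = (\<Sum>i=1..K. ln (\<theta> i) - (\<theta> (K + 1) + 1) * ln (x i))" .
  have F: "fact (K - 1) * \<theta> (K + 1) ^ (K - 1) / ?Q ^ K > 0" using Q \<tau> by simp
  have "log_lik K x \<theta> = ln (fact (K - 1) * \<theta> (K + 1) ^ (K - 1) / ?Q ^ K) + ln (\<Prod>i=1..K. \<theta> i / x i powr (\<theta> (K + 1) + 1))"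
    unfolding log_lik_def concrete_density_def using F P by (intro ln_mult_pos)
  also have "ln (fact (K - 1) * \<theta> (K + 1) ^ (K - 1) / ?Q ^ K) = ln (fact (K - 1)) + (real K - 1) * ln (\<theta> (K + 1)) - real K * ln ?Q"
    using Q \<tau> K by (simp add: ln_div ln_mult ln_realpow of_nat_diff)
  finally show ?thesis unfolding lnP by simp
qed

lemma pderiv_log_lik:
  assumes A: "A \<in> {1..K+1}" and \<theta>: "\<forall>i\<in>{1..K+1}. \<theta> i > 0"
  shows "pderiv_at A (log_lik K x) \<theta> = score K x A \<theta>"
  unfolding pderiv_at_def
proof (rule DERIV_imp_deriv)
  let ?Q = "\<lambda>\<theta>. \<Sum>k=1..K. \<theta> k / x k powr \<theta> (K + 1)"
  define L where "L = (\<lambda>\<theta>. ln (fact (K - 1)) + (real K - 1) * ln (\<theta> (K + 1)) - real K * ln (?Q \<theta>)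
      + (\<Sum>i=1..K. ln (\<theta> i) - (\<theta> (K + 1) + 1) * ln (x i)))"
  have lnQ: "((\<lambda>t. ln (?Q (\<theta>(A := t)))) has_real_derivative mean_coeff K x A \<theta>) (at (\<theta> A))"
  proof -
    have cancel: "inverse q * (q * m) = m" if "q > 0" for q m :: real using that by simp
    show ?thesis
      using DERIV_chain2[OF DERIV_ln DERIV_partition[OF A \<theta>], unfolded fun_upd_triv, OF partition_pos[OF \<theta>]]
      unfolding cancel[OF partition_pos[OF \<theta>]] .
  qed
  have ln\<tau>: "((\<lambda>t. ln ((\<theta>(A := t)) (K + 1))) has_real_derivative (if A = K + 1 then 1 / \<theta> A else 0)) (at (\<theta> A))"
    using \<theta> A by (auto intro!: derivative_eq_intros)
  have s: "((\<lambda>t. \<Sum>i=1..K. ln ((\<theta>(A := t)) i) - ((\<theta>(A := t)) (K + 1) + 1) * ln (x i)) has_real_derivative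
      (\<Sum>i=1..K. if A = K + 1 then - ln (x i) else if i = A then 1 / \<theta> A else 0)) (at (\<theta> A))"
  proof (rule DERIV_sum)
    fix i assume i: "i \<in> {1..K}"
    consider "A = K + 1" | "A = i" "A \<noteq> K + 1" | "A \<noteq> i" "A \<noteq> K + 1" by blast
    then show "((\<lambda>t. ln ((\<theta>(A := t)) i) - ((\<theta>(A := t)) (K + 1) + 1) * ln (x i)) has_real_derivative
        (if A = K + 1 then - ln (x i) else if i = A then 1 / \<theta> A else 0)) (at (\<theta> A))"
      by cases (use i \<theta> in \<open>auto intro!: derivative_eq_intros\<close>)
  qed
  have "((\<lambda>t. L (\<theta>(A := t))) has_real_derivative 0 + (real K - 1) * (if A = K + 1 then 1 / \<theta> A else 0)
      - real K * mean_coeff K x A \<theta> + (\<Sum>i=1..K. if A = K + 1 then - ln (x i) else if i = A then 1 / \<theta> A else 0)) (at (\<theta> A))"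
    unfolding L_def by (intro DERIV_add DERIV_diff DERIV_cmult DERIV_const lnQ ln\<tau> s)
  also have "0 + (real K - 1) * (if A = K + 1 then 1 / \<theta> A else 0)
      - real K * mean_coeff K x A \<theta> + (\<Sum>i=1..K. if A = K + 1 then - ln (x i) else if i = A then 1 / \<theta> A else 0) = score K x A \<theta>"
    using A by (auto simp: score_def sum_negf)
  finally have "((\<lambda>t. L (\<theta>(A := t))) has_real_derivative score K x A \<theta>) (at (\<theta> A))" .
  then show "((\<lambda>t. log_lik K x (\<theta>(A := t))) has_real_derivative score K x A \<theta>) (at (\<theta> A))"
  \<comment> \<open>The closed formula is available only while all parameters are positive, hence
    the open set t > 0 around \<open>\<theta> A\<close>.\<close>
  proof (rule has_field_derivative_transform_within_open[where S = "{0<..}"])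
    fix t :: real assume "t \<in> {0<..}"
    then have "\<forall>i\<in>{1..K+1}. (\<theta>(A := t)) i > 0" using \<theta> by auto
    from log_lik_interior[of "\<theta>(A := t)", OF this] show "L (\<theta>(A := t)) = log_lik K x (\<theta>(A := t))"
      unfolding L_def by simp
  qed (use \<theta> A in auto)
qed

lemma DERIV_log_coeff:
  assumes A: "A \<in> {1..K+1}" and \<theta>: "\<forall>i\<in>{1..K+1}. \<theta> i > 0"
  shows "((\<lambda>t. log_coeff K x B (\<theta>(A := t)) j) has_real_derivative
    (if A = B \<and> A \<noteq> K + 1 \<and> j = A then - (1 / (\<theta> A)\<^sup>2) else 0)) (at (\<theta> A))"
proof (cases "A = B \<and> A \<noteq> K + 1 \<and> j = A")
  case True
  moreover have "\<theta> A \<noteq> 0" using \<theta> A by force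
  ultimately show ?thesis
    by (auto intro!: derivative_eq_intros simp: log_coeff_def power2_eq_square)
next
  case False
  then have "(\<lambda>t. log_coeff K x B (\<theta>(A := t)) j) = (\<lambda>t. log_coeff K x B \<theta> j)"
    by (auto simp: log_coeff_def fun_eq_iff)
  with False show ?thesis by auto
qed

text \<open>Product rule: differentiating the weights gives the covariance, differentiating the
  coefficients gives the correction, which lives on the single index j = A.\<close>

lemma DERIV_mean_coeff:
  assumes A: "A \<in> {1..K+1}" and \<theta>: "\<forall>i\<in>{1..K+1}. \<theta> i > 0"
  shows "((\<lambda>t. mean_coeff K x B (\<theta>(A := t))) has_real_derivative
    (\<Sum>j=1..K. term_weight K x \<theta> j * log_coeff K x A \<theta> j * log_coeff K x B \<theta> j)
      - mean_coeff K x A \<theta> * mean_coeff K x B \<theta>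
      - (if A = B \<and> A \<noteq> K + 1 then term_weight K x \<theta> A / (\<theta> A)\<^sup>2 else 0)) (at (\<theta> A))"
proof -
  let ?w = "term_weight K x \<theta>" and ?c = "\<lambda>A. log_coeff K x A \<theta>" and ?m = "\<lambda>A. mean_coeff K x A \<theta>"
  let ?d = "\<lambda>j. if A = B \<and> A \<noteq> K + 1 \<and> j = A then - (1 / (\<theta> A)\<^sup>2) else 0"
  have eq: "(\<lambda>t. mean_coeff K x B (\<theta>(A := t))) =
      (\<lambda>t. \<Sum>j=1..K. term_weight K x (\<theta>(A := t)) j * log_coeff K x B (\<theta>(A := t)) j)"
    by (simp add: mean_coeff_def fun_eq_iff)
  have "((\<lambda>t. mean_coeff K x B (\<theta>(A := t))) has_real_derivative
      (\<Sum>j=1..K. ?w j * (?c A j - ?m A) * ?c B j + ?d j * ?w j)) (at (\<theta> A))"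
    unfolding eq
  proof (rule DERIV_sum)
    fix j assume j: "j \<in> {1..K}"
    from DERIV_mult[OF DERIV_term_weight[OF A j \<theta>] DERIV_log_coeff[OF A \<theta>, of B j]]
    show "((\<lambda>t. term_weight K x (\<theta>(A := t)) j * log_coeff K x B (\<theta>(A := t)) j) has_real_derivative
        ?w j * (?c A j - ?m A) * ?c B j + ?d j * ?w j) (at (\<theta> A))"
      unfolding fun_upd_triv by simp
  qed
  also have "(\<Sum>j=1..K. ?w j * (?c A j - ?m A) * ?c B j + ?d j * ?w j) =
      (\<Sum>j=1..K. ?w j * ?c A j * ?c B j) - ?m A * (\<Sum>j=1..K. ?w j * ?c B j) + (\<Sum>j=1..K. ?d j * ?w j)"
    by (simp add: sum.distrib sum_subtractf sum_distrib_left algebra_simps)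
  also have "(\<Sum>j=1..K. ?w j * ?c B j) = ?m B" by (simp add: mean_coeff_def)
  also have "(\<Sum>j=1..K. ?d j * ?w j) = - (if A = B \<and> A \<noteq> K + 1 then ?w A / (\<theta> A)\<^sup>2 else 0)"
  proof (cases "A = B \<and> A \<noteq> K + 1")
    case True
    have "(\<Sum>j=1..K. ?d j * ?w j) = (\<Sum>j=1..K. if j = A then - (?w A / (\<theta> A)\<^sup>2) else 0)"
      using True by (intro sum.cong) auto
    then show ?thesis using True A by simp
  next
    case False
    then have "(\<Sum>j=1..K. ?d j * ?w j) = (\<Sum>j=1..K. 0)" by (intro sum.cong) auto
    then show ?thesis using False by auto
  qed
  finally show ?thesis by (simp only: add_uminus_conv_diff)
qed

lemma pderiv_pderiv_log_lik:
  assumes A: "A \<in> {1..K+1}" and B: "B \<in> {1..K+1}" and \<theta>: "\<forall>i\<in>{1..K+1}. \<theta> i > 0"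
  shows "pderiv_at A (pderiv_at B (log_lik K x)) \<theta> = hess K x A B \<theta>"
  unfolding pderiv_at_def[of A]
proof (rule DERIV_imp_deriv)
  have g: "((\<lambda>t. if B = K + 1 then (real K - 1) / (\<theta>(A := t)) B - (\<Sum>j=1..K. ln (x j)) else 1 / (\<theta>(A := t)) B) has_real_derivative
      (if A = B then if A = K + 1 then - (real K - 1) / (\<theta> A)\<^sup>2 else - (1 / (\<theta> A)\<^sup>2) else 0)) (at (\<theta> A))"
  proof -
    have "\<theta> A \<noteq> 0" using \<theta> A by force
    then show ?thesis by (auto intro!: derivative_eq_intros simp: power2_eq_square)
  qed
  have "((\<lambda>t. score K x B (\<theta>(A := t))) has_real_derivative hess K x A B \<theta>) (at (\<theta> A))"
    unfolding score_def hess_def by (intro DERIV_diff DERIV_cmult g DERIV_mean_coeff A \<theta>)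
  then show "((\<lambda>t. pderiv_at B (log_lik K x) (\<theta>(A := t))) has_real_derivative hess K x A B \<theta>) (at (\<theta> A))"
  \<comment> \<open>The formula for the first derivative is needed on a whole neighbourhood of
    \<open>\<theta> A\<close>, not only at the point.\<close>
  proof (rule has_field_derivative_transform_within_open[where S = "{0<..}"])
    fix t :: real assume "t \<in> {0<..}"
    then have "\<forall>i\<in>{1..K+1}. (\<theta>(A := t)) i > 0" using \<theta> by auto
    from pderiv_log_lik[OF B this] show "score K x B (\<theta>(A := t)) = pderiv_at B (log_lik K x) (\<theta>(A := t))"
      by (rule sym)
  qed (use \<theta> A in auto)
qed

end

section \<open>The Concrete distribution as a normalized Frechet vector\<close>

text \<open>The substitution t = b / y^\<tau> turns this into the n-th moment of the exponential
  law. With n = K + 1 it evaluates the radial integral.\<close>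

lemma nn_integral_frechet_moment:
  assumes "b > 0" "\<tau> > 0"
  shows "(\<integral>\<^sup>+y. ennreal (frechet_density b \<tau> y * (b / y powr \<tau>) ^ n) \<partial>lborel) = ennreal (fact n)"
proof -
  have "(\<integral>\<^sup>+y. ennreal (frechet_density b \<tau> y * (b / y powr \<tau>) ^ n) \<partial>lborel) =
      (\<integral>\<^sup>+y. ennreal ((b / y powr \<tau>) ^ n) \<partial>frechet b \<tau>)"
    using assms unfolding frechet_def
    by (subst nn_integral_density) (auto simp: ennreal_mult frechet_density_nonneg)
  also have "\<dots> = (\<integral>\<^sup>+t. ennreal (t ^ n) \<partial>distr (frechet b \<tau>) borel (\<lambda>y. b / y powr \<tau>))"
    by (subst nn_integral_distr) auto
  also have "\<dots> = (\<integral>\<^sup>+t. ennreal (exponential_density 1 t * t ^ n) \<partial>lborel)"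
    unfolding distr_frechet_exp1[OF assms]
    by (subst nn_integral_density) (auto simp: ennreal_mult' exponential_density_nonneg)
  also have "\<dots> = ennreal (fact n)"
    using nn_integral_erlang_ith_moment[of 1 0 n] by simp
  finally show ?thesis .
qed

lemma sets_prob_simplex [measurable]: "prob_simplex K \<in> sets (\<Pi>\<^sub>M i\<in>{1..K}. (borel :: real measure))"
proof -
  have "prob_simplex K = {x \<in> space (\<Pi>\<^sub>M i\<in>{1..K}. (borel :: real measure)). (\<Sum>i=1..K. x i) = 1 \<and> (\<forall>i\<in>{1..K}. 0 \<le> x i)}"
    by (auto simp: prob_simplex_def space_PiM PiE_def)
  also have "\<dots> \<in> sets (\<Pi>\<^sub>M i\<in>{1..K}. borel)" by measurable
  finally show ?thesis .
qed

lemma borel_measurable_concrete_density [measurable]: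
  "concrete_density K \<beta> \<tau> \<in> borel_measurable (\<Pi>\<^sub>M i\<in>{1..K}. borel)"
  unfolding concrete_density_def by measurable

lemma measurable_complete_last:
  assumes "K \<ge> 1"
  shows "complete_last K \<in> (\<Pi>\<^sub>M i\<in>{1..K-1}. lborel) \<rightarrow>\<^sub>M (\<Pi>\<^sub>M i\<in>{1..K}. borel)"
proof -
  have s: "sets (\<Pi>\<^sub>M i\<in>{1..K-1}. lborel) = sets (\<Pi>\<^sub>M i\<in>{1..K-1}. (borel :: real measure))"
    by (intro sets_PiM_cong) auto
  show ?thesis unfolding complete_last_def
    using assms by (intro measurable_fun_upd[where J = "{1..K-1}"]) (auto simp: measurable_ident_sets[OF s])
qed

text \<open>Off the positive orthant, a null set for the Frechet variables, an arbitrary vertex is returned,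
  so that the map takes values in the simplex everywhere.\<close>

definition simplex_normalize :: "nat \<Rightarrow> (nat \<Rightarrow> real) \<Rightarrow> (nat \<Rightarrow> real)" where
  "simplex_normalize K y = (if \<forall>i\<in>{1..K}. y i > 0 then (\<lambda>i\<in>{1..K}. y i / (\<Sum>j=1..K. y j))
    else (\<lambda>i\<in>{1..K}. if i = 1 then 1 else 0))"

lemma simplex_normalize_in:
  assumes "K \<ge> 1" shows "simplex_normalize K y \<in> prob_simplex K"
proof (cases "\<forall>i\<in>{1..K}. y i > 0")
  case True
  then have "(\<Sum>j=1..K. y j) > 0" using assms by (intro sum_pos) auto
  with True show ?thesis
    by (auto simp: simplex_normalize_def prob_simplex_def less_imp_le simp flip: sum_divide_distrib)
next
  case False
  have "(\<Sum>i=1..K. if i = 1 then 1 else (0::real)) = 1"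
    using assms by (simp add: sum.delta)
  with False show ?thesis unfolding simplex_normalize_def prob_simplex_def by auto
qed

abbreviation simplex_space :: "nat \<Rightarrow> (nat \<Rightarrow> real) measure" where
  "simplex_space K \<equiv> restrict_space (\<Pi>\<^sub>M i\<in>{1..K}. borel) (prob_simplex K)"

lemma sets_simplex_spaceD:
  assumes "A \<in> sets (simplex_space K)"
  shows "A \<in> sets (\<Pi>\<^sub>M i\<in>{1..K}. (borel :: real measure))" "A \<subseteq> prob_simplex K"
proof -
  from assms obtain B where B: "B \<in> sets (\<Pi>\<^sub>M i\<in>{1..K}. (borel :: real measure))" "A = prob_simplex K \<inter> B"
    unfolding sets_restrict_space by blast
  then show "A \<in> sets (\<Pi>\<^sub>M i\<in>{1..K}. (borel :: real measure))"
    by (simp only:) (intro sets.Int sets_prob_simplex)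
  from B show "A \<subseteq> prob_simplex K" by blast
qed

lemma measurable_simplex_normalize:
  assumes "K \<ge> 1" "sets M = sets (\<Pi>\<^sub>M i\<in>{1..K}. (borel :: real measure))"
  shows "simplex_normalize K \<in> M \<rightarrow>\<^sub>M simplex_space K"
proof -
  note [measurable_cong] = assms(2)
  have "simplex_normalize K \<in> M \<rightarrow>\<^sub>M (\<Pi>\<^sub>M i\<in>{1..K}. borel)"
    unfolding simplex_normalize_def by measurable
  then show ?thesis
    using simplex_normalize_in[OF assms(1)] by (intro measurable_restrict_space2) auto
qed

text \<open>Push-forward and restriction are unfolded to an integral over all of R^(K-1). The
  indicator of A, a subset of the simplex, takes over the role of the restricted domain.\<close>

lemma emeasure_concrete:
  assumes K: "K \<ge> 1" and A: "A \<in> sets (simplex_space K)"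
  shows "emeasure (concrete K \<beta> \<tau>) A =
    (\<integral>\<^sup>+x. ennreal (concrete_density K \<beta> \<tau> (complete_last K x)) * indicator A (complete_last K x) \<partial>(\<Pi>\<^sub>M i\<in>{1..K-1}. lborel))"
proof -
  let ?P = "\<Pi>\<^sub>M i\<in>{1..K-1}. (lborel :: real measure)"
  let ?D = "{y. complete_last K y \<in> prob_simplex K}"
  have A': "A \<in> sets (\<Pi>\<^sub>M i\<in>{1..K}. (borel :: real measure))" "A \<subseteq> prob_simplex K"
    using sets_simplex_spaceD[OF A] by auto
  have D: "?D \<inter> space ?P \<in> sets ?P"
    using measurable_sets[OF measurable_complete_last[OF K] sets_prob_simplex] by (simp add: vimage_def)
  have c: "complete_last K \<in> restrict_space ?P ?D \<rightarrow>\<^sub>M simplex_space K"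
    by (intro measurable_restrict_space2 measurable_restrict_space1 measurable_complete_last K)
       (auto simp: space_restrict_space)
  have f: "(\<lambda>x. ennreal (concrete_density K \<beta> \<tau> x)) \<in> borel_measurable (simplex_space K)"
    by (intro measurable_restrict_space1) measurable
  have fA: "(\<lambda>x. ennreal (concrete_density K \<beta> \<tau> x) * indicator A x) \<in> borel_measurable (simplex_space K)"
    using f A by (intro borel_measurable_times_ennreal borel_measurable_indicator)
  have "emeasure (concrete K \<beta> \<tau>) A = (\<integral>\<^sup>+x. ennreal (concrete_density K \<beta> \<tau> x) * indicator A x \<partial>simplex_lebesgue K)"
    unfolding concrete_def using f A by (intro emeasure_density) (simp_all add: simplex_lebesgue_def)
  also have "\<dots> = (\<integral>\<^sup>+x. ennreal (concrete_density K \<beta> \<tau> (complete_last K x)) * indicator A (complete_last K x) \<partial>restrict_space ?P ?D)"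
    unfolding simplex_lebesgue_def by (intro nn_integral_distr c) (simp only: measurable_distr_eq1 fA)
  also have "\<dots> = (\<integral>\<^sup>+x. ennreal (concrete_density K \<beta> \<tau> (complete_last K x)) * indicator A (complete_last K x) * indicator ?D x \<partial>?P)"
    using D by (intro nn_integral_restrict_space) auto
  also have "\<dots> = (\<integral>\<^sup>+x. ennreal (concrete_density K \<beta> \<tau> (complete_last K x)) * indicator A (complete_last K x) \<partial>?P)"
    using A' by (intro nn_integral_cong) (auto split: split_indicator)
  finally show ?thesis .
qed

text \<open>Along a ray through the simplex the density of independent Frechet variables,
  weighted by \<open>S\<^sup>2\<close>, splits into a one-dimensional Frechet density in the radius and the
  Concrete density of the direction.\<close>

lemma frechet_ray:
  assumes K: "K \<ge> 1" and \<beta>: "\<And>i. i \<in> {1..K} \<Longrightarrow> \<beta> i > 0" and \<tau>: "\<tau> > 0"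
    and x: "\<And>i. i \<in> {1..K} \<Longrightarrow> x i > 0" and r: "r > 0"
  defines "Q \<equiv> \<Sum>j=1..K. \<beta> j / x j powr \<tau>"
  shows "r ^ (K - 1) * ((\<Prod>i=1..K. frechet_density (\<beta> i) \<tau> (r * x i)) *
      ((\<Sum>j=1..K. \<beta> j / (r * x j) powr \<tau>)\<^sup>2 / (real K * (real K + 1)))) =
    concrete_density K \<beta> \<tau> x / fact (K + 1) * (frechet_density Q \<tau> r * (Q / r powr \<tau>) ^ (K + 1))"
proof -
  define P where "P = (\<Prod>i=1..K. \<beta> i / x i powr (\<tau> + 1))"
  define R where "R = r powr \<tau>"
  define k where "k = K - 1"
  have k: "K = Suc k" using K by (simp add: k_def)
  have R: "R > 0" "r powr (\<tau> + 1) = r * R" using r by (auto simp: R_def powr_add)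
  have "\<beta> i / x i powr \<tau> > 0" if "i \<in> {1..K}" for i
    using \<beta>[OF that] x[OF that] by simp
  then have Q: "Q > 0" unfolding Q_def using K by (intro sum_pos) auto
  have Qr: "(\<Sum>j=1..K. \<beta> j / (r * x j) powr \<tau>) = Q / R"
    unfolding Q_def R_def sum_divide_distrib using r x
    by (intro sum.cong) (auto simp: powr_mult less_imp_le)
  have "(\<Prod>i=1..K. frechet_density (\<beta> i) \<tau> (r * x i)) =
      (\<Prod>i=1..K. \<beta> i / x i powr (\<tau> + 1) * (\<tau> / (r * R)) * exp (- (\<beta> i / (r * x i) powr \<tau>)))"
    using r x by (intro prod.cong) (auto simp: frechet_density_def powr_mult less_imp_le R)
  also have "\<dots> = P * (\<tau> / (r * R)) ^ K * exp (\<Sum>i=1..K. - (\<beta> i / (r * x i) powr \<tau>))"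
    by (simp only: P_def exp_sum[OF finite_atLeastAtMost] prod.distrib prod_constant card_atLeastAtMost diff_Suc_1)
  also have "(\<Sum>i=1..K. - (\<beta> i / (r * x i) powr \<tau>)) = - (Q / R)"
    unfolding sum_negf Qr ..
  finally have 1: "(\<Prod>i=1..K. frechet_density (\<beta> i) \<tau> (r * x i)) = P * (\<tau> / (r * R)) ^ K * exp (- (Q / R))" .
  have 2: "concrete_density K \<beta> \<tau> x = fact (K - 1) * \<tau> ^ (K - 1) / Q ^ K * P"
    by (simp add: concrete_density_def Q_def P_def)
  have 3: "frechet_density Q \<tau> r = Q * \<tau> / (r * R) * exp (- (Q / R))"
    using r by (simp add: frechet_density_def R R_def[symmetric])
  define N where "N = real K * (real K + 1)"
  have N: "N > 0" "fact (K + 1) = N * fact (K - 1)" using K by (auto simp: N_def) (simp add: k algebra_simps)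
  define E where "E = exp (- (Q / R))"
  show ?thesis
    unfolding 1 2 3 Qr R_def[symmetric] E_def[symmetric] N(2) unfolding N_def[symmetric] unfolding k
    using r R(1) Q \<tau> N(1)
    by (simp add: field_simps power_divide power_mult_distrib power2_eq_square)
qed

text \<open>Both measures are evaluated at a set A. In polar coordinates A constrains only the
  direction, so the radius can be integrated out along each ray, which leaves the Concrete density
  integrated over A.\<close>

theorem concrete_eq_distr_frechet:
  assumes K: "K \<ge> 1" and \<beta>: "\<And>i. i \<in> {1..K} \<Longrightarrow> \<beta> i > 0" and \<tau>: "\<tau> > 0"
  shows "concrete K \<beta> \<tau> =
    distr (density (\<Pi>\<^sub>M i\<in>{1..K}. frechet (\<beta> i) \<tau>)
        (\<lambda>y. ennreal ((\<Sum>j=1..K. \<beta> j / y j powr \<tau>)\<^sup>2 / (real K * (real K + 1)))))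
      (simplex_space K) (simplex_normalize K)"
proof (rule measure_eqI)
  let ?Y = "\<Pi>\<^sub>M i\<in>{1..K}. frechet (\<beta> i) \<tau>"
  let ?L = "\<Pi>\<^sub>M i\<in>{1..K}. (lborel :: real measure)"
  define W where "W = (\<lambda>y. (\<Sum>j=1..K. \<beta> j / y j powr \<tau>)\<^sup>2 / (real K * (real K + 1)))"
  show "sets (concrete K \<beta> \<tau>) = sets (distr (density ?Y (\<lambda>y. ennreal ((\<Sum>j=1..K. \<beta> j / y j powr \<tau>)\<^sup>2 / (real K * (real K + 1))))) (simplex_space K) (simplex_normalize K))"
    by (simp add: concrete_def simplex_lebesgue_def)
  fix A assume "A \<in> sets (concrete K \<beta> \<tau>)"
  then have A: "A \<in> sets (simplex_space K)" by (simp add: concrete_def simplex_lebesgue_def)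
  have A': "A \<in> sets (\<Pi>\<^sub>M i\<in>{1..K}. (borel :: real measure))" "A \<subseteq> prob_simplex K"
    using sets_simplex_spaceD[OF A] by auto
  have sY: "sets ?Y = sets (\<Pi>\<^sub>M i\<in>{1..K}. (borel :: real measure))" by (intro sets_PiM_cong) auto
  have sL [measurable_cong]: "sets ?L = sets (\<Pi>\<^sub>M i\<in>{1..K}. (borel :: real measure))" by (intro sets_PiM_cong) auto
  have nY: "simplex_normalize K \<in> ?Y \<rightarrow>\<^sub>M simplex_space K" by (intro measurable_simplex_normalize K sY)
  have nL [measurable]: "simplex_normalize K \<in> ?L \<rightarrow>\<^sub>M simplex_space K" by (intro measurable_simplex_normalize K sL)
  have W [measurable]: "W \<in> borel_measurable ?L" unfolding W_def by measurable
  have WY: "W \<in> borel_measurable ?Y" using W by (simp add: measurable_cong_sets[OF sY] measurable_cong_sets[OF sL])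
  define G where "G = (\<lambda>y. ennreal (W y) * indicator A (simplex_normalize K y))"
  have iA [measurable]: "indicator A \<in> borel_measurable (simplex_space K)" using A by simp
  have G [measurable]: "G \<in> borel_measurable ?L" unfolding G_def by measurable
  have GY: "G \<in> borel_measurable ?Y" using G by (simp add: measurable_cong_sets[OF sY] measurable_cong_sets[OF sL])
  define H where "H = (\<lambda>y. (\<Prod>i=1..K. ennreal (frechet_density (\<beta> i) \<tau> (y i))) * G y)"
  have H: "H \<in> borel_measurable ?L" unfolding H_def by measurable
  have Ydens: "?Y = density ?L (\<lambda>y. \<Prod>i=1..K. ennreal (frechet_density (\<beta> i) \<tau> (y i)))"
    unfolding frechet_def using prob_space_imp_sigma_finite[OF prob_space_frechet] \<beta> \<tau>
    by (intro PiM_density) (auto simp: frechet_def intro: lborel.sigma_finite_measure_axioms)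
  have "emeasure (distr (density ?Y (\<lambda>y. ennreal (W y))) (simplex_space K) (simplex_normalize K)) A =
      (\<integral>\<^sup>+z. indicator A z \<partial>distr (density ?Y (\<lambda>y. ennreal (W y))) (simplex_space K) (simplex_normalize K))"
    using A by simp
  also have "\<dots> = (\<integral>\<^sup>+y. indicator A (simplex_normalize K y) \<partial>density ?Y (\<lambda>y. ennreal (W y)))"
    using nY by (intro nn_integral_distr) (simp_all only: measurable_distr_eq1 measurable_density_eq1 iA)
  also have "\<dots> = (\<integral>\<^sup>+y. G y \<partial>?Y)"
    unfolding G_def using WY measurable_compose[OF nY iA] by (intro nn_integral_density) auto
  also have "\<dots> = (\<integral>\<^sup>+y. H y \<partial>?L)"
    unfolding Ydens H_def by (intro nn_integral_density) measurable
  also have "\<dots> = (\<integral>\<^sup>+x. \<integral>\<^sup>+r. indicator {0<..} r * ennreal (r ^ (K - 1)) * H (\<lambda>i\<in>{1..K}. r * complete_last K x i) \<partial>lborel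
       \<partial>(\<Pi>\<^sub>M i\<in>{1..K-1}. lborel))"
  proof (intro nn_integral_PiM_polar K H ballI)
    fix y i assume H0: "H y \<noteq> 0" and i: "i \<in> {1..K}"
    have "frechet_density (\<beta> i) \<tau> (y i) \<noteq> 0"
    proof
      assume "frechet_density (\<beta> i) \<tau> (y i) = 0"
      with i have "(\<Prod>i=1..K. ennreal (frechet_density (\<beta> i) \<tau> (y i))) = 0"
        by (intro prod_zero bexI[of _ i]) auto
      with H0 show False by (simp add: H_def)
    qed
    then show "y i > 0" by (auto simp: frechet_density_def split: if_splits)
  qed
  also have "\<dots> = (\<integral>\<^sup>+x. ennreal (concrete_density K \<beta> \<tau> (complete_last K x)) * indicator A (complete_last K x) \<partial>(\<Pi>\<^sub>M i\<in>{1..K-1}. lborel))"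
  proof (rule nn_integral_cong)
    fix x' assume x': "x' \<in> space (\<Pi>\<^sub>M i\<in>{1..K-1}. (lborel :: real measure))"
    define x where "x = complete_last K x'"
    have ext: "x \<in> extensional {1..K}"
      using x' K by (auto simp: x_def complete_last_def space_PiM PiE_def extensional_def)
    have "{1..K} = insert K {1..K-1}" "K \<notin> {1..K-1}" using K by auto
    then have "(\<Sum>i=1..K. x i) = x K + (\<Sum>i=1..K-1. x i)" by simp
    also have "(\<Sum>i=1..K-1. x i) = (\<Sum>i=1..K-1. x' i)"
      by (intro sum.cong) (auto simp: x_def complete_last_def)
    \<comment> \<open>Because the coordinates of x sum to 1, the parameter r is the coordinate sum
      of r x, and normalizing r x returns x.\<close>
    finally have sum1: "(\<Sum>i=1..K. x i) = 1" by (simp add: x_def complete_last_def)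
    show "(\<integral>\<^sup>+r. indicator {0<..} r * ennreal (r ^ (K - 1)) * H (\<lambda>i\<in>{1..K}. r * complete_last K x' i) \<partial>lborel) =
        ennreal (concrete_density K \<beta> \<tau> (complete_last K x')) * indicator A (complete_last K x')"
      unfolding x_def[symmetric]
    proof (cases "\<forall>i\<in>{1..K}. x i > 0")
      case True
      define Q where "Q = (\<Sum>j=1..K. \<beta> j / x j powr \<tau>)"
      have "\<beta> i / x i powr \<tau> > 0" if "i \<in> {1..K}" for i
        using \<beta>[OF that] bspec[OF True that] by simp
      then have Q: "Q > 0" unfolding Q_def using K by (intro sum_pos) auto
      have d0: "concrete_density K \<beta> \<tau> x \<ge> 0"
        unfolding concrete_density_def using \<beta> \<tau>
        by (intro mult_nonneg_nonneg divide_nonneg_nonneg prod_nonneg zero_le_power sum_nonneg) (auto intro: less_imp_le)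
      \<comment> \<open>The integrand separates: everything that depends on the direction x can
        leave the integral over r.\<close>
      have "indicator {0<..} r * ennreal (r ^ (K - 1)) * H (\<lambda>i\<in>{1..K}. r * x i) =
          ennreal (concrete_density K \<beta> \<tau> x / fact (K + 1)) * indicator A x * ennreal (frechet_density Q \<tau> r * (Q / r powr \<tau>) ^ (K + 1))" for r
      proof (cases "r > 0")
        case r: True
        have n: "simplex_normalize K (\<lambda>i\<in>{1..K}. r * x i) = x"
        proof -
          have "(\<Sum>j=1..K. (\<lambda>i\<in>{1..K}. r * x i) j) = r"
            using sum1 by (simp flip: sum_distrib_left)
          then show ?thesis
            using True r ext unfolding simplex_normalize_def by (auto simp: fun_eq_iff restrict_def extensional_def)
        qed
        have "indicator {0<..} r * ennreal (r ^ (K - 1)) * H (\<lambda>i\<in>{1..K}. r * x i) =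
          ennreal (r ^ (K - 1) * ((\<Prod>i=1..K. frechet_density (\<beta> i) \<tau> (r * x i)) *
            ((\<Sum>j=1..K. \<beta> j / (r * x j) powr \<tau>)\<^sup>2 / (real K * (real K + 1))))) * indicator A x"
        proof -
          have "(\<Prod>i=1..K. ennreal (frechet_density (\<beta> i) \<tau> ((\<lambda>i\<in>{1..K}. r * x i) i))) =
              (\<Prod>i=1..K. ennreal (frechet_density (\<beta> i) \<tau> (r * x i)))"
            by (intro prod.cong) auto
          also have "\<dots> = ennreal (\<Prod>i=1..K. frechet_density (\<beta> i) \<tau> (r * x i))"
            using \<beta> \<tau> by (intro prod_ennreal frechet_density_nonneg)
          finally have p: "(\<Prod>i=1..K. ennreal (frechet_density (\<beta> i) \<tau> ((\<lambda>i\<in>{1..K}. r * x i) i))) =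
              ennreal (\<Prod>i=1..K. frechet_density (\<beta> i) \<tau> (r * x i))" .
          have q: "(\<Sum>j=1..K. \<beta> j / (\<lambda>i\<in>{1..K}. r * x i) j powr \<tau>) = (\<Sum>j=1..K. \<beta> j / (r * x j) powr \<tau>)"
            by (intro sum.cong) auto
          have m: "indicator {0<..} r * ennreal a * (ennreal b * (ennreal c * z)) = ennreal (a * (b * c)) * z"
            if "a \<ge> 0" "b \<ge> 0" "c \<ge> 0" for a b c z
            using that r by (simp add: ennreal_mult mult.assoc)
          show ?thesis
            unfolding H_def G_def n W_def p q
            by (rule m) (use r \<beta> \<tau> in \<open>auto intro!: prod_nonneg frechet_density_nonneg\<close>)
        qed
        also have "\<dots> = ennreal (concrete_density K \<beta> \<tau> x / fact (K + 1) * (frechet_density Q \<tau> r * (Q / r powr \<tau>) ^ (K + 1))) * indicator A x"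
          using True r unfolding Q_def by (subst frechet_ray[OF K \<beta> \<tau>]) auto
        also have "\<dots> = ennreal (concrete_density K \<beta> \<tau> x / fact (K + 1)) * indicator A x * ennreal (frechet_density Q \<tau> r * (Q / r powr \<tau>) ^ (K + 1))"
          using d0 by (subst ennreal_mult') (auto simp: mult_ac)
        finally show ?thesis .
      qed (simp add: frechet_density_def)
      then have "(\<integral>\<^sup>+r. indicator {0<..} r * ennreal (r ^ (K - 1)) * H (\<lambda>i\<in>{1..K}. r * x i) \<partial>lborel) =
          ennreal (concrete_density K \<beta> \<tau> x / fact (K + 1)) * indicator A x * ennreal (fact (K + 1))"
        \<comment> \<open>The factor (K + 1)! is rewritten as the radial integral, so that only a
          constant has to be pulled out.\<close>
        unfolding nn_integral_frechet_moment[OF Q \<tau>, of "K + 1", symmetric]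
        by (simp only:) (intro nn_integral_cmult, measurable)
      also have "\<dots> = ennreal (concrete_density K \<beta> \<tau> x) * indicator A x"
        using d0 by (simp add: mult_ac flip: ennreal_mult split: split_indicator)
      finally show "(\<integral>\<^sup>+r. indicator {0<..} r * ennreal (r ^ (K - 1)) * H (\<lambda>i\<in>{1..K}. r * x i) \<partial>lborel) =
          ennreal (concrete_density K \<beta> \<tau> x) * indicator A x" .
    next
      \<comment> \<open>On the left, a coordinate that is not positive annihilates a Frechet factor.
        On the right, a point of A lies in the simplex, so this coordinate is 0 and the density
        takes its default value 0.\<close>
      case False
      then obtain i where i: "i \<in> {1..K}" "x i \<le> 0" by (auto simp: not_less)
      have "indicator {0<..} r * ennreal (r ^ (K - 1)) * H (\<lambda>i\<in>{1..K}. r * x i) = 0" for r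
      proof (cases "r > 0")
        case True
        then have "\<not> r * x i > 0" using i by (simp add: zero_less_mult_iff)
        then have "(\<Prod>j=1..K. ennreal (frechet_density (\<beta> j) \<tau> ((\<lambda>i\<in>{1..K}. r * x i) j))) = 0"
          using i by (intro prod_zero bexI[of _ i]) (auto simp: frechet_density_def)
        then show ?thesis by (simp add: H_def)
      qed simp
      moreover have "ennreal (concrete_density K \<beta> \<tau> x) * indicator A x = 0"
      proof (cases "x \<in> A")
        case True
        then have "x i = 0" using A'(2) i by (force simp: prob_simplex_def)
        then show ?thesis using concrete_density_face[OF i(1)] by simp
      qed simp
      ultimately show "(\<integral>\<^sup>+r. indicator {0<..} r * ennreal (r ^ (K - 1)) * H (\<lambda>i\<in>{1..K}. r * x i) \<partial>lborel) =
          ennreal (concrete_density K \<beta> \<tau> x) * indicator A x"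
        by (simp only: nn_integral_const mult_zero_left)
    qed
  qed
  also have "\<dots> = emeasure (concrete K \<beta> \<tau>) A" by (rule emeasure_concrete[OF K A, symmetric])
  finally show "emeasure (concrete K \<beta> \<tau>) A = emeasure (distr (density ?Y (\<lambda>y. ennreal ((\<Sum>j=1..K. \<beta> j / y j powr \<tau>)\<^sup>2 / (real K * (real K + 1))))) (simplex_space K) (simplex_normalize K)) A"
    unfolding W_def ..
qed

section \<open>Transfer of expectations\<close>

lemma integrable_exp1_site: "integrable exp1 (\<lambda>t. t ^ p * (c - ln t) ^ q)"
proof -
  have int: "integrable exp1 (\<lambda>t. \<Sum>k\<le>q. (of_nat (q choose k) * c ^ k * (- 1) ^ (q - k)) * (t powr (real (p + 1) - 1) * ln t ^ (q - k)))"
    by (intro Bochner_Integration.integrable_sum integrable_mult_right integrable_log_moment) auto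
  have eq: "AE t in exp1. (\<Sum>k\<le>q. (of_nat (q choose k) * c ^ k * (- 1) ^ (q - k)) * (t powr (real (p + 1) - 1) * ln t ^ (q - k))) =
      t ^ p * (c - ln t) ^ q"
    using AE_exp1_pos
  proof eventually_elim
    fix t :: real assume t: "t > 0"
    have "(c - ln t) ^ q = (\<Sum>k\<le>q. of_nat (q choose k) * c ^ k * (- ln t) ^ (q - k))"
      using binomial_ring[of c "- ln t" q] by simp
    also have "t ^ p * \<dots> = (\<Sum>k\<le>q. (of_nat (q choose k) * c ^ k * (- 1) ^ (q - k)) * (t ^ p * ln t ^ (q - k)))"
      unfolding sum_distrib_left by (intro sum.cong refl) (subst power_minus, simp add: mult_ac)
    finally show "(\<Sum>k\<le>q. (of_nat (q choose k) * c ^ k * (- 1) ^ (q - k)) * (t powr (real (p + 1) - 1) * ln t ^ (q - k))) =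
      t ^ p * (c - ln t) ^ q"
      using t by (simp add: powr_realpow)
  qed
  show ?thesis by (rule integrable_cong_AE_imp[OF int _ eq]) auto
qed

text \<open>In the coordinate t = b / y^\<tau> one has ln b - ln t = \<tau> ln y for almost every
  y.\<close>

lemma has_bochner_integral_frechet_site:
  assumes b: "b > 0" and \<tau>: "\<tau> > 0"
    and h: "has_bochner_integral exp1 (\<lambda>t. t ^ p * (ln b - (ln t + g)) ^ q) c"
  shows "has_bochner_integral (frechet b \<tau>) (\<lambda>y. (b / y powr \<tau>) ^ p * (\<tau> * ln y - g) ^ q) c"
proof -
  have pos: "AE y in frechet b \<tau>. y > 0"
    unfolding frechet_def by (subst AE_density) (auto simp: frechet_density_def)
  have "has_bochner_integral (distr (frechet b \<tau>) borel (\<lambda>y. b / y powr \<tau>)) (\<lambda>t. t ^ p * (ln b - (ln t + g)) ^ q) c"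
    using h by (simp add: distr_frechet_exp1[OF b \<tau>])
  then have "has_bochner_integral (frechet b \<tau>) (\<lambda>y. (b / y powr \<tau>) ^ p * (ln b - (ln (b / y powr \<tau>) + g)) ^ q) c"
    by (simp add: has_bochner_integral_iff integrable_distr_eq integral_distr)
  moreover have "AE y in frechet b \<tau>. (b / y powr \<tau>) ^ p * (ln b - (ln (b / y powr \<tau>) + g)) ^ q =
      (b / y powr \<tau>) ^ p * (\<tau> * ln y - g) ^ q"
    using pos by eventually_elim (use b in \<open>simp add: ln_div ln_powr\<close>)
  ultimately show ?thesis
    by (subst (asm) has_bochner_integral_cong_AE) auto
qed

lemma exp1_site_moments:
  fixes b :: real
  defines "l \<equiv> \<lambda>t. ln t + (euler_mascheroni :: real)"
  shows "has_bochner_integral exp1 (\<lambda>t. t ^ 1 * (b - l t) ^ 0) 1"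
    "has_bochner_integral exp1 (\<lambda>t. t ^ 2 * (b - l t) ^ 0) 2"
    "has_bochner_integral exp1 (\<lambda>t. t ^ 0 * (b - l t) ^ 1) b"
    "has_bochner_integral exp1 (\<lambda>t. t ^ 1 * (b - l t) ^ 1) (b - 1)"
    "has_bochner_integral exp1 (\<lambda>t. t ^ 2 * (b - l t) ^ 1) (2 * b - 3)"
    "has_bochner_integral exp1 (\<lambda>t. t ^ 0 * (b - l t) ^ 2) (b ^ 2 + pi\<^sup>2 / 6)"
    "has_bochner_integral exp1 (\<lambda>t. t ^ 1 * (b - l t) ^ 2) (b ^ 2 - 2 * b + pi\<^sup>2 / 6)"
    "has_bochner_integral exp1 (\<lambda>t. t ^ 2 * (b - l t) ^ 2) (2 * b ^ 2 - 6 * b + 2 * (pi\<^sup>2 / 6) + 2)"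
proof -
  have l: "ln t + euler_mascheroni = l t" for t by (simp add: l_def)
  note m = exp1_moments[unfolded l]
  interpret prob_space exp1 by (rule prob_space_exp1)
  have c: "has_bochner_integral exp1 (\<lambda>t. 1) (1 :: real)"
    unfolding has_bochner_integral_iff lebesgue_integral_const using prob_space by simp
  have lin: "has_bochner_integral exp1 (\<lambda>t. f t * (b - l t) ^ 1) (b * u - v)"
    if "has_bochner_integral exp1 f u" "has_bochner_integral exp1 (\<lambda>t. f t * l t) v" for f u v
    by (rule has_bochner_integral_cong_value[OF has_bochner_integral_diff[OF has_bochner_integral_mult_right[OF that(1), of b] that(2)]])
       (auto simp: algebra_simps)
  have quad: "has_bochner_integral exp1 (\<lambda>t. f t * (b - l t) ^ 2) (b ^ 2 * u - 2 * b * v + w)"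
    if "has_bochner_integral exp1 f u" "has_bochner_integral exp1 (\<lambda>t. f t * l t) v"
      "has_bochner_integral exp1 (\<lambda>t. f t * (l t) ^ 2) w" for f u v w
    by (rule has_bochner_integral_cong_value[OF has_bochner_integral_add[OF has_bochner_integral_diff[
          OF has_bochner_integral_mult_right[OF that(1), of "b ^ 2"] has_bochner_integral_mult_right[OF that(2), of "2 * b"]] that(3)]])
       (auto simp: power2_eq_square algebra_simps)
  show "has_bochner_integral exp1 (\<lambda>t. t ^ 1 * (b - l t) ^ 0) 1" using m(1) by simp
  show "has_bochner_integral exp1 (\<lambda>t. t ^ 2 * (b - l t) ^ 0) 2" using m(2) by simp
  show "has_bochner_integral exp1 (\<lambda>t. t ^ 0 * (b - l t) ^ 1) b" using lin[OF c, of 0] m(3) by simp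
  show "has_bochner_integral exp1 (\<lambda>t. t ^ 1 * (b - l t) ^ 1) (b - 1)" using lin[OF m(1,4)] by simp
  show "has_bochner_integral exp1 (\<lambda>t. t ^ 2 * (b - l t) ^ 1) (2 * b - 3)" using lin[OF m(2,5)] by (simp add: mult.commute)
  show "has_bochner_integral exp1 (\<lambda>t. t ^ 0 * (b - l t) ^ 2) (b ^ 2 + pi\<^sup>2 / 6)" using quad[OF c, of 0 "pi\<^sup>2 / 6"] m(3,6) by simp
  show "has_bochner_integral exp1 (\<lambda>t. t ^ 1 * (b - l t) ^ 2) (b ^ 2 - 2 * b + pi\<^sup>2 / 6)" using quad[OF m(1,4,7)] by simp
  show "has_bochner_integral exp1 (\<lambda>t. t ^ 2 * (b - l t) ^ 2) (2 * b ^ 2 - 6 * b + 2 * (pi\<^sup>2 / 6) + 2)"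
    using quad[OF m(2,5,8)] by (simp add: algebra_simps)
qed

definition frechet_e :: "(nat \<Rightarrow> real) \<Rightarrow> real \<Rightarrow> nat \<Rightarrow> real \<Rightarrow> real" where
  "frechet_e \<beta> \<tau> i y = \<beta> i / y powr \<tau>"

text \<open>With \<open>E = frechet_e \<beta> \<tau> i y\<close> this is \<open>ln (\<beta> i) - (ln E + euler_mascheroni)\<close>; the constant centres
  \<open>ln E\<close>, which keeps Euler's constant out of all moments.\<close>

definition frechet_v :: "real \<Rightarrow> nat \<Rightarrow> real \<Rightarrow> real" where
  "frechet_v \<tau> i y = \<tau> * ln y - euler_mascheroni"

lemma exponential_log_pairs_frechet:
  assumes \<beta>: "\<And>i. i \<in> I \<Longrightarrow> \<beta> i > 0" and \<tau>: "\<tau> > 0"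
  shows "exponential_log_pairs I (\<lambda>i. frechet (\<beta> i) \<tau>) (frechet_e \<beta> \<tau>) (frechet_v \<tau>) (\<lambda>i. ln (\<beta> i)) (pi\<^sup>2 / 6)"
proof -
  have h: "has_bochner_integral (frechet (\<beta> i) \<tau>) (\<lambda>t. frechet_e \<beta> \<tau> i t ^ p * frechet_v \<tau> i t ^ q) c"
    if "i \<in> I" "has_bochner_integral exp1 (\<lambda>t. t ^ p * (ln (\<beta> i) - (ln t + euler_mascheroni)) ^ q) c" for i p q c
    unfolding frechet_e_def frechet_v_def using that \<beta> \<tau> by (intro has_bochner_integral_frechet_site)
  have "integrable exp1 (\<lambda>t. t ^ p * (ln (\<beta> i) - (ln t + euler_mascheroni)) ^ q)" for i p q
    using integrable_exp1_site[of p "ln (\<beta> i) - euler_mascheroni" q] by (simp add: algebra_simps)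
  then have "has_bochner_integral exp1 (\<lambda>t. t ^ p * (ln (\<beta> i) - (ln t + euler_mascheroni)) ^ q)
      (\<integral>t. t ^ p * (ln (\<beta> i) - (ln t + euler_mascheroni)) ^ q \<partial>exp1)" for i p q
    by (simp add: has_bochner_integral_iff)
  from h[OF _ this] have site: "i \<in> I \<Longrightarrow> integrable (frechet (\<beta> i) \<tau>) (\<lambda>t. frechet_e \<beta> \<tau> i t ^ p * frechet_v \<tau> i t ^ q)" for i p q
    by (simp only: has_bochner_integral_iff)
  interpret independent_pairs I "\<lambda>i. frechet (\<beta> i) \<tau>" "frechet_e \<beta> \<tau>" "frechet_v \<tau>"
    by (intro independent_pairs.intro prob_space_frechet \<beta> \<tau> site)
  have s: "site_moment p q i = c"
    if "i \<in> I" "has_bochner_integral exp1 (\<lambda>t. t ^ p * (ln (\<beta> i) - (ln t + euler_mascheroni)) ^ q) c" for i p q c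
    using h[OF that] by (simp add: has_bochner_integral_iff site_moment_def site_def)
  show ?thesis
    by unfold_locales (erule s, rule exp1_site_moments)+
qed

lemma simplex_normalize_pos:
  assumes "\<forall>i\<in>{1..K}. y i > 0" "i \<in> {1..K}"
  shows "simplex_normalize K y i = y i / (\<Sum>j=1..K. y j)" "(\<Sum>j=1..K. y j) > 0" "simplex_normalize K y i > 0"
proof -
  show s: "(\<Sum>j=1..K. y j) > 0" using assms by (intro sum_pos) auto
  show e: "simplex_normalize K y i = y i / (\<Sum>j=1..K. y j)" using assms by (simp add: simplex_normalize_def)
  show "simplex_normalize K y i > 0" unfolding e using assms s by simp
qed

text \<open>Transfer principle: G, in the applications a ratio with denominator
  \<open>S\<^sup>2\<close>, has to be known only after multiplication by \<open>S\<^sup>2\<close>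
  and at normalizations of positive vectors, which have full measure. The factor K (K + 1)
  compensates the normalization of the weight.\<close>

lemma has_bochner_integral_concrete:
  fixes G :: "(nat \<Rightarrow> real) \<Rightarrow> real"
  assumes K: "K \<ge> 1" and \<beta>: "\<And>i. i \<in> {1..K} \<Longrightarrow> \<beta> i > 0" and \<tau>: "\<tau> > 0"
    and G: "G \<in> borel_measurable (simplex_space K)"
    and h: "has_bochner_integral (\<Pi>\<^sub>M i\<in>{1..K}. frechet (\<beta> i) \<tau>) H (real K * (real K + 1) * c)"
    and H: "\<And>y. \<forall>i\<in>{1..K}. y i > 0 \<Longrightarrow>
      (\<Sum>j=1..K. \<beta> j / y j powr \<tau>)\<^sup>2 * G (simplex_normalize K y) = H y"
  shows "has_bochner_integral (concrete K \<beta> \<tau>) G c"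
proof -
  let ?Y = "\<Pi>\<^sub>M i\<in>{1..K}. frechet (\<beta> i) \<tau>"
  define W where "W = (\<lambda>y. (\<Sum>j=1..K. \<beta> j / y j powr \<tau>)\<^sup>2 / (real K * (real K + 1)))"
  have sY: "sets ?Y = sets (\<Pi>\<^sub>M i\<in>{1..K}. (borel :: real measure))" by (intro sets_PiM_cong) auto
  have n: "simplex_normalize K \<in> ?Y \<rightarrow>\<^sub>M simplex_space K" by (intro measurable_simplex_normalize K sY)
  have W: "W \<in> borel_measurable ?Y" unfolding W_def measurable_cong_sets[OF sY refl] by measurable
  have "AE y in ?Y. y i > 0" if "i \<in> {1..K}" for i
  proof (rule AE_PiM_component[where P = "\<lambda>t. t > 0"])
    show "prob_space (frechet (\<beta> i) \<tau>)" if "i \<in> {1..K}" for i using \<beta>[OF that] \<tau> by (rule prob_space_frechet)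
    show "AE y in frechet (\<beta> i) \<tau>. y > 0"
      unfolding frechet_def by (subst AE_density) (auto simp: frechet_density_def)
  qed fact
  then have pos: "AE y in ?Y. \<forall>i\<in>{1..K}. y i > 0"
    by (subst AE_finite_all) auto
  have "has_bochner_integral ?Y (\<lambda>y. H y / (real K * (real K + 1))) (real K * (real K + 1) * c / (real K * (real K + 1)))"
    by (intro has_bochner_integral_divide_zero h)
  moreover have "real K * (real K + 1) * c / (real K * (real K + 1)) = c" using K by simp
  moreover have "AE y in ?Y. H y / (real K * (real K + 1)) = W y * G (simplex_normalize K y)"
    using pos
  proof eventually_elim
    fix y :: "nat \<Rightarrow> real" assume "\<forall>i\<in>{1..K}. y i > 0"
    from H[OF this] show "H y / (real K * (real K + 1)) = W y * G (simplex_normalize K y)"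
      unfolding W_def by simp
  qed
  ultimately have "has_bochner_integral ?Y (\<lambda>y. W y * G (simplex_normalize K y)) c"
    using h W measurable_compose[OF n G]
    by (subst (asm) has_bochner_integral_cong_AE) (auto simp: has_bochner_integral_iff)
  then have "has_bochner_integral (density ?Y (\<lambda>y. ennreal (W y))) (\<lambda>y. G (simplex_normalize K y)) c"
    using W measurable_compose[OF n G] by (intro has_bochner_integral_density) (auto simp: W_def)
  then have "has_bochner_integral (distr (density ?Y (\<lambda>y. ennreal (W y))) (simplex_space K) (simplex_normalize K)) G c"
    using n G by (intro has_bochner_integral_distr) auto
  moreover have "concrete K \<beta> \<tau> = distr (density ?Y (\<lambda>y. ennreal (W y))) (simplex_space K) (simplex_normalize K)"
    unfolding W_def by (rule concrete_eq_distr_frechet[OF K \<beta> \<tau>])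
  ultimately show ?thesis by (simp only:)
qed

section \<open>Measurability of score products and Hessian entries\<close>

lemma borel_measurable_score [measurable]:
  "(\<lambda>x. score K x A \<theta>) \<in> borel_measurable (\<Pi>\<^sub>M i\<in>{1..K}. borel)"
  unfolding score_def mean_coeff_def log_coeff_def term_weight_def by measurable

lemma borel_measurable_hess [measurable]:
  assumes "A \<in> {1..K+1}"
  shows "(\<lambda>x. hess K x A B \<theta>) \<in> borel_measurable (\<Pi>\<^sub>M i\<in>{1..K}. borel)"
proof (cases "A = K + 1")
  case True
  then show ?thesis
    unfolding hess_def mean_coeff_def log_coeff_def term_weight_def by simp
next
  case False
  with assms have [measurable]: "(\<lambda>x. x A) \<in> borel_measurable (\<Pi>\<^sub>M i\<in>{1..K}. (borel :: real measure))"
    by (intro measurable_component_singleton) auto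
  show ?thesis
    unfolding hess_def mean_coeff_def log_coeff_def term_weight_def by measurable
qed

lemma log_lik_derivs_simplex:
  assumes K: "K \<ge> 1" and x: "x \<in> prob_simplex K"
    and A: "A \<in> {1..K+1}" and B: "B \<in> {1..K+1}" and \<theta>: "\<forall>i\<in>{1..K+1}. \<theta> i > 0"
  shows "score_prod K \<theta> A B x = (if \<forall>i\<in>{1..K}. x i > 0 then score K x A \<theta> * score K x B \<theta> else 0)"
    "log_lik_hess K \<theta> A B x = (if \<forall>i\<in>{1..K}. x i > 0 then hess K x A B \<theta> else 0)"
proof -
  have "score_prod K \<theta> A B x = (if \<forall>i\<in>{1..K}. x i > 0 then score K x A \<theta> * score K x B \<theta> else 0) \<and>
    log_lik_hess K \<theta> A B x = (if \<forall>i\<in>{1..K}. x i > 0 then hess K x A B \<theta> else 0)"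
  proof (cases "\<forall>i\<in>{1..K}. x i > 0")
    case True
    then have p: "\<And>i. i \<in> {1..K} \<Longrightarrow> x i > 0" by blast
    have "pderiv_at A (log_lik K x) \<theta> = score K x A \<theta>" "pderiv_at B (log_lik K x) \<theta> = score K x B \<theta>"
      "pderiv_at A (pderiv_at B (log_lik K x)) \<theta> = hess K x A B \<theta>"
      by (rule pderiv_log_lik[OF K p A \<theta>], assumption, rule pderiv_log_lik[OF K p B \<theta>], assumption,
          rule pderiv_pderiv_log_lik[OF K p A B \<theta>], assumption)
    then show ?thesis unfolding score_prod_def log_lik_hess_def if_P[OF True] by simp
  next
    case False
    then obtain i where i: "i \<in> {1..K}" "\<not> x i > 0" by blast
    then have "x i = 0" using x by (force simp: prob_simplex_def)
    from pderiv_log_lik_face[of i K x, OF i(1) this] show ?thesis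
      unfolding score_prod_def log_lik_hess_def using False by (simp only: mult_zero_left if_False simp_thms)
  qed
  then show "score_prod K \<theta> A B x = (if \<forall>i\<in>{1..K}. x i > 0 then score K x A \<theta> * score K x B \<theta> else 0)"
    "log_lik_hess K \<theta> A B x = (if \<forall>i\<in>{1..K}. x i > 0 then hess K x A B \<theta> else 0)" by auto
qed

text \<open>Both functions are defined through \<open>deriv\<close>; measurability in x is inherited
  from closed formulas that agree with them on the whole simplex, boundary values included.\<close>

lemma borel_measurable_log_lik_derivs:
  assumes K: "K \<ge> 1" and A: "A \<in> {1..K+1}" and B: "B \<in> {1..K+1}" and \<theta>: "\<forall>i\<in>{1..K+1}. \<theta> i > 0"
  shows "score_prod K \<theta> A B \<in> borel_measurable (simplex_space K)"
    "log_lik_hess K \<theta> A B \<in> borel_measurable (simplex_space K)"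
proof -
  note borel_measurable_hess[OF A, measurable]
  have "(\<lambda>x. if \<forall>i\<in>{1..K}. x i > 0 then score K x A \<theta> * score K x B \<theta> else 0) \<in> borel_measurable (simplex_space K)"
    by (intro measurable_restrict_space1) measurable
  then show "score_prod K \<theta> A B \<in> borel_measurable (simplex_space K)"
    by (subst measurable_cong[OF log_lik_derivs_simplex(1)[OF K _ A B \<theta>]]) (simp_all add: space_restrict_space)
  have "(\<lambda>x. if \<forall>i\<in>{1..K}. x i > 0 then hess K x A B \<theta> else 0) \<in> borel_measurable (simplex_space K)"
    by (intro measurable_restrict_space1) measurable
  then show "log_lik_hess K \<theta> A B \<in> borel_measurable (simplex_space K)"
    by (subst measurable_cong[OF log_lik_derivs_simplex(2)[OF K _ A B \<theta>]]) (simp_all add: space_restrict_space)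
qed

text \<open>The scale of \<open>y\<close> adds a common constant \<open>c\<close> to the logarithms of the coordinates of its
  normalization; it drops out of score and Hessian because the weights sum to one.\<close>

locale positive_point =
  fixes K :: nat and \<beta> :: "nat \<Rightarrow> real" and \<tau> :: real and y :: "nat \<Rightarrow> real"
  assumes K: "K \<ge> 1" and \<beta>: "\<forall>i\<in>{1..K}. \<beta> i > 0" and \<tau>: "\<tau> > 0" and y: "\<forall>i\<in>{1..K}. y i > 0"
begin

abbreviation "x \<equiv> simplex_normalize K y"
abbreviation "\<theta> \<equiv> coords K \<beta> \<tau>"
abbreviation "e i \<equiv> frechet_e \<beta> \<tau> i (y i)"
abbreviation "v i \<equiv> frechet_v \<tau> i (y i)"

definition S :: real where "S = (\<Sum>i=1..K. e i)"
text \<open>Besides the scale of y, the constant undoes the centring in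
  \<open>frechet_v\<close>.\<close>

definition c :: real where "c = euler_mascheroni / \<tau> - ln (\<Sum>j=1..K. y j)"

lemma \<theta>_simps: "\<theta> (K + 1) = \<tau>" "i \<in> {1..K} \<Longrightarrow> \<theta> i = \<beta> i"
  by (auto simp: coords_def)

lemma S_pos: "S > 0"
  unfolding S_def
proof (rule sum_pos)
  show "e i > 0" if "i \<in> {1..K}" for i
  proof -
    have "\<beta> i > 0" "y i > 0" using that \<beta> y by auto
    then show ?thesis by (simp add: frechet_e_def)
  qed
qed (use K in auto)

lemma ln_x:
  assumes i: "i \<in> {1..K}"
  shows "ln (x i) = v i / \<tau> + c"
proof -
  have "y i > 0" using y i by auto
  then show ?thesis
    unfolding simplex_normalize_pos(1)[OF y i] using simplex_normalize_pos(2)[OF y i] \<tau>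
    by (simp add: ln_div frechet_v_def c_def field_simps)
qed

text \<open>The terms of the partition sum are homogeneous of the same degree in x, so normalizing y
  multiplies each of them by the same T, which cancels.\<close>

lemma term_weight_eq:
  assumes i: "i \<in> {1..K}"
  shows "term_weight K x \<theta> i = e i / S"
proof -
  define T where "T = (\<Sum>j=1..K. y j) powr \<tau>"
  have T: "T > 0" using simplex_normalize_pos(2)[OF y i] by (simp add: T_def)
  have u: "\<theta> j / x j powr \<theta> (K + 1) = e j * T" if j: "j \<in> {1..K}" for j
  proof -
    have "y j > 0" using y j by auto
    then show ?thesis
      unfolding \<theta>_simps(1) \<theta>_simps(2)[OF j] using simplex_normalize_pos[OF y j]
      by (simp add: frechet_e_def T_def powr_divide)
  qed
  have Q: "(\<Sum>j=1..K. \<theta> j / x j powr \<theta> (K + 1)) = S * T"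
    unfolding S_def sum_distrib_right by (intro sum.cong u refl)
  show ?thesis using T unfolding term_weight_def u[OF i] Q by simp
qed

lemma sum_term_weight: "(\<Sum>j=1..K. term_weight K x \<theta> j * f j) = (\<Sum>j=1..K. e j * f j) / S"
  unfolding sum_divide_distrib by (intro sum.cong refl) (subst term_weight_eq, auto)

lemma mean_coeff_site:
  assumes i: "i \<in> {1..K}"
  shows "mean_coeff K x i \<theta> = e i / S / \<beta> i"
proof -
  have "mean_coeff K x i \<theta> = (\<Sum>j=1..K. if j = i then term_weight K x \<theta> i * (1 / \<theta> i) else 0)"
    unfolding mean_coeff_def using i by (intro sum.cong) (auto simp: log_coeff_def)
  also have "\<dots> = term_weight K x \<theta> i * (1 / \<theta> i)" using i by simp
  finally show ?thesis unfolding term_weight_eq[OF i] \<theta>_simps(2)[OF i] by simp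
qed

lemma mean_coeff_log: "mean_coeff K x (K + 1) \<theta> = - ((\<Sum>j=1..K. e j * v j) / S / \<tau> + c)"
proof -
  have "mean_coeff K x (K + 1) \<theta> = (\<Sum>j=1..K. term_weight K x \<theta> j * (- (v j / \<tau> + c)))"
    unfolding mean_coeff_def by (intro sum.cong refl) (simp add: log_coeff_def ln_x)
  also have "\<dots> = (\<Sum>j=1..K. (- 1 / \<tau>) * (e j * v j) - c * e j) / S"
    unfolding sum_term_weight
    by (intro arg_cong2[where f = "(/)"] sum.cong refl) (simp add: algebra_simps)
  also have "\<dots> = ((- 1 / \<tau>) * (\<Sum>j=1..K. e j * v j) - c * S) / S"
    by (simp only: sum_subtractf S_def sum_distrib_left)
  also have "\<dots> = - ((\<Sum>j=1..K. e j * v j) / S / \<tau> + c)"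
    using S_pos \<tau> by (simp add: field_simps)
  finally show ?thesis .
qed

lemma score_site:
  assumes i: "i \<in> {1..K}"
  shows "S * score K x i \<theta> = (S - real K * e i) / \<beta> i"
proof -
  have "i \<noteq> K + 1" "\<beta> i > 0" using i \<beta> by auto
  then show ?thesis
    unfolding score_def mean_coeff_site[OF i] \<theta>_simps(2)[OF i] using S_pos by (simp add: field_simps)
qed

lemma score_log: "S * score K x (K + 1) \<theta> =
  ((real K - 1) * S + real K * (\<Sum>j=1..K. e j * v j) - S * (\<Sum>j=1..K. v j)) / \<tau>"
proof -
  have l: "(\<Sum>j=1..K. ln (x j)) = (\<Sum>j=1..K. v j) / \<tau> + real K * c"
    using ln_x by (simp add: sum.distrib sum_divide_distrib)
  \<comment> \<open>The constant c cancels: - K c from the sum of the logarithms against K c from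
    the weighted mean.\<close>
  have "S * ((k - 1) / \<tau> - (V / \<tau> + k * c) - k * (- (A / S / \<tau> + c))) = ((k - 1) * S + k * A - S * V) / \<tau>" for k V A
    using S_pos \<tau> by (simp add: field_simps)
  then show ?thesis
    unfolding score_def mean_coeff_log l \<theta>_simps(1) by simp
qed

text \<open>On the diagonal the second moment of \<open>log_coeff\<close> equals the correction
  term, so the two cancel; the product of the means and, for i = j,
  \<open>- 1 / (\<beta> i)\<^sup>2\<close> are left.\<close>

lemma hess_site_site:
  assumes i: "i \<in> {1..K}" and j: "j \<in> {1..K}"
  shows "S\<^sup>2 * hess K x i j \<theta> = (real K * (e i * e j) - (if i = j then S\<^sup>2 else 0)) / (\<beta> i * \<beta> j)"
proof -
  have "(\<Sum>k=1..K. term_weight K x \<theta> k * log_coeff K x i \<theta> k * log_coeff K x j \<theta> k) =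
      (\<Sum>k=1..K. if k = i then if i = j then term_weight K x \<theta> i / (\<theta> i)\<^sup>2 else 0 else 0)"
    using i j by (intro sum.cong) (auto simp: log_coeff_def power2_eq_square)
  also have "\<dots> = (if i = j then term_weight K x \<theta> i / (\<theta> i)\<^sup>2 else 0)" using i by simp
  finally have q: "(\<Sum>k=1..K. term_weight K x \<theta> k * log_coeff K x i \<theta> k * log_coeff K x j \<theta> k) =
      (if i = j then term_weight K x \<theta> i / (\<theta> i)\<^sup>2 else 0)" .
  have ne: "i \<noteq> K + 1" "\<beta> i > 0" "\<beta> j > 0" using i j \<beta> by auto
  show ?thesis
    unfolding hess_def q mean_coeff_site[OF i] mean_coeff_site[OF j] \<theta>_simps(2)[OF i]
    using ne S_pos by (auto simp: field_simps power2_eq_square)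
qed

lemma sum_coeff_site_log:
  assumes i: "i \<in> {1..K}"
  shows "(\<Sum>k=1..K. term_weight K x \<theta> k * log_coeff K x i \<theta> k * log_coeff K x (K + 1) \<theta> k) =
    - (e i / S / \<beta> i * (v i / \<tau> + c))"
proof -
  have "(\<Sum>k=1..K. term_weight K x \<theta> k * log_coeff K x i \<theta> k * log_coeff K x (K + 1) \<theta> k) =
      (\<Sum>k=1..K. if k = i then - (term_weight K x \<theta> i / \<theta> i * ln (x i)) else 0)"
    using i by (intro sum.cong) (auto simp: log_coeff_def)
  also have "\<dots> = - (term_weight K x \<theta> i / \<theta> i * ln (x i))" using i by simp
  finally show ?thesis unfolding term_weight_eq[OF i] \<theta>_simps(2)[OF i] ln_x[OF i] .
qed

text \<open>A covariance under the weights, hence unaffected by the shift c of the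
  logarithms.\<close>

lemma hess_site_log:
  assumes i: "i \<in> {1..K}"
  shows "S\<^sup>2 * hess K x i (K + 1) \<theta> = - (real K / (\<beta> i * \<tau>)) * (e i * ((\<Sum>j=1..K. e j * v j) - S * v i))"
    and "hess K x (K + 1) i \<theta> = hess K x i (K + 1) \<theta>"
proof -
  have ne: "i \<noteq> K + 1" "\<beta> i > 0" using i \<beta> by auto
  have "S\<^sup>2 * (0 - k * (- (E / S / b * (V / \<tau> + c)) - E / S / b * - (A / S / \<tau> + c) - 0)) =
      - (k / (b * \<tau>)) * (E * (A - S * V))" if "b > 0" for k E b V A
    using S_pos \<tau> that by (simp add: field_simps power2_eq_square)
  then show "S\<^sup>2 * hess K x i (K + 1) \<theta> = - (real K / (\<beta> i * \<tau>)) * (e i * ((\<Sum>j=1..K. e j * v j) - S * v i))"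
    unfolding hess_def sum_coeff_site_log[OF i] mean_coeff_site[OF i] mean_coeff_log
    using ne by simp
  have "(\<Sum>k=1..K. term_weight K x \<theta> k * log_coeff K x (K + 1) \<theta> k * log_coeff K x i \<theta> k) =
      (\<Sum>k=1..K. term_weight K x \<theta> k * log_coeff K x i \<theta> k * log_coeff K x (K + 1) \<theta> k)"
    by (intro sum.cong refl) (simp only: mult_ac)
  then show "hess K x (K + 1) i \<theta> = hess K x i (K + 1) \<theta>"
    unfolding hess_def using ne by (simp add: mult.commute)
qed

text \<open>The variance of \<open>v / \<tau> + c\<close> under the weights does not involve c. The
  summand with K - 1 comes from the power of \<tau> in the density.\<close>

lemma hess_log_log:
  "S\<^sup>2 * hess K x (K + 1) (K + 1) \<theta> =
    - ((real K - 1) * S\<^sup>2 + real K * (S * (\<Sum>j=1..K. e j * (v j)\<^sup>2) - (\<Sum>j=1..K. e j * v j)\<^sup>2)) / \<tau>\<^sup>2"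
proof -
  let ?Q = "\<Sum>j=1..K. e j * (v j)\<^sup>2" and ?A = "\<Sum>j=1..K. e j * v j"
  have "(\<Sum>k=1..K. term_weight K x \<theta> k * log_coeff K x (K + 1) \<theta> k * log_coeff K x (K + 1) \<theta> k) =
      (\<Sum>k=1..K. term_weight K x \<theta> k * (v k / \<tau> + c)\<^sup>2)"
  proof (rule sum.cong)
    fix k assume k: "k \<in> {1..K}"
    have "w * - a * - a = w * a\<^sup>2" for w a :: real by (simp add: power2_eq_square)
    then show "term_weight K x \<theta> k * log_coeff K x (K + 1) \<theta> k * log_coeff K x (K + 1) \<theta> k =
        term_weight K x \<theta> k * (v k / \<tau> + c)\<^sup>2"
      by (simp only: log_coeff_def ln_x[OF k] if_True simp_thms)
  qed simp
  also have "\<dots> = (\<Sum>k=1..K. e k * (v k)\<^sup>2 / \<tau>\<^sup>2 + 2 * c / \<tau> * (e k * v k) + c\<^sup>2 * e k) / S"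
    unfolding sum_term_weight using \<tau>
    by (intro arg_cong2[where f = "(/)"] sum.cong refl) (simp add: field_simps power2_eq_square)
  also have "\<dots> = (?Q / \<tau>\<^sup>2 + 2 * c / \<tau> * ?A + c\<^sup>2 * S) / S"
    by (simp only: sum.distrib S_def sum_divide_distrib[symmetric] sum_distrib_left[symmetric])
  finally have q: "(\<Sum>k=1..K. term_weight K x \<theta> k * log_coeff K x (K + 1) \<theta> k * log_coeff K x (K + 1) \<theta> k) =
      (?Q / \<tau>\<^sup>2 + 2 * c / \<tau> * ?A + c\<^sup>2 * S) / S" .
  have "S\<^sup>2 * (- (k - 1) / \<tau>\<^sup>2 - k * ((Q / \<tau>\<^sup>2 + 2 * c / \<tau> * A + c\<^sup>2 * S) / S
      - - (A / S / \<tau> + c) * - (A / S / \<tau> + c) - 0)) = - ((k - 1) * S\<^sup>2 + k * (S * Q - A\<^sup>2)) / \<tau>\<^sup>2" for k Q A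
    using S_pos \<tau> by (simp add: field_simps power2_eq_square)
  then show ?thesis
    unfolding hess_def q mean_coeff_log \<theta>_simps(1) by simp
qed

end

section \<open>The information metric\<close>

text \<open>The symmetric coefficient matrix of the claimed metric; the factor 2 of its mixed term
  arises from the two mixed blocks. The last bracket of the entry for \<tau> is half the double sum
  of squared differences, expanded.\<close>

definition fisher_value :: "nat \<Rightarrow> (nat \<Rightarrow> real) \<Rightarrow> real \<Rightarrow> nat \<Rightarrow> nat \<Rightarrow> real" where
  "fisher_value K \<beta> \<tau> A B =
    (let L = (\<Sum>j=1..K. ln (\<beta> j)); m = (\<lambda>i. (L - real K * ln (\<beta> i)) / ((real K + 1) * \<tau> * \<beta> i)) in
     if A = K + 1 then if B = K + 1
       then ((real K - 1) * (real K * pi\<^sup>2 / 6 + 1) + (real K * (\<Sum>j=1..K. (ln (\<beta> j))\<^sup>2) - L\<^sup>2)) / ((real K + 1) * \<tau>\<^sup>2)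
       else m B
     else if B = K + 1 then m A
       else (real K * (if A = B then 1 else 0) - 1) / ((real K + 1) * \<beta> A * \<beta> B))"

text \<open>Both expectations are computed independently and turn out to be opposite. The equality
  of the two expressions for the information is thus obtained with no exchange of integration and
  differentiation in the parameters.\<close>

lemma has_bochner_integral_score_prod_hess:
  assumes K: "K \<ge> 1" and \<beta>: "\<And>i. i \<in> {1..K} \<Longrightarrow> \<beta> i > 0" and \<tau>: "\<tau> > 0"
    and A: "A \<in> {1..K+1}" and B: "B \<in> {1..K+1}"
  shows "has_bochner_integral (concrete K \<beta> \<tau>) (score_prod K (coords K \<beta> \<tau>) A B) (fisher_value K \<beta> \<tau> A B)"
    "has_bochner_integral (concrete K \<beta> \<tau>) (log_lik_hess K (coords K \<beta> \<tau>) A B) (- fisher_value K \<beta> \<tau> A B)"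
proof -
  let ?\<theta> = "coords K \<beta> \<tau>" and ?Y = "\<Pi>\<^sub>M i\<in>{1..K}. frechet (\<beta> i) \<tau>"
  have \<theta>: "\<forall>i\<in>{1..K+1}. ?\<theta> i > 0" using \<beta> \<tau> by (auto simp: coords_def)
  interpret exponential_log_pairs "{1..K}" "\<lambda>i. frechet (\<beta> i) \<tau>" "frechet_e \<beta> \<tau>" "frechet_v \<tau>" "\<lambda>i. ln (\<beta> i)" "pi\<^sup>2 / 6"
    using \<beta> \<tau> by (rule exponential_log_pairs_frechet)
  let ?N = "real K * (real K + 1)"
  have N: "?N > 0" using K by auto
  have card: "real (card {1..K}) = real K" by simp
  have fin: "finite {1..K}" "{1..K} \<subseteq> {1..K}" by auto
  \<comment> \<open>H is a cleared integrand with known expectation d, s collects the prefactors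
    \<open>1 / \<beta>\<^sub>i\<close> and 1 / \<tau> and, where needed, K and a sign; the equation
    s d = K (K + 1) w determines the value w.\<close>
  have transfer: "has_bochner_integral (concrete K \<beta> \<tau>) G w"
    if G: "G \<in> borel_measurable (simplex_space K)" and h: "has_bochner_integral ?Y H d"
      and H: "\<And>y. \<forall>i\<in>{1..K}. y i > 0 \<Longrightarrow> (SE {1..K} y)\<^sup>2 * G (simplex_normalize K y) = s * H y"
      and w: "s * d = ?N * w" for G H d s w
  proof (rule has_bochner_integral_concrete[OF K \<beta> \<tau> G])
    show "has_bochner_integral ?Y (\<lambda>y. s * H y) (?N * w)"
      unfolding w[symmetric] by (rule has_bochner_integral_mult_right[OF h])
    show "(\<Sum>j=1..K. \<beta> j / y j powr \<tau>)\<^sup>2 * G (simplex_normalize K y) = s * H y" if "\<forall>i\<in>{1..K}. y i > 0" for y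
      using H[OF that] by (simp add: SE_def frechet_e_def)
  qed
  have scG: "score_prod K ?\<theta> A B (simplex_normalize K y) = score K (simplex_normalize K y) A ?\<theta> * score K (simplex_normalize K y) B ?\<theta>"
    and heG: "log_lik_hess K ?\<theta> A B (simplex_normalize K y) = hess K (simplex_normalize K y) A B ?\<theta>"
    if "\<forall>i\<in>{1..K}. y i > 0" for y
    using log_lik_derivs_simplex[OF K simplex_normalize_in[OF K, of y] A B \<theta>] simplex_normalize_pos(3)[OF that] by auto
  have pp: "positive_point K \<beta> \<tau> y" if "\<forall>i\<in>{1..K}. y i > 0" for y
    using K \<beta> \<tau> that by unfold_locales auto
  have SE: "positive_point.S K \<beta> \<tau> y = SE {1..K} y" if "\<forall>i\<in>{1..K}. y i > 0" for y
    by (simp add: positive_point.S_def[OF pp[OF that]] SE_def)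
  have scs: "SE {1..K} y * score K (simplex_normalize K y) i ?\<theta> = (SE {1..K} y - real K * frechet_e \<beta> \<tau> i (y i)) / \<beta> i"
    if y: "\<forall>i\<in>{1..K}. y i > 0" and i: "i \<in> {1..K}" for y i
    using positive_point.score_site[OF pp[OF y] i] unfolding SE[OF y] .
  have scl: "SE {1..K} y * score K (simplex_normalize K y) (K + 1) ?\<theta> =
      ((real K - 1) * SE {1..K} y + real K * SEV {1..K} y - SE {1..K} y * SV {1..K} y) / \<tau>"
    if y: "\<forall>i\<in>{1..K}. y i > 0" for y
    using positive_point.score_log[OF pp[OF y]] unfolding SE[OF y] SEV_def SV_def .
  have hss: "(SE {1..K} y)\<^sup>2 * hess K (simplex_normalize K y) i j ?\<theta> =
      (real K * (frechet_e \<beta> \<tau> i (y i) * frechet_e \<beta> \<tau> j (y j)) - (if i = j then (SE {1..K} y)\<^sup>2 else 0)) / (\<beta> i * \<beta> j)"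
    if y: "\<forall>i\<in>{1..K}. y i > 0" and i: "i \<in> {1..K}" and j: "j \<in> {1..K}" for y i j
    using positive_point.hess_site_site[OF pp[OF y] i j] unfolding SE[OF y] .
  have hsl: "(SE {1..K} y)\<^sup>2 * hess K (simplex_normalize K y) i (K + 1) ?\<theta> =
      - (real K / (\<beta> i * \<tau>)) * (frechet_e \<beta> \<tau> i (y i) * (SEV {1..K} y - SE {1..K} y * frechet_v \<tau> i (y i)))"
    "hess K (simplex_normalize K y) (K + 1) i ?\<theta> = hess K (simplex_normalize K y) i (K + 1) ?\<theta>"
    if y: "\<forall>i\<in>{1..K}. y i > 0" and i: "i \<in> {1..K}" for y i
    using positive_point.hess_site_log[OF pp[OF y] i] unfolding SE[OF y] SEV_def .
  have hll: "(SE {1..K} y)\<^sup>2 * hess K (simplex_normalize K y) (K + 1) (K + 1) ?\<theta> =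
      - ((real K - 1) * (SE {1..K} y)\<^sup>2 + real K * (SE {1..K} y * SEV2 {1..K} y - (SEV {1..K} y)\<^sup>2)) / \<tau>\<^sup>2"
    if y: "\<forall>i\<in>{1..K}. y i > 0" for y
    using positive_point.hess_log_log[OF pp[OF y]] unfolding SE[OF y] SEV_def SEV2_def .
  note meas = borel_measurable_log_lik_derivs[OF K A B \<theta>]
  have split: "(SE {1..K} y)\<^sup>2 * (score K (simplex_normalize K y) A ?\<theta> * score K (simplex_normalize K y) B ?\<theta>) =
      (SE {1..K} y * score K (simplex_normalize K y) A ?\<theta>) * (SE {1..K} y * score K (simplex_normalize K y) B ?\<theta>)" for y
    by (simp add: power2_eq_square)
  have K1: "real K \<ge> 1" using K by simp
  \<comment> \<open>A factor K, sitting in the moment or in the prefactor, cancels against K (K + 1)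
    and leaves the K + 1 of the metric.\<close>
  have scale: "1 / (b * t) * (k * u) = k * (k + 1) * (u / ((k + 1) * t * b))"
    "- (k / (b * t)) * u = k * (k + 1) * - (u / ((k + 1) * t * b))"
    if "b > 0" "t > 0" "k \<ge> 1" for b t k u :: real
    using that by (simp_all add: divide_simps)
  consider "A = K + 1" "B = K + 1" | "A \<in> {1..K}" "B = K + 1" | "A = K + 1" "B \<in> {1..K}" | "A \<in> {1..K}" "B \<in> {1..K}"
    using A B by force
  then have "has_bochner_integral (concrete K \<beta> \<tau>) (score_prod K ?\<theta> A B) (fisher_value K \<beta> \<tau> A B) \<and>
    has_bochner_integral (concrete K \<beta> \<tau>) (log_lik_hess K ?\<theta> A B) (- fisher_value K \<beta> \<tau> A B)"
  proof cases
    case 1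
    let ?d = "(real K - 1) * (real K * pi\<^sup>2 / 6 + 1) + (real K * (\<Sum>j=1..K. (ln (\<beta> j))\<^sup>2) - (\<Sum>j=1..K. ln (\<beta> j))\<^sup>2)"
    have val: "fisher_value K \<beta> \<tau> A B = ?d / ((real K + 1) * \<tau>\<^sup>2)"
      using 1 by (simp add: fisher_value_def Let_def)
    show ?thesis
    proof
      show "has_bochner_integral (concrete K \<beta> \<tau>) (score_prod K ?\<theta> A B) (fisher_value K \<beta> \<tau> A B)"
      proof (rule transfer[OF meas(1) score_moment_log_log[OF fin, unfolded card], where s = "1 / \<tau>\<^sup>2"])
        fix y :: "nat \<Rightarrow> real" assume y: "\<forall>i\<in>{1..K}. y i > 0"
        show "(SE {1..K} y)\<^sup>2 * score_prod K ?\<theta> A B (simplex_normalize K y) =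
            1 / \<tau>\<^sup>2 * ((real K - 1) * SE {1..K} y + real K * SEV {1..K} y - SE {1..K} y * SV {1..K} y)\<^sup>2"
          unfolding scG[OF y] split unfolding 1 scl[OF y] by (simp add: power2_eq_square)
      next
        show "1 / \<tau>\<^sup>2 * (real K * ((real K - 1) * (real K * (pi\<^sup>2 / 6) + 1) + real K * (\<Sum>i\<in>{1..K}. (ln (\<beta> i))\<^sup>2) - (\<Sum>i\<in>{1..K}. ln (\<beta> i))\<^sup>2)) =
            ?N * fisher_value K \<beta> \<tau> A B"
        proof -
          have scale: "1 / t * (k * u) = k * (k + 1) * (w / ((k + 1) * t))" if "t > 0" "k \<ge> 1" "u = w" for t k u w :: real
            using that by (simp add: divide_simps)
          show ?thesis unfolding val by (rule scale) (use K \<tau> in auto)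
        qed
      qed
      have "has_bochner_integral ?Y (\<lambda>y. (real K - 1) * (SE {1..K} y)\<^sup>2 + real K * (SE {1..K} y * SEV2 {1..K} y - (SEV {1..K} y)\<^sup>2))
          ((real K - 1) * ?N + real K * (real K * (\<Sum>i\<in>{1..K}. (ln (\<beta> i))\<^sup>2) - (\<Sum>i\<in>{1..K}. ln (\<beta> i))\<^sup>2 + real K * (real K - 1) * (pi\<^sup>2 / 6 - 1)))"
        by (intro has_bochner_integral_add has_bochner_integral_mult_right
            second_moment_SE[OF fin, unfolded card] hess_moment_log_log[OF fin, unfolded card])
      then show "has_bochner_integral (concrete K \<beta> \<tau>) (log_lik_hess K ?\<theta> A B) (- fisher_value K \<beta> \<tau> A B)"
      proof (rule transfer[OF meas(2), where s = "- 1 / \<tau>\<^sup>2"])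
        fix y :: "nat \<Rightarrow> real" assume y: "\<forall>i\<in>{1..K}. y i > 0"
        show "(SE {1..K} y)\<^sup>2 * log_lik_hess K ?\<theta> A B (simplex_normalize K y) =
            - 1 / \<tau>\<^sup>2 * ((real K - 1) * (SE {1..K} y)\<^sup>2 + real K * (SE {1..K} y * SEV2 {1..K} y - (SEV {1..K} y)\<^sup>2))"
          unfolding heG[OF y] unfolding 1 hll[OF y] using \<tau> by (simp add: field_simps)
      next
        \<comment> \<open>The two contributions merge through (k + 1) + k (z - 1) = k z + 1.\<close>
        have "- 1 / t * ((k - 1) * (k * (k + 1)) + k * (C + k * (k - 1) * (z - 1))) =
            k * (k + 1) * - (((k - 1) * (k * z + 1) + C) / ((k + 1) * t))" if "t > 0" "k \<ge> 1" for t k C z :: real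
        proof -
          have "k + 1 \<noteq> 0" "t \<noteq> 0" using that by auto
          then show ?thesis by (simp add: divide_simps) (simp add: algebra_simps)
        qed
        from this[of "\<tau>\<^sup>2" "real K" _ "pi\<^sup>2 / 6"] \<tau> K
        show "- 1 / \<tau>\<^sup>2 * ((real K - 1) * ?N + real K * (real K * (\<Sum>i\<in>{1..K}. (ln (\<beta> i))\<^sup>2) - (\<Sum>i\<in>{1..K}. ln (\<beta> i))\<^sup>2 + real K * (real K - 1) * (pi\<^sup>2 / 6 - 1))) =
            ?N * - fisher_value K \<beta> \<tau> A B"
          unfolding val by simp
      qed
    qed
  next
    case 2
    have b: "\<beta> A > 0" using \<beta>[OF 2(1)] .
    have val: "fisher_value K \<beta> \<tau> A B = ((\<Sum>j=1..K. ln (\<beta> j)) - real K * ln (\<beta> A)) / ((real K + 1) * \<tau> * \<beta> A)"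
      using 2 by (auto simp: fisher_value_def Let_def)
    show ?thesis
    proof
      show "has_bochner_integral (concrete K \<beta> \<tau>) (score_prod K ?\<theta> A B) (fisher_value K \<beta> \<tau> A B)"
      proof (rule transfer[OF meas(1) score_moment_site_log[OF fin 2(1), unfolded card], where s = "1 / (\<beta> A * \<tau>)"])
        fix y :: "nat \<Rightarrow> real" assume y: "\<forall>i\<in>{1..K}. y i > 0"
        show "(SE {1..K} y)\<^sup>2 * score_prod K ?\<theta> A B (simplex_normalize K y) =
            1 / (\<beta> A * \<tau>) * ((SE {1..K} y - real K * frechet_e \<beta> \<tau> A (y A)) * ((real K - 1) * SE {1..K} y + real K * SEV {1..K} y - SE {1..K} y * SV {1..K} y))"
          unfolding scG[OF y] split unfolding 2(2) scl[OF y] scs[OF y 2(1)] by simp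
      next
        show "1 / (\<beta> A * \<tau>) * (real K * ((\<Sum>i\<in>{1..K}. ln (\<beta> i)) - real K * ln (\<beta> A))) = ?N * fisher_value K \<beta> \<tau> A B"
          unfolding val by (rule scale(1)[OF b \<tau> K1])
      qed
      show "has_bochner_integral (concrete K \<beta> \<tau>) (log_lik_hess K ?\<theta> A B) (- fisher_value K \<beta> \<tau> A B)"
      proof (rule transfer[OF meas(2) hess_moment_site_log[OF fin 2(1), unfolded card], where s = "- (real K / (\<beta> A * \<tau>))"])
        fix y :: "nat \<Rightarrow> real" assume y: "\<forall>i\<in>{1..K}. y i > 0"
        show "(SE {1..K} y)\<^sup>2 * log_lik_hess K ?\<theta> A B (simplex_normalize K y) =
            - (real K / (\<beta> A * \<tau>)) * (frechet_e \<beta> \<tau> A (y A) * (SEV {1..K} y - SE {1..K} y * frechet_v \<tau> A (y A)))"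
          unfolding heG[OF y] unfolding 2(2) hsl(1)[OF y 2(1)] ..
      next
        show "- (real K / (\<beta> A * \<tau>)) * ((\<Sum>i\<in>{1..K}. ln (\<beta> i)) - real K * ln (\<beta> A)) = ?N * - fisher_value K \<beta> \<tau> A B"
          unfolding val by (rule scale(2)[OF b \<tau> K1])
      qed
    qed
  next
    case 3
    have b: "\<beta> B > 0" using \<beta>[OF 3(2)] .
    have val: "fisher_value K \<beta> \<tau> A B = ((\<Sum>j=1..K. ln (\<beta> j)) - real K * ln (\<beta> B)) / ((real K + 1) * \<tau> * \<beta> B)"
      using 3 by (auto simp: fisher_value_def Let_def)
    show ?thesis
    proof
      show "has_bochner_integral (concrete K \<beta> \<tau>) (score_prod K ?\<theta> A B) (fisher_value K \<beta> \<tau> A B)"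
      proof (rule transfer[OF meas(1) score_moment_site_log[OF fin 3(2), unfolded card], where s = "1 / (\<beta> B * \<tau>)"])
        fix y :: "nat \<Rightarrow> real" assume y: "\<forall>i\<in>{1..K}. y i > 0"
        show "(SE {1..K} y)\<^sup>2 * score_prod K ?\<theta> A B (simplex_normalize K y) =
            1 / (\<beta> B * \<tau>) * ((SE {1..K} y - real K * frechet_e \<beta> \<tau> B (y B)) * ((real K - 1) * SE {1..K} y + real K * SEV {1..K} y - SE {1..K} y * SV {1..K} y))"
          unfolding scG[OF y] split unfolding 3(1) scl[OF y] scs[OF y 3(2)] by (simp add: mult.commute)
      next
        show "1 / (\<beta> B * \<tau>) * (real K * ((\<Sum>i\<in>{1..K}. ln (\<beta> i)) - real K * ln (\<beta> B))) = ?N * fisher_value K \<beta> \<tau> A B"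
          unfolding val by (rule scale(1)[OF b \<tau> K1])
      qed
      show "has_bochner_integral (concrete K \<beta> \<tau>) (log_lik_hess K ?\<theta> A B) (- fisher_value K \<beta> \<tau> A B)"
      proof (rule transfer[OF meas(2) hess_moment_site_log[OF fin 3(2), unfolded card], where s = "- (real K / (\<beta> B * \<tau>))"])
        fix y :: "nat \<Rightarrow> real" assume y: "\<forall>i\<in>{1..K}. y i > 0"
        show "(SE {1..K} y)\<^sup>2 * log_lik_hess K ?\<theta> A B (simplex_normalize K y) =
            - (real K / (\<beta> B * \<tau>)) * (frechet_e \<beta> \<tau> B (y B) * (SEV {1..K} y - SE {1..K} y * frechet_v \<tau> B (y B)))"
          \<comment> \<open>The second derivatives in either order coincide, which reduces this
            entry to the transposed one.\<close>
          unfolding heG[OF y] unfolding 3(1) hsl(2)[OF y 3(2)] hsl(1)[OF y 3(2)] ..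
      next
        show "- (real K / (\<beta> B * \<tau>)) * ((\<Sum>i\<in>{1..K}. ln (\<beta> i)) - real K * ln (\<beta> B)) = ?N * - fisher_value K \<beta> \<tau> A B"
          unfolding val by (rule scale(2)[OF b \<tau> K1])
      qed
    qed
  next
    case 4
    have b: "\<beta> A > 0" "\<beta> B > 0" using \<beta>[OF 4(1)] \<beta>[OF 4(2)] .
    have val: "fisher_value K \<beta> \<tau> A B = (real K * (if A = B then 1 else 0) - 1) / ((real K + 1) * \<beta> A * \<beta> B)"
      using 4 by (auto simp: fisher_value_def Let_def)
    show ?thesis
    proof
      show "has_bochner_integral (concrete K \<beta> \<tau>) (score_prod K ?\<theta> A B) (fisher_value K \<beta> \<tau> A B)"
      proof (rule transfer[OF meas(1) score_moment_site_site[OF fin 4, unfolded card], where s = "1 / (\<beta> A * \<beta> B)"])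
        fix y :: "nat \<Rightarrow> real" assume y: "\<forall>i\<in>{1..K}. y i > 0"
        show "(SE {1..K} y)\<^sup>2 * score_prod K ?\<theta> A B (simplex_normalize K y) =
            1 / (\<beta> A * \<beta> B) * ((SE {1..K} y - real K * frechet_e \<beta> \<tau> A (y A)) * (SE {1..K} y - real K * frechet_e \<beta> \<tau> B (y B)))"
          unfolding scG[OF y] split scs[OF y 4(1)] scs[OF y 4(2)] by simp
      next
        show "1 / (\<beta> A * \<beta> B) * (real K * (real K * (if A = B then 1 else 0) - 1)) = ?N * fisher_value K \<beta> \<tau> A B"
          unfolding val mult.commute[of "\<beta> A" "\<beta> B"] by (rule scale(1)[OF b(2,1) K1])
      qed
      have "has_bochner_integral ?Y (\<lambda>y. real K * (frechet_e \<beta> \<tau> A (y A) * frechet_e \<beta> \<tau> B (y B)) - (if A = B then 1 else 0) * (SE {1..K} y)\<^sup>2)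
          (real K * (if A = B then 2 else 1) - (if A = B then 1 else 0) * ?N)"
        by (intro has_bochner_integral_diff has_bochner_integral_mult_right
            second_moment_SE[OF fin, unfolded card] has_bochner_integral_site_site[OF fin 4])
      then show "has_bochner_integral (concrete K \<beta> \<tau>) (log_lik_hess K ?\<theta> A B) (- fisher_value K \<beta> \<tau> A B)"
      proof (rule transfer[OF meas(2), where s = "1 / (\<beta> A * \<beta> B)"])
        fix y :: "nat \<Rightarrow> real" assume y: "\<forall>i\<in>{1..K}. y i > 0"
        show "(SE {1..K} y)\<^sup>2 * log_lik_hess K ?\<theta> A B (simplex_normalize K y) =
            1 / (\<beta> A * \<beta> B) * (real K * (frechet_e \<beta> \<tau> A (y A) * frechet_e \<beta> \<tau> B (y B)) - (if A = B then 1 else 0) * (SE {1..K} y)\<^sup>2)"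
          unfolding heG[OF y] hss[OF y 4] by simp
      next
        \<comment> \<open>On the diagonal 2 K - K (K + 1) = - K (K - 1); off it K stands
          alone.\<close>
        show "1 / (\<beta> A * \<beta> B) * (real K * (if A = B then 2 else 1) - (if A = B then 1 else 0) * ?N) = ?N * - fisher_value K \<beta> \<tau> A B"
          unfolding val using K b by (simp add: divide_simps) (simp add: algebra_simps)
      qed
    qed
  qed
  then show "has_bochner_integral (concrete K \<beta> \<tau>) (score_prod K ?\<theta> A B) (fisher_value K \<beta> \<tau> A B)"
    "has_bochner_integral (concrete K \<beta> \<tau>) (log_lik_hess K ?\<theta> A B) (- fisher_value K \<beta> \<tau> A B)" by auto
qed

text \<open>When the square is expanded, each \<open>(f i)\<^sup>2\<close> occurs
  \<open>card I\<close> times from either index, and the cross terms form the square of the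
  sum.\<close>

lemma sum_squared_differences:
  fixes f :: "'a \<Rightarrow> real"
  shows "(\<Sum>i\<in>I. \<Sum>j\<in>I. (f i - f j)\<^sup>2) = 2 * (real (card I) * (\<Sum>i\<in>I. (f i)\<^sup>2) - (\<Sum>i\<in>I. f i)\<^sup>2)"
proof -
  have "(\<Sum>i\<in>I. \<Sum>j\<in>I. (f i - f j)\<^sup>2) = (\<Sum>i\<in>I. \<Sum>j\<in>I. (f i)\<^sup>2 + (f j)\<^sup>2 - 2 * (f i * f j))"
    by (intro sum.cong refl) (simp add: power2_eq_square algebra_simps)
  also have "\<dots> = 2 * (real (card I) * (\<Sum>i\<in>I. (f i)\<^sup>2) - (\<Sum>i\<in>I. f i) * (\<Sum>i\<in>I. f i))"
    unfolding sum_product by (simp add: sum.distrib sum_subtractf sum_distrib_left algebra_simps)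
  finally show ?thesis by (simp add: power2_eq_square)
qed

text \<open>Integrability is part of the claim because the Bochner integral of a non-integrable
  function is 0 by convention; with it, both formulas for the information express genuine
  expectations.\<close>

theorem theorem4p2:
  fixes K :: nat and \<beta> :: "nat \<Rightarrow> real" and \<tau> :: real
  assumes "K \<ge> 2"
    and "\<And>i. i \<in> {1..K} \<Longrightarrow> \<beta> i > 0"
    and "\<tau> > 0"
  shows "(\<forall>A\<in>{1..K+1}. \<forall>B\<in>{1..K+1}.
           integrable (concrete K \<beta> \<tau>) (score_prod K (coords K \<beta> \<tau>) A B) \<and>
           integrable (concrete K \<beta> \<tau>) (log_lik_hess K (coords K \<beta> \<tau>) A B) \<and>
           fisher_info K (coords K \<beta> \<tau>) A B
             = - (\<integral>x. log_lik_hess K (coords K \<beta> \<tau>) A B x \<partial>concrete K \<beta> \<tau>))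
       \<and> (\<forall>(d\<beta> :: nat \<Rightarrow> real) (d\<tau> :: real).
           info_metric K (coords K \<beta> \<tau>) (coords K d\<beta> d\<tau>) =
             ((real K - 1) * (real K * pi\<^sup>2 / 6 + 1)
                + 1/2 * (\<Sum>i=1..K. \<Sum>j=1..K. (ln (\<beta> i) - ln (\<beta> j))\<^sup>2))
               / ((real K + 1) * \<tau>\<^sup>2) * d\<tau>\<^sup>2
           + 2 * (\<Sum>i=1..K. ((\<Sum>j=1..K. ln (\<beta> j)) - real K * ln (\<beta> i))
                              / ((real K + 1) * \<tau> * \<beta> i) * d\<beta> i * d\<tau>)
           + (\<Sum>i=1..K. \<Sum>j=1..K. (real K * (if i = j then 1 else 0) - 1)
                              / ((real K + 1) * \<beta> i * \<beta> j) * d\<beta> i * d\<beta> j))"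
proof (intro conjI ballI allI)
  have K: "K \<ge> 1" using assms(1) by simp
  note main = has_bochner_integral_score_prod_hess[OF K assms(2,3)]
  \<comment> \<open>\<open>coords\<close> changes its argument at K + 1 only, an index at which the
    density does not evaluate it.\<close>
  have "concrete_density K (coords K \<beta> \<tau>) \<tau> = concrete_density K \<beta> \<tau>"
    unfolding concrete_density_def
    by (intro ext arg_cong2[where f = "(*)"] arg_cong2[where f = "(/)"] arg_cong2[where f = "(^)"] sum.cong prod.cong refl)
       (auto simp: coords_def)
  then have conc: "concrete K (coords K \<beta> \<tau>) (coords K \<beta> \<tau> (K + 1)) = concrete K \<beta> \<tau>"
    by (simp add: concrete_def coords_def)
  have fisher: "fisher_info K (coords K \<beta> \<tau>) A B = fisher_value K \<beta> \<tau> A B"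
    if "A \<in> {1..K+1}" "B \<in> {1..K+1}" for A B
    using main(1)[OF _ that] unfolding fisher_info_def conc by (simp add: has_bochner_integral_iff)
  show "integrable (concrete K \<beta> \<tau>) (score_prod K (coords K \<beta> \<tau>) A B)"
    "integrable (concrete K \<beta> \<tau>) (log_lik_hess K (coords K \<beta> \<tau>) A B)"
    "fisher_info K (coords K \<beta> \<tau>) A B = - (\<integral>x. log_lik_hess K (coords K \<beta> \<tau>) A B x \<partial>concrete K \<beta> \<tau>)"
    if "A \<in> {1..K+1}" "B \<in> {1..K+1}" for A B
    using main[OF _ that] fisher[OF that] by (auto simp: has_bochner_integral_iff)
  fix d\<beta> :: "nat \<Rightarrow> real" and d\<tau> :: real
  let ?F = "fisher_value K \<beta> \<tau>" and ?d = "coords K d\<beta> d\<tau>"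
  let ?m = "\<lambda>i. ((\<Sum>j=1..K. ln (\<beta> j)) - real K * ln (\<beta> i)) / ((real K + 1) * \<tau> * \<beta> i)"
  let ?t = "((real K - 1) * (real K * pi\<^sup>2 / 6 + 1) + 1/2 * (\<Sum>i=1..K. \<Sum>j=1..K. (ln (\<beta> i) - ln (\<beta> j))\<^sup>2)) / ((real K + 1) * \<tau>\<^sup>2)"
  let ?s = "\<lambda>i j. (real K * (if i = j then 1 else 0) - 1) / ((real K + 1) * \<beta> i * \<beta> j)"
  have Ft: "?F (K + 1) (K + 1) = ?t"
    unfolding sum_squared_differences by (simp add: fisher_value_def Let_def)
  have Fm: "?F (K + 1) i = ?m i" "?F i (K + 1) = ?m i" if "i \<in> {1..K}" for i
    using that by (auto simp: fisher_value_def Let_def)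
  have Fs: "?F i j = ?s i j" if "i \<in> {1..K}" "j \<in> {1..K}" for i j
    using that by (auto simp: fisher_value_def Let_def)
  have d: "?d (K + 1) = d\<tau>" "i \<in> {1..K} \<Longrightarrow> ?d i = d\<beta> i" for i
    by (auto simp: coords_def)
  have last: "(\<Sum>A=1..K+1. g A) = (\<Sum>A=1..K. g A) + g (K + 1)" for g :: "nat \<Rightarrow> real" by simp
  have "info_metric K (coords K \<beta> \<tau>) ?d = (\<Sum>A=1..K+1. \<Sum>B=1..K+1. ?F A B * ?d A * ?d B)"
    unfolding info_metric_def by (intro sum.cong refl) (simp only: fisher)
  \<comment> \<open>The index K + 1 is split off from both sums; the two mixed blocks agree after
    renaming and give the factor 2.\<close>
  also have "\<dots> = (\<Sum>i=1..K. (\<Sum>j=1..K. ?F i j * ?d i * ?d j) + ?F i (K + 1) * ?d i * d\<tau>) +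
      ((\<Sum>j=1..K. ?F (K + 1) j * d\<tau> * ?d j) + ?F (K + 1) (K + 1) * d\<tau> * d\<tau>)"
    unfolding last d(1) ..
  also have "(\<Sum>i=1..K. (\<Sum>j=1..K. ?F i j * ?d i * ?d j) + ?F i (K + 1) * ?d i * d\<tau>) =
      (\<Sum>i=1..K. (\<Sum>j=1..K. ?s i j * d\<beta> i * d\<beta> j) + ?m i * d\<beta> i * d\<tau>)"
    by (intro sum.cong arg_cong2[where f = "(+)"] refl) (simp_all only: Fs Fm d)
  also have "(\<Sum>j=1..K. ?F (K + 1) j * d\<tau> * ?d j) = (\<Sum>i=1..K. ?m i * d\<beta> i * d\<tau>)"
  proof (rule sum.cong)
    fix j assume j: "j \<in> {1..K}"
    show "?F (K + 1) j * d\<tau> * ?d j = ?m j * d\<beta> j * d\<tau>"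
      unfolding Fm(1)[OF j] d(2)[OF j] by (simp only: mult_ac)
  qed simp
  also have "(\<Sum>i=1..K. (\<Sum>j=1..K. ?s i j * d\<beta> i * d\<beta> j) + ?m i * d\<beta> i * d\<tau>) +
      ((\<Sum>i=1..K. ?m i * d\<beta> i * d\<tau>) + ?F (K + 1) (K + 1) * d\<tau> * d\<tau>) =
      ?t * d\<tau>\<^sup>2 + 2 * (\<Sum>i=1..K. ?m i * d\<beta> i * d\<tau>) + (\<Sum>i=1..K. \<Sum>j=1..K. ?s i j * d\<beta> i * d\<beta> j)"
    unfolding Ft sum.distrib power2_eq_square[of d\<tau>] by (simp only: mult_2 ac_simps)
  finally show "info_metric K (coords K \<beta> \<tau>) ?d = ?t * d\<tau>\<^sup>2 + 2 * (\<Sum>i=1..K. ?m i * d\<beta> i * d\<tau>) + (\<Sum>i=1..K. \<Sum>j=1..K. ?s i j * d\<beta> i * d\<beta> j)" .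
qed

end
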